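(* Let $l$ be the base capacity process, i.e. the unique optional process (with upper right-continuous paths) solving $$\mathbb{E}\Big\{\int_\tau^\infty e^{-\delta s}R_y\big(X(s),\sup_{\tau\le u<s}l(u)\big)\,ds\,\Big|\,\mathcal{F}_\tau\Big\}=e^{-\delta\tau},\qquad\forall\,\tau\in\mathcal{T}.$$ Then the process $$\nu_*(t):=\sup_{0\le s<t}\big(l(s)\wedge\theta(s)\big)\vee y$$ is optimal for the problem $\sup_{\nu\in\mathcal{S}_\theta}\mathcal{J}(\nu)$, and the associated Lagrange multiplier $d\lambda(t)$ is absolutely continuous with respect to the Lebesgue measure. That is, $\nu_*$ satisfies the following conditions for a nonnegative optional random measure $d\lambda(\omega,t)$ with $\mathbb{E}\{\int_0^\infty d\lambda(s)\}<\infty$ which is $\mathbb{P}$-a.s. absolutely continuous with respect to the Lebesgue measure in $t$: $\nabla_y\mathcal{J}(\nu_* )(\tau)\le\mathbb{E}\{\int_\tau^\infty d\lambda(s)|\mathcal{F}_\tau\}$ $\mathbb{P}$-a.s. for all $\tau\in\mathcal{T}$; $\int_0^\infty[\nabla_y\mathcal{J}(\nu_* )(t)-\mathbb{E}\{\int_t^\infty d\lambda(s)|\mathcal{F}_t\}]\,d\nu_*(t)=0$ $\mathbb{P}$-a.s.; $\nu_*(t)\le\theta(t)$ $\mathbb{P}$-a.s. for all $t\ge0$; and $\mathbb{E}\{\int_0^\infty(\theta(t)-\nu_*(t))\,d\lambda(t)\}=0$.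
   Context: Setting (single firm, infinite horizon). $(\Omega,\mathcal{F},\{\mathcal{F}_t\}_{t\ge0},\mathbb{P})$ is a complete filtered probability space satisfying the usual conditions; $\mathcal{T}$ is the set of stopping times with values in $[0,\infty]$. $\delta>0$ is a constant (discount factor $e^{-\delta t}$). $\theta$ is a nonnegative, nondecreasing, adapted, left-continuous process with $\theta(0)=\theta_o>0$ and $\mathbb{E}\{\theta(\infty)\}<\infty$, where $\theta(\infty)$ is the limit at infinity. $y>0$ is a constant. $X$ is a real-valued progressively measurable process. $R:\mathbb{R}\times\mathbb{R}_+\to\mathbb{R}_+$ satisfies: for every $x$, $y\mapsto R(x,y)$ is increasing, strictly concave, with $R(x,0)=0$, and has a continuous partial derivative $R_y(x,y)$ with $\lim_{y\to0}R_y(x,y)=\infty$, $\lim_{y\to\infty}R_y(x,y)=0$; and $(\omega,t)\mapsto e^{-\delta t}R(X(\omega,t),\theta(\omega,t))$ is $d\mathbb{P}\otimes dt$-integrable. $\mathcal{S}_\theta$ is the set (assumed nonempty) of nondecreasing, left-continuous, adapted processes $\nu:\Omega\times[0,\infty)\to\mathbb{R}_+$ with $\nu(0)=y$ $\mathbb{P}$-a.s. and $\nu(t)\le\theta(t)$ $\mathbb{P}$-a.s. for all $t\ge0$. The objective is $$\mathcal{J}(\nu)=\mathbb{E}\Big\{\int_0^\infty e^{-\delta t}R(X(t),\nu(t))\,dt-\int_{[0,\infty)}e^{-\delta t}\,d\nu(t)\Big\},$$ where $d\nu([s,t))=\nu(t)-\nu(s)$, and its supergradient is the optional process $$\nabla_y\mathcal{J}(\nu)(t):=\mathbb{E}\Big\{\int_t^\infty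 e^{-\delta s}R_y(X(s),\nu(s))\,ds\,\Big|\,\mathcal{F}_t\Big\}-e^{-\delta t}.$$ Upper right-continuity of $l$ means $l(t)=\limsup_{s\downarrow t}l(s)$. Existence and uniqueness of $l$ is a known consequence of the Bank--El Karoui representation theorem. *)

theory Defs
  imports "HOL-Probability.Probability"
begin

text \<open>
  Conventions. Time is \<open>real\<close>, and only times \<open>t \<ge> 0\<close> matter; a process is a map \<open>Z t \<omega>\<close>, of which only
  the values with \<open>0 \<le> t\<close> and \<open>\<omega> \<in> space M\<close> matter. Path properties hold on all of \<open>space M\<close> unless an
  \<open>AE\<close> is written. The filtration is indexed by \<open>[0,\<infinity>]\<close>, i.e. by \<open>ennreal\<close>, so that the library notions
  of stopping time and of the \<open>\<sigma>\<close>-algebra \<open>pre_sigma\<close> of a stopping time apply to \<open>[0,\<infinity>]\<close>-valued times;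
  \<open>F \<infinity>\<close> may be any sub-\<open>\<sigma>\<close>-algebra of \<open>M\<close> that contains every \<open>F t\<close>.
\<close>

subsection \<open>Filtrations and processes\<close>

definition usual_conditions :: "'a measure \<Rightarrow> (ennreal \<Rightarrow> 'a measure) \<Rightarrow> bool" where
  "usual_conditions M F \<longleftrightarrow>
     filtration (space M) F \<and> (\<forall>t. sets (F t) \<subseteq> sets M) \<and>
     null_sets M \<subseteq> sets (F 0) \<and>
     (\<forall>t<\<infinity>. sets (F t) = (\<Inter>s\<in>{t<..}. sets (F s)))"

abbreviation sigma_at :: "'a measure \<Rightarrow> (ennreal \<Rightarrow> 'a measure) \<Rightarrow> ('a \<Rightarrow> ennreal) \<Rightarrow> 'a measure" where
  "sigma_at M F \<tau> \<equiv> filtration.pre_sigma (space M) F \<tau>"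

definition adapted :: "(ennreal \<Rightarrow> 'a measure) \<Rightarrow> (real \<Rightarrow> 'a \<Rightarrow> real) \<Rightarrow> bool" where
  "adapted F Z \<longleftrightarrow> (\<forall>t\<ge>0. Z t \<in> borel_measurable (F (ennreal t)))"

definition progressive :: "(ennreal \<Rightarrow> 'a measure) \<Rightarrow> (real \<Rightarrow> 'a \<Rightarrow> real) \<Rightarrow> bool" where
  "progressive F Z \<longleftrightarrow>
     (\<forall>t\<ge>0. (\<lambda>(\<omega>, s). Z s \<omega>) \<in> borel_measurable (F (ennreal t) \<Otimes>\<^sub>M restrict_space borel {0..t}))"

definition cadlag :: "(real \<Rightarrow> real) \<Rightarrow> bool" where
  "cadlag f \<longleftrightarrow>
     (\<forall>t\<ge>0. continuous (at_right t) f) \<and> (\<forall>t>0. \<exists>L. (f \<longlongrightarrow> L) (at_left t))"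

definition optional_algebra :: "'a measure \<Rightarrow> (ennreal \<Rightarrow> 'a measure) \<Rightarrow> ('a \<times> real) measure" where
  "optional_algebra M F =
     sigma (space M \<times> {0..})
       {(\<lambda>(\<omega>, t). Z t \<omega>) -` B \<inter> (space M \<times> {0..}) | Z B.
          adapted F Z \<and> (\<forall>\<omega>\<in>space M. cadlag (\<lambda>t. Z t \<omega>)) \<and> B \<in> sets (borel :: real measure)}"

definition optional_process :: "'a measure \<Rightarrow> (ennreal \<Rightarrow> 'a measure) \<Rightarrow> (real \<Rightarrow> 'a \<Rightarrow> real) \<Rightarrow> bool" where
  "optional_process M F Z \<longleftrightarrow> (\<lambda>(\<omega>, t). Z t \<omega>) \<in> borel_measurable (optional_algebra M F)"

definition nondecreasing_left_cont :: "(real \<Rightarrow> real) \<Rightarrow> bool" where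
  "nondecreasing_left_cont f \<longleftrightarrow> mono_on {0..} f \<and> (\<forall>t>0. continuous (at_left t) f)"

definition upper_right_continuous :: "(real \<Rightarrow> real) \<Rightarrow> bool" where
  "upper_right_continuous f \<longleftrightarrow> (\<forall>t\<ge>0. ereal (f t) = Limsup (at_right t) (\<lambda>s. ereal (f s)))"

text \<open>
  A process such as \<open>t \<mapsto> E[A t | F t]\<close>, \<open>A\<close> not adapted, is given through its values \<open>Z \<tau> = E[A \<tau> | F \<tau>]\<close> at
  all stopping times; it is the optional process \<open>G\<close> having these values (the optional projection of \<open>A\<close>,
  which is unique up to indistinguishability).
\<close>
definition optional_version ::
    "'a measure \<Rightarrow> (ennreal \<Rightarrow> 'a measure) \<Rightarrow> (('a \<Rightarrow> ennreal) \<Rightarrow> 'a \<Rightarrow> real) \<Rightarrow> (real \<Rightarrow> 'a \<Rightarrow> real) \<Rightarrow> bool" where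
  "optional_version M F Z G \<longleftrightarrow>
     optional_process M F G \<and>
     (\<forall>\<tau>. stopping_time F \<tau> \<longrightarrow> (AE \<omega> in M. \<tau> \<omega> < \<infinity> \<longrightarrow> G (enn2real (\<tau> \<omega>)) \<omega> = Z \<tau> \<omega>))"

subsection \<open>Integrals over time\<close>

definition times_from :: "ennreal \<Rightarrow> real set" where
  "times_from t = {s. 0 \<le> s \<and> t \<le> ennreal s}"

definition discount :: "real \<Rightarrow> ennreal \<Rightarrow> real" where
  "discount \<delta> t = (if t = \<infinity> then 0 else exp (- \<delta> * enn2real t))"

text \<open>
  The measure \<open>df\<close> on \<open>[0,\<infinity>)\<close> with \<open>df [s,t) = f t - f s\<close>, for left-continuous nondecreasing \<open>f\<close>. The
  library measure \<open>interval_measure\<close> prescribes the mass of the intervals \<open>(s,t]\<close> by a right-continuous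
  function, hence the right limits; \<open>df\<close> has the atom \<open>f (0+) - f 0\<close> at \<open>0\<close>.
\<close>
definition left_stieltjes :: "(real \<Rightarrow> real) \<Rightarrow> real measure" where
  "left_stieltjes f = interval_measure (\<lambda>t. if t < 0 then f 0 else Lim (at_right t) f)"

lemma emeasure_left_stieltjes_Ico:
  assumes f: "nondecreasing_left_cont f" and st: "0 \<le> s" "s \<le> t"
  shows "emeasure (left_stieltjes f) {s..<t} = ennreal (f t - f s)"
proof -
  define g where "g = (\<lambda>t. f (max 0 t))"
  have g_mono: "g a \<le> g b" if "a \<le> b" for a b
    using f that unfolding nondecreasing_left_cont_def g_def by (auto intro!: mono_onD[of "{0..}" f])
  have bdd: "bdd_below (g ` {t<..})" for t
    by (intro bdd_belowI[of _ "g t"]) (auto intro: g_mono)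
  have g_lim: "(g \<longlongrightarrow> (INF s\<in>{t<..}. g s)) (at_right t)" for t
  proof (rule order_tendstoI)
    fix a assume "a < (INF s\<in>{t<..}. g s)"
    then have "a < g s" if "t < s" for s
      using cINF_lower[OF bdd[of t], of s] that by simp
    then show "eventually (\<lambda>s. a < g s) (at_right t)"
      by (simp add: eventually_at_filter)
  next
    fix a assume "(INF s\<in>{t<..}. g s) < a"
    then obtain s where s: "t < s" "g s < a"
      using cINF_less_iff[OF _ bdd[of t]] by auto
    then show "eventually (\<lambda>s. g s < a) (at_right t)"
      unfolding eventually_at_right_field
      using s by (meson g_mono le_less_trans less_imp_le)
  qed
  define h where "h = (\<lambda>t. INF s\<in>{t<..}. g s)"
  have h_eq: "(\<lambda>t. if t < 0 then f 0 else Lim (at_right t) f) = h"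
  proof
    fix t
    show "(if t < 0 then f 0 else Lim (at_right t) f) = h t"
    proof (cases "t < 0")
      case True
      have "eventually (\<lambda>s. g s = f 0) (at_right t)"
        unfolding eventually_at_right_field using True by (intro exI[of _ 0]) (auto simp: g_def)
      then have "(g \<longlongrightarrow> f 0) (at_right t)"
        by (rule tendsto_eventually)
      with g_lim[of t] show ?thesis
        using True tendsto_unique[of "at_right t"] unfolding h_def by auto
    next
      case False
      have "eventually (\<lambda>s. g s = f s) (at_right t)"
        unfolding eventually_at_right_field using False by (intro exI[of _ "t + 1"]) (auto simp: g_def)
      then have "(f \<longlongrightarrow> h t) (at_right t)"
        using g_lim[of t] unfolding h_def by (rule Lim_transform_eventually[rotated])
      then show ?thesis
        using False by (auto intro!: tendsto_Lim)
    qed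
  qed
  have g_le_h: "g t \<le> h t" for t
    unfolding h_def by (intro cINF_greatest) (auto intro: g_mono)
  have h_le_g: "h s \<le> g t" if "s < t" for s t
    unfolding h_def using that by (intro cINF_lower[OF bdd]) auto
  have h_mono: "h a \<le> h b" if "a \<le> b" for a b
    using that g_le_h[of b] h_le_g[of a b] by (cases "a = b") (auto intro: order_trans)
  have h_right: "continuous (at_right a) h" for a
    unfolding continuous_within
  proof (rule order_tendstoI)
    fix c assume "c < h a"
    then show "eventually (\<lambda>s. c < h s) (at_right a)"
      unfolding eventually_at_right_field
      by (intro exI[of _ "a + 1"]) (auto intro: less_le_trans[OF _ h_mono])
  next
    fix c assume "h a < c"
    then obtain s where s: "a < s" "g s < c"
      using cINF_less_iff[OF _ bdd[of a]] unfolding h_def by auto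
    then show "eventually (\<lambda>s. h s < c) (at_right a)"
      unfolding eventually_at_right_field
      using s by (meson h_le_g le_less_trans)
  qed
  have g_left: "(g \<longlongrightarrow> g t) (at_left t)" for t
  proof (cases "t > 0")
    case True
    have "(f \<longlongrightarrow> f t) (at_left t)"
      using f True unfolding nondecreasing_left_cont_def continuous_within by auto
    moreover have "eventually (\<lambda>s. f s = g s) (at_left t)"
      unfolding eventually_at_left_field using True by (intro exI[of _ 0]) (auto simp: g_def)
    ultimately have "(g \<longlongrightarrow> f t) (at_left t)"
      by (rule Lim_transform_eventually)
    then show ?thesis using True by (simp add: g_def)
  next
    case False
    have "eventually (\<lambda>s. g s = g t) (at_left t)"
      unfolding eventually_at_left_field using False by (intro exI[of _ "t - 1"]) (auto simp: g_def)
    then show ?thesis by (rule tendsto_eventually)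
  qed
  have h_left: "(h \<longlongrightarrow> g t) (at_left t)" for t
  proof (rule tendsto_sandwich[OF _ _ g_left tendsto_const])
    show "eventually (\<lambda>s. h s \<le> g t) (at_left t)"
      by (simp add: eventually_at_filter h_le_g)
  qed (simp add: g_le_h)
  let ?m = "interval_measure h"
  have Ioc: "emeasure ?m {a<..b} = ennreal (h b - h a)" if "a \<le> b" for a b
    by (rule emeasure_interval_measure_Ioc[OF that h_mono h_right])
  have lims: "filterlim (\<lambda>n. u - inverse (real (Suc n))) (at_left u) sequentially" for u :: real
    unfolding filterlim_at
    using tendsto_diff[OF tendsto_const[of u] LIMSEQ_inverse_real_of_nat] by simp
  show ?thesis
  proof (cases "s = t")
    case False
    have single: "emeasure ?m {u} = ennreal (h u - g u)" for u
    proof -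
      define A where "A = (\<lambda>n. {u - inverse (real (Suc n))<..u})"
      have "(\<lambda>n. emeasure ?m (A n)) \<longlonglongrightarrow> emeasure ?m (\<Inter>n. A n)"
      proof (rule Lim_emeasure_decseq)
        show "decseq A"
          unfolding decseq_Suc_iff A_def by (auto simp: field_simps)
        show "emeasure ?m (A n) \<noteq> \<infinity>" for n unfolding A_def by (subst Ioc) auto
      qed (auto simp: A_def)
      moreover have "(\<Inter>n. A n) = {u}"
      proof (intro equalityI subsetI)
        fix x assume "x \<in> (\<Inter>n. A n)"
        then have lower: "u - inverse (real (Suc n)) < x" "x \<le> u" for n
          by (auto simp: A_def)
        then have "x \<le> u" by blast
        moreover have "\<not> x < u"
        proof
          assume "x < u"
          then obtain n where "inverse (real (Suc n)) < u - x"
            using reals_Archimedean[of "u - x"] by auto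
          with lower(1)[of n] show False by linarith
        qed
        ultimately show "x \<in> {u}" by (simp add: antisym)
      qed (auto simp: A_def)
      moreover have "(\<lambda>n. emeasure ?m (A n)) \<longlonglongrightarrow> ennreal (h u - g u)"
        unfolding A_def using filterlim_compose[OF h_left[of u] lims[of u]]
        by (subst Ioc) (auto intro!: tendsto_ennrealI tendsto_diff)
      ultimately show ?thesis by (metis LIMSEQ_unique)
    qed
    have "emeasure ?m ({s} \<union> {s<..t}) = emeasure ?m {s} + emeasure ?m {s<..t}"
      by (rule plus_emeasure[symmetric]) simp_all
    moreover have "{s} \<union> {s<..t} = {s..t}"
      using st by force
    moreover have "emeasure ?m ({s..<t} \<union> {t}) = emeasure ?m {s..<t} + emeasure ?m {t}"
      by (rule plus_emeasure[symmetric]) simp_all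
    moreover have "{s..<t} \<union> {t} = {s..t}"
      using st by force
    ultimately have eq: "emeasure ?m {s..<t} + ennreal (h t - g t) = ennreal (h s - g s) + ennreal (h t - h s)"
      using st by (simp add: single Ioc)
    also have "\<dots> = ennreal (g t - g s) + ennreal (h t - g t)"
      using st g_le_h[of s] g_le_h[of t] h_mono[of s t] g_mono[of s t] by (simp flip: ennreal_plus)
    finally have "emeasure ?m {s..<t} = ennreal (g t - g s)"
      by (simp add: ennreal_add_left_cancel add.commute[of _ "ennreal (h t - g t)"])
    then show ?thesis
      using st by (simp add: left_stieltjes_def h_eq g_def)
  qed simp
qed

definition optional_random_measure ::
    "'a measure \<Rightarrow> (ennreal \<Rightarrow> 'a measure) \<Rightarrow> ('a \<Rightarrow> real measure) \<Rightarrow> bool" where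
  "optional_random_measure M F \<kappa> \<longleftrightarrow>
     (\<forall>\<omega>\<in>space M. sets (\<kappa> \<omega>) = sets borel \<and> emeasure (\<kappa> \<omega>) {..<0} = 0 \<and>
        (\<forall>t\<ge>0. emeasure (\<kappa> \<omega>) {0..t} < \<infinity>)) \<and>
     (\<forall>t\<ge>0. (\<lambda>\<omega>. emeasure (\<kappa> \<omega>) {0..t}) \<in> borel_measurable (F (ennreal t)))"

subsection \<open>The investment problem\<close>

definition resource_process :: "'a measure \<Rightarrow> (ennreal \<Rightarrow> 'a measure) \<Rightarrow> (real \<Rightarrow> 'a \<Rightarrow> real) \<Rightarrow> real \<Rightarrow> bool" where
  "resource_process M F \<theta> \<theta>\<^sub>o \<longleftrightarrow>
     adapted F \<theta> \<and>
     (\<forall>\<omega>\<in>space M. nondecreasing_left_cont (\<lambda>t. \<theta> t \<omega>) \<and> (\<forall>t\<ge>0. 0 \<le> \<theta> t \<omega>) \<and> \<theta> 0 \<omega> = \<theta>\<^sub>o) \<and>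
     0 < \<theta>\<^sub>o \<and>
     (\<integral>\<^sup>+\<omega>. (SUP t\<in>{0..}. ennreal (\<theta> t \<omega>)) \<partial>M) < \<infinity>"

definition strictly_concave_on :: "real set \<Rightarrow> (real \<Rightarrow> real) \<Rightarrow> bool" where
  "strictly_concave_on S f \<longleftrightarrow>
     (\<forall>a\<in>S. \<forall>b\<in>S. \<forall>u. a \<noteq> b \<longrightarrow> 0 < u \<longrightarrow> u < 1 \<longrightarrow>
        (1 - u) * f a + u * f b < f ((1 - u) * a + u * b))"

text \<open>
  Borel measurability in \<open>x\<close> is what makes \<open>R (X t) (\<nu> t)\<close> a measurable process; it holds automatically
  when \<open>R\<close> is jointly continuous.
\<close>
definition profit_function :: "(real \<Rightarrow> real \<Rightarrow> real) \<Rightarrow> bool" where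
  "profit_function R \<longleftrightarrow>
     (\<forall>y\<ge>0. (\<lambda>x. R x y) \<in> borel_measurable borel) \<and>
     (\<forall>x. (\<forall>y\<ge>0. 0 \<le> R x y) \<and>
        mono_on {0..} (R x) \<and> strictly_concave_on {0..} (R x) \<and> R x 0 = 0 \<and>
        (\<forall>y>0. R x differentiable (at y)) \<and> continuous_on {0<..} (deriv (R x)) \<and>
        filterlim (deriv (R x)) at_top (at_right 0) \<and>
        (deriv (R x) \<longlongrightarrow> 0) at_top)"

text \<open>
  \<open>R\<^sub>y x\<close> extended to all of \<open>[-\<infinity>,\<infinity>]\<close> by its limits \<open>\<infinity>\<close> at \<open>0\<close> and \<open>0\<close> at \<open>\<infinity>\<close>: the running suprema of the
  base capacity are not known beforehand to be positive and finite. The value \<open>\<infinity>\<close> below \<open>0\<close> excludes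
  suprema outside the domain of \<open>R\<close>.
\<close>
definition marginal_profit :: "(real \<Rightarrow> real \<Rightarrow> real) \<Rightarrow> real \<Rightarrow> ereal \<Rightarrow> ennreal" where
  "marginal_profit R x z =
     (if z \<le> 0 then \<infinity> else if z = \<infinity> then 0 else ennreal (deriv (R x) (real_of_ereal z)))"

definition admissible ::
    "'a measure \<Rightarrow> (ennreal \<Rightarrow> 'a measure) \<Rightarrow> (real \<Rightarrow> 'a \<Rightarrow> real) \<Rightarrow> real \<Rightarrow> (real \<Rightarrow> 'a \<Rightarrow> real) set" where
  "admissible M F \<theta> y =
     {\<nu>. adapted F \<nu> \<and>
         (\<forall>\<omega>\<in>space M. nondecreasing_left_cont (\<lambda>t. \<nu> t \<omega>) \<and> (\<forall>t\<ge>0. 0 \<le> \<nu> t \<omega>)) \<and>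
         (AE \<omega> in M. \<nu> 0 \<omega> = y) \<and> (AE \<omega> in M. \<forall>t\<ge>0. \<nu> t \<omega> \<le> \<theta> t \<omega>)}"

definition net_profit ::
    "'a measure \<Rightarrow> real \<Rightarrow> (real \<Rightarrow> real \<Rightarrow> real) \<Rightarrow> (real \<Rightarrow> 'a \<Rightarrow> real) \<Rightarrow> (real \<Rightarrow> 'a \<Rightarrow> real) \<Rightarrow> real" where
  "net_profit M \<delta> R X \<nu> =
     (LINT \<omega>|M. (LINT t:{0..}|lborel. exp (- \<delta> * t) * R (X t \<omega>) (\<nu> t \<omega>))
              - (LINT t:{0..}|left_stieltjes (\<lambda>t. \<nu> t \<omega>). exp (- \<delta> * t)))"

definition optimal ::
    "'a measure \<Rightarrow> (ennreal \<Rightarrow> 'a measure) \<Rightarrow> real \<Rightarrow> (real \<Rightarrow> real \<Rightarrow> real) \<Rightarrow> (real \<Rightarrow> 'a \<Rightarrow> real) \<Rightarrow>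
      (real \<Rightarrow> 'a \<Rightarrow> real) \<Rightarrow> real \<Rightarrow> (real \<Rightarrow> 'a \<Rightarrow> real) \<Rightarrow> bool" where
  "optimal M F \<delta> R X \<theta> y \<nu> \<longleftrightarrow>
     \<nu> \<in> admissible M F \<theta> y \<and>
     (\<forall>\<mu>\<in>admissible M F \<theta> y. net_profit M \<delta> R X \<mu> \<le> net_profit M \<delta> R X \<nu>)"

text \<open>The value at the stopping time \<open>\<tau>\<close> of the supergradient of the net profit at \<open>\<nu>\<close>.\<close>
definition supergradient_at ::
    "'a measure \<Rightarrow> (ennreal \<Rightarrow> 'a measure) \<Rightarrow> real \<Rightarrow> (real \<Rightarrow> real \<Rightarrow> real) \<Rightarrow> (real \<Rightarrow> 'a \<Rightarrow> real) \<Rightarrow>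
      (real \<Rightarrow> 'a \<Rightarrow> real) \<Rightarrow> ('a \<Rightarrow> ennreal) \<Rightarrow> 'a \<Rightarrow> real" where
  "supergradient_at M F \<delta> R X \<nu> \<tau> \<omega> =
     real_cond_exp M (sigma_at M F \<tau>)
       (\<lambda>\<omega>. LINT s:times_from (\<tau> \<omega>)|lborel. exp (- \<delta> * s) * deriv (R (X s \<omega>)) (\<nu> s \<omega>)) \<omega>
     - discount \<delta> (\<tau> \<omega>)"

text \<open>The value at the stopping time \<open>\<tau>\<close> of the process \<open>t \<mapsto> E[\<kappa> [t,\<infinity>) | F t]\<close>.\<close>
definition expected_tail_at ::
    "'a measure \<Rightarrow> (ennreal \<Rightarrow> 'a measure) \<Rightarrow> ('a \<Rightarrow> real measure) \<Rightarrow> ('a \<Rightarrow> ennreal) \<Rightarrow> 'a \<Rightarrow> real" where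
  "expected_tail_at M F \<kappa> \<tau> =
     real_cond_exp M (sigma_at M F \<tau>) (\<lambda>\<omega>. measure (\<kappa> \<omega>) (times_from (\<tau> \<omega>)))"

definition base_capacity ::
    "'a measure \<Rightarrow> (ennreal \<Rightarrow> 'a measure) \<Rightarrow> real \<Rightarrow> (real \<Rightarrow> real \<Rightarrow> real) \<Rightarrow> (real \<Rightarrow> 'a \<Rightarrow> real) \<Rightarrow>
      (real \<Rightarrow> 'a \<Rightarrow> real) \<Rightarrow> bool" where
  "base_capacity M F \<delta> R X l \<longleftrightarrow>
     optional_process M F l \<and>
     (\<forall>\<omega>\<in>space M. upper_right_continuous (\<lambda>t. l t \<omega>)) \<and>
     (\<forall>\<tau>. stopping_time F \<tau> \<longrightarrow>
        (AE \<omega> in M.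
           nn_cond_exp M (sigma_at M F \<tau>)
             (\<lambda>\<omega>. \<integral>\<^sup>+s\<in>times_from (\<tau> \<omega>).
                     ennreal (exp (- \<delta> * s)) *
                     marginal_profit R (X s \<omega>) (SUP u\<in>{u\<in>times_from (\<tau> \<omega>). u < s}. ereal (l u \<omega>))
                   \<partial>lborel) \<omega>
           = ennreal (discount \<delta> (\<tau> \<omega>))))"

text \<open>At \<open>t = 0\<close> the supremum is over the empty set, hence \<open>-\<infinity>\<close>, and the value is \<open>y\<close>.\<close>
definition nu_star ::
    "(real \<Rightarrow> 'a \<Rightarrow> real) \<Rightarrow> (real \<Rightarrow> 'a \<Rightarrow> real) \<Rightarrow> real \<Rightarrow> real \<Rightarrow> 'a \<Rightarrow> real" where
  "nu_star l \<theta> y t \<omega> =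
     real_of_ereal (max (SUP s\<in>{0..<t}. ereal (min (l s \<omega>) (\<theta> s \<omega>))) (ereal y))"

end

theory Submission
  imports Defs
begin

text \<open>Let \<open>\<nu>\<close> be the candidate and \<open>g(s) = e\<^sup>-\<^sup>\<delta>\<^sup>s (R\<^sub>y(X(s), \<nu>(s)) - \<delta>)\<close>. As \<open>e\<^sup>-\<^sup>\<delta>\<^sup>\<tau>\<close> is the integral of
  \<open>\<delta> e\<^sup>-\<^sup>\<delta>\<^sup>s\<close> over \<open>[\<tau>, \<infinity>)\<close>, the supergradient at \<open>\<tau>\<close> is \<open>E[\<integral>\<^sub>\<tau> g | F\<^sub>\<tau>]\<close>. Call \<open>u\<close> binding if \<open>l(u) \<ge> \<theta>(u)\<close> and let
  \<open>\<sigma>\<close> be the first binding time after \<open>\<tau>\<close>. Comparing \<open>\<nu>\<close> with the running supremum of \<open>l\<close> from \<open>\<tau>\<close> in the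
  equation of the base capacity process shows that \<open>g\<close> has conditionally nonpositive integral between
  \<open>\<tau>\<close> and \<open>\<sigma>\<close>, and a vanishing one if \<open>\<nu>\<close> increases at \<open>\<tau>\<close>.

  Moving the signed mass \<open>g(s) ds\<close> back to the last binding time before \<open>s\<close> therefore produces, on the
  predictable sets, a nonnegative measure that is dominated by \<open>g\<^sup>+ ds\<close>. Its predictable density \<open>k\<close> is the
  density of the multiplier: by construction \<open>E[\<integral>\<^sub>\<tau> k | F\<^sub>\<tau>] = E[\<integral>\<^sub>\<sigma> g | F\<^sub>\<tau>]\<close>, which dominates
  \<open>E[\<integral>\<^sub>\<tau> g | F\<^sub>\<tau>]\<close>, with equality at the times of increase of \<open>\<nu>\<close>; and \<open>k\<close> vanishes where \<open>\<nu> < \<theta>\<close>. Optimality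
  follows by concavity, decomposing capacities into their levels \<open>c\<close> and using these relations at the
  times at which the capacity passes \<open>c\<close>.

  That \<open>\<sigma>\<close> is a stopping time and \<open>\<nu>\<close> is adapted rests on the measurable projection theorem.\<close>

subsection \<open>Measurable projection\<close>

text \<open>The values \<open>E[\<integral> g over (\<sigma>, \<infinity>) | F_\<tau>]\<close> form
  a potential, because \<nu> is driven by \<open>l\<close> after \<sigma>; \<open>k ds\<close> is
  its compensator, built as a measure on predictable sets. The obstacle is that g has no sign along
  a path: the mass sent to one binding time mixes gains and losses, and only conditional integrals
  are ordered. Positivity can thus be tested only on sets A x (s,t] with A known at s. These form a
  semiring, on which the images of the positive and of the negative part of g are compared;
  Caratheodory extends the difference to all predictable sets. On A x (s,t] it equals the integral
  of g between the next binding times after s and after t. The stretch that starts at t has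
  nonpositive integral, which leaves at most the positive part of g on (s,t]: this bound makes the
  compensator absolutely continuous in time. In the proof of optimality capacities are cut at a
  level n, because \<open>k\<close> is known to be integrable, but not its product with
  \<theta>.\<close>

definition rectangle_paving :: "'a measure \<Rightarrow> real set \<Rightarrow> ('a \<times> real) set set" where
  "rectangle_paving M C = {A \<times> (C \<inter> K) | A K. A \<in> sets M \<and> closed K}"

text \<open>A Souslin scheme is indexed by finite sequences. Here its sets are functions of an
  infinite sequence that look at the first \<open>n\<close> entries only, so no truncation operator
  is needed.\<close>

definition finitely_determined :: "nat \<Rightarrow> ((nat \<Rightarrow> nat) \<Rightarrow> 'b) \<Rightarrow> bool" where
  "finitely_determined n f \<longleftrightarrow> (\<forall>b b'. (\<forall>i<n. b i = b' i) \<longrightarrow> f b = f b')"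

text \<open>\<open>B\<close> is the result of the Souslin operation applied to the paving by rectangles with compact second factor.\<close>
definition souslin :: "'a measure \<Rightarrow> real set \<Rightarrow> ('a \<times> real) set \<Rightarrow> bool" where
  "souslin M C B \<longleftrightarrow>
     (\<exists>E. (\<forall>n b. E n b \<in> rectangle_paving M C) \<and> (\<forall>n. finitely_determined n (E n)) \<and>
        B = {x. \<exists>b::nat \<Rightarrow> nat. \<forall>n::nat. x \<in> E n b})"

lemma rectangle_paving_top: "space M \<times> C \<in> rectangle_paving M C"
  unfolding rectangle_paving_def by (intro CollectI exI[of _ "space M"] exI[of _ UNIV]) auto

lemma rectangle_paving_Int:
  assumes "P \<in> rectangle_paving M C" "Q \<in> rectangle_paving M C"
  shows "P \<inter> Q \<in> rectangle_paving M C"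
proof -
  obtain A K B L where "P = A \<times> (C \<inter> K)" "Q = B \<times> (C \<inter> L)" "A \<in> sets M" "B \<in> sets M" "closed K" "closed L"
    using assms unfolding rectangle_paving_def by auto
  then show ?thesis
    unfolding rectangle_paving_def by (auto intro!: exI[of _ "A \<inter> B"] exI[of _ "K \<inter> L"])
qed

lemma rectangle_paving_sub: "P \<in> rectangle_paving M C \<Longrightarrow> P \<subseteq> space M \<times> C"
  unfolding rectangle_paving_def by (auto dest: sets.sets_into_space)

lemma rectangle_paving_INT:
  assumes "finite I" "\<And>i. i \<in> I \<Longrightarrow> P i \<in> rectangle_paving M C"
  shows "(space M \<times> C) \<inter> (\<Inter>i\<in>I. P i) \<in> rectangle_paving M C"
  using assms
proof (induction I rule: finite_induct)
  case empty
  then show ?case using rectangle_paving_top by auto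
next
  case (insert i I)
  have "(space M \<times> C) \<inter> (\<Inter>i\<in>insert i I. P i) = P i \<inter> ((space M \<times> C) \<inter> (\<Inter>i\<in>I. P i))"
    by auto
  with insert show ?case by (auto intro: rectangle_paving_Int)
qed

text \<open>Delaying repairs a scheme whose \<open>n\<close>-th set looks at more than
  \<open>n\<close> entries: stage \<open>N\<close> imposes only those conditions whose index and
  modulus are both at most \<open>N\<close>. Every condition is imposed eventually.\<close>

lemma souslinI_modulus:
  assumes E: "\<And>n b. E n b \<in> rectangle_paving M C" and det: "\<And>n::nat. \<exists>m. finitely_determined m (E n)"
  shows "souslin M C {x. \<exists>b. \<forall>n. x \<in> E n b}"
proof -
  obtain m where m: "finitely_determined (m n) (E n)" for n using det by metis
  define E' where "E' N b = (space M \<times> C) \<inter> (\<Inter>n\<in>{n. n \<le> N \<and> m n \<le> N}. E n b)" for N b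
  have "(\<forall>n. x \<in> E n b) \<longleftrightarrow> (\<forall>n. x \<in> E' n b)" for x b
  proof
    assume "\<forall>n. x \<in> E n b"
    then show "\<forall>n. x \<in> E' n b"
      unfolding E'_def using rectangle_paving_sub[OF E] by blast
  next
    assume *: "\<forall>n. x \<in> E' n b"
    show "\<forall>n. x \<in> E n b"
    proof
      fix n show "x \<in> E n b"
        using *[rule_format, of "max n (m n)"] unfolding E'_def by auto
    qed
  qed
  moreover have "E' n b \<in> rectangle_paving M C" for n b
    unfolding E'_def by (rule rectangle_paving_INT) (auto intro: E)
  moreover have "finitely_determined n (E' n)" for n
    unfolding finitely_determined_def
  proof safe
    fix b b' :: "nat \<Rightarrow> nat" assume "\<forall>i<n. b i = b' i"
    then have "E k b = E k b'" if "k \<le> n" "m k \<le> n" for k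
      using m[of k] that unfolding finitely_determined_def by auto
    then have "E' n b = E' n b'" unfolding E'_def by auto
    then show "x \<in> E' n b \<Longrightarrow> x \<in> E' n b'" "x \<in> E' n b' \<Longrightarrow> x \<in> E' n b" for x by auto
  qed
  ultimately show ?thesis
    unfolding souslin_def by (intro exI[of _ E']) auto
qed

lemma souslin_rectangle: "P \<in> rectangle_paving M C \<Longrightarrow> souslin M C P"
  using souslinI_modulus[of "\<lambda>_ _. P" M C] unfolding finitely_determined_def by auto

lemma souslin_familyE:
  assumes "\<And>i::'i. souslin M C (B i)"
  obtains E where "\<And>i n b. E i n b \<in> rectangle_paving M C" "\<And>i n. finitely_determined n (E i n)"
    "\<And>i. B i = {x. \<exists>b::nat \<Rightarrow> nat. \<forall>n::nat. x \<in> E i n b}"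
proof -
  have "\<forall>i. \<exists>E. (\<forall>n b. E n b \<in> rectangle_paving M C) \<and> (\<forall>n. finitely_determined n (E n)) \<and>
        B i = {x. \<exists>b::nat \<Rightarrow> nat. \<forall>n::nat. x \<in> E n b}"
    using assms unfolding souslin_def by (rule allI)
  from choice[OF this] show ?thesis using that by blast
qed

text \<open>Entry 0 of the sequence names the member of the union and the shifted rest is its
  branch; the shift costs one entry of modulus.\<close>

lemma souslin_Union:
  assumes "\<And>i::nat. souslin M C (B i)"
  shows "souslin M C (\<Union>i. B i)"
proof -
  obtain E where E: "\<And>i n b. E i n b \<in> rectangle_paving M C" "\<And>i n. finitely_determined n (E i n)"
    "\<And>i. B i = {x. \<exists>b::nat \<Rightarrow> nat. \<forall>n::nat. x \<in> E i n b}"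
    using souslin_familyE[of M C B, OF assms] by blast
  define E' where "E' n b = E (b 0) n (\<lambda>j. b (Suc j))" for n and b :: "nat \<Rightarrow> nat"
  have "souslin M C {x. \<exists>b. \<forall>n. x \<in> E' n b}"
  proof (rule souslinI_modulus)
    show "\<exists>m. finitely_determined m (E' n)" for n
    proof (intro exI[of _ "Suc n"], unfold finitely_determined_def, intro allI impI)
      fix b b' :: "nat \<Rightarrow> nat" assume *: "\<forall>i<Suc n. b i = b' i"
      have "E (b 0) n (\<lambda>j. b (Suc j)) = E (b 0) n (\<lambda>j. b' (Suc j))"
        using E(2)[of n "b 0"] * unfolding finitely_determined_def by auto
      then show "E' n b = E' n b'" using * unfolding E'_def by auto
    qed
  qed (auto simp: E'_def E)
  moreover have "{x. \<exists>b. \<forall>n. x \<in> E' n b} = (\<Union>i. B i)"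
  proof safe
    fix w t b assume "\<forall>n. (w, t) \<in> E' n b"
    then show "(w, t) \<in> (\<Union>i. B i)" unfolding E'_def E(3) by blast
  next
    fix w t i assume "(w, t) \<in> B i"
    then obtain b where "\<forall>n. (w, t) \<in> E i n b" unfolding E(3) by auto
    then show "\<exists>b. \<forall>n. (w, t) \<in> E' n b"
      unfolding E'_def by (intro exI[of _ "case_nat i b"]) auto
  qed
  ultimately show ?thesis by simp
qed

text \<open>One sequence encodes countably many through the pairing function, one branch for each
  member of the intersection.\<close>

lemma souslin_Inter:
  assumes "\<And>i::nat. souslin M C (B i)"
  shows "souslin M C (\<Inter>i. B i)"
proof -
  obtain E where E: "\<And>i n b. E i n b \<in> rectangle_paving M C" "\<And>i n. finitely_determined n (E i n)"
    "\<And>i. B i = {x. \<exists>b::nat \<Rightarrow> nat. \<forall>n::nat. x \<in> E i n b}"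
    using souslin_familyE[of M C B, OF assms] by blast
  define E' where "E' N b = E (fst (prod_decode N)) (snd (prod_decode N)) (\<lambda>m. b (prod_encode (fst (prod_decode N), m)))"
    for N and b :: "nat \<Rightarrow> nat"
  have "souslin M C {x. \<exists>b. \<forall>n. x \<in> E' n b}"
  proof (rule souslinI_modulus)
    fix N
    obtain i n where [simp]: "prod_decode N = (i, n)" by (metis surj_pair)
    \<comment> \<open>Only a bound above all codes of the pairs \<open>(i, m)\<close> with
      \<open>m < n\<close> is wanted; the sum is a convenient one.\<close>
    have "finitely_determined (\<Sum>m<n. Suc (prod_encode (i, m))) (E' N)"
    proof (unfold finitely_determined_def, intro allI impI)
      fix b b' :: "nat \<Rightarrow> nat" assume *: "\<forall>j<(\<Sum>m<n. Suc (prod_encode (i, m))). b j = b' j"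
      have "b (prod_encode (i, m)) = b' (prod_encode (i, m))" if "m < n" for m
      proof -
        have "prod_encode (i, m) < Suc (prod_encode (i, m))" by simp
        also have "\<dots> \<le> (\<Sum>m<n. Suc (prod_encode (i, m)))"
          using that by (intro member_le_sum) auto
        finally show ?thesis using * by auto
      qed
      then show "E' N b = E' N b'"
        using E(2)[of n i] unfolding E'_def finitely_determined_def by auto
    qed
    then show "\<exists>m. finitely_determined m (E' N)" by blast
  qed (auto simp: E'_def E)
  moreover have "{x. \<exists>b. \<forall>n. x \<in> E' n b} = (\<Inter>i. B i)"
  proof safe
    fix w t b i assume *: "\<forall>n. (w, t) \<in> E' n b"
    show "(w, t) \<in> B i" unfolding E(3)
    proof (intro CollectI exI allI)
      fix n show "(w, t) \<in> E i n (\<lambda>m. b (prod_encode (i, m)))"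
        using *[rule_format, of "prod_encode (i, n)"] unfolding E'_def by simp
    qed
  next
    fix w t assume "(w, t) \<in> (\<Inter>i. B i)"
    then have "\<forall>i. \<exists>b. \<forall>n. (w, t) \<in> E i n b" unfolding E(3) by auto
    then obtain b where "\<And>i n. (w, t) \<in> E i n (b i)" by metis
    then show "\<exists>b. \<forall>n. (w, t) \<in> E' n b"
      unfolding E'_def by (intro exI[of _ "\<lambda>N. b (fst (prod_decode N)) (snd (prod_decode N))"]) auto
  qed
  ultimately show ?thesis by simp
qed

text \<open>Souslin sets are closed under countable unions and intersections but not under
  complements, so the induction over the sigma-algebra carries each set together with its
  complement.\<close>

lemma souslin_measurable:
  assumes "B \<in> sets (M \<Otimes>\<^sub>M restrict_space borel C)"
  shows "souslin M C B"
proof -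
  let ?S = "space M \<times> C"
  have un: "souslin M C (P \<union> Q)" if "souslin M C P" "souslin M C Q" for P Q
  proof -
    have "P \<union> Q = (\<Union>i::nat. if i = 0 then P else Q)"
      by (auto split: if_splits)
    then show ?thesis
      using souslin_Union[of M C "\<lambda>i. if i = 0 then P else Q"] that by auto
  qed
  \<comment> \<open>An open half-line is a countable union of closed ones; this supplies the
    complements at the start of the induction.\<close>
  have compl_closed: "souslin M C (space M \<times> (C - {..a}))" for a :: real
  proof -
    have "space M \<times> (C - {..a}) = (\<Union>n::nat. space M \<times> (C \<inter> {a + inverse (real (Suc n))..}))"
    proof (intro equalityI subsetI)
      fix z assume z: "z \<in> space M \<times> (C - {..a})"
      then have "0 < snd z - a" by (simp add: mem_Times_iff)
      from reals_Archimedean[OF this] obtain n where "inverse (real (Suc n)) < snd z - a" by blast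
      then have "a + inverse (real (Suc n)) \<le> snd z" by linarith
      then have "z \<in> space M \<times> (C \<inter> {a + inverse (real (Suc n))..})"
        using z by (simp add: mem_Times_iff)
      then show "z \<in> (\<Union>n::nat. space M \<times> (C \<inter> {a + inverse (real (Suc n))..}))"
        by (rule UN_I[OF UNIV_I])
    next
      fix z assume "z \<in> (\<Union>n::nat. space M \<times> (C \<inter> {a + inverse (real (Suc n))..}))"
      then obtain n where n: "z \<in> space M \<times> (C \<inter> {a + inverse (real (Suc n))..})" by blast
      have "inverse (real (Suc n)) > 0" by simp
      moreover have "a + inverse (real (Suc n)) \<le> snd z" using n unfolding mem_Times_iff by blast
      ultimately have "a < snd z" by linarith
      then show "z \<in> space M \<times> (C - {..a})" using n by (simp add: mem_Times_iff)
    qed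
    moreover have "souslin M C (\<Union>n. space M \<times> (C \<inter> {a + inverse (real (Suc n))..}))"
      by (intro souslin_Union souslin_rectangle) (auto simp: rectangle_paving_def)
    ultimately show ?thesis by (simp only:)
  qed
  have inter: "souslin M C (P \<inter> Q)" if "souslin M C P" "souslin M C Q" for P Q
  proof -
    have "P \<inter> Q = (\<Inter>i::nat. if i = 0 then P else Q)"
      by (auto split: if_splits)
    then show ?thesis
      using souslin_Inter[of M C "\<lambda>i. if i = 0 then P else Q"] that by auto
  qed
  have rect: "souslin M C (A \<times> (C \<inter> K))" if "A \<in> sets M" "closed K" for A K
    by (rule souslin_rectangle) (use that in \<open>auto simp: rectangle_paving_def\<close>)
  have borel: "souslin M C (space M \<times> (C \<inter> L)) \<and> souslin M C (space M \<times> (C - L))"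
    if "L \<in> sets borel" for L :: "real set"
  proof -
    have "L \<in> sigma_sets UNIV (range (\<lambda>a. {..a}))"
      using that by (subst (asm) borel_eq_atMost) (simp add: sets_measure_of)
    then show ?thesis
    proof (induction rule: sigma_sets.induct)
      case (Basic a)
      then show ?case using compl_closed rect[of "space M"] by auto
    next
      case Empty
      then show ?case using rect[of "space M" "{}"] rect[of "space M" UNIV] by auto
    next
      case (Compl a)
      then show ?case by (auto simp: Diff_Int_distrib Int_Diff[symmetric] double_diff Diff_eq)
    next
      case (Union a)
      have "space M \<times> (C \<inter> (\<Union>i. a i)) = (\<Union>i. space M \<times> (C \<inter> a i))"
        "space M \<times> (C - (\<Union>i. a i)) = (\<Inter>i. space M \<times> (C - a i))" by auto
      then show ?case using Union.IH by (auto intro!: souslin_Union souslin_Inter)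
    qed
  qed
  have "B \<in> sigma_sets ?S {a \<times> b | a b. a \<in> sets M \<and> b \<in> sets (restrict_space borel C)}"
    using assms by (simp add: sets_pair_measure space_restrict_space)
  then have "souslin M C B \<and> souslin M C (?S - B) \<and> B \<subseteq> ?S"
  proof (induction rule: sigma_sets.induct)
    case (Basic P)
    then obtain A L where P: "P = A \<times> (C \<inter> L)" "A \<in> sets M" "L \<in> sets borel"
      by (auto simp: sets_restrict_space)
    have "P = (A \<times> (C \<inter> UNIV)) \<inter> (space M \<times> (C \<inter> L))" "P \<subseteq> ?S"
      "?S - P = ((space M - A) \<times> (C \<inter> UNIV)) \<union> (space M \<times> (C - L))"
      using P sets.sets_into_space[OF P(2)] by auto
    then show ?case
      using P borel[OF P(3)] by (auto intro!: inter un rect[where K = UNIV, simplified])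
  next
    case Empty
    then show ?case using rect[of "{}" "{}"] rect[of "space M" UNIV] by auto
  next
    case (Compl a)
    then show ?case by (auto simp: double_diff)
  next
    case (Union a)
    have "?S - (\<Union>i. a i) = (\<Inter>i. ?S - a i)" by auto
    moreover have "souslin M C (\<Inter>i. ?S - a i)" "souslin M C (\<Union>i. a i)"
      by (rule souslin_Inter souslin_Union, use Union.IH in blast)+
    ultimately show ?case using Union.IH by (simp only: UN_least simp_thms)
  qed
  then show ?thesis by blast
qed

text \<open>Koenig's lemma for the tree of sequences below \<open>k\<close>. A prefix is
  \<open>good\<close> if it extends to partial solutions of every depth; finite branching lets a
  good prefix be prolonged to a good one.\<close>

lemma Koenig_bounded:
  assumes E: "\<And>n. finitely_determined n (E n)"
    and ex: "\<And>N. \<exists>b::nat \<Rightarrow> nat. (\<forall>i<N. b i \<le> k i) \<and> (\<forall>m\<le>N. x \<in> E m b)"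
  shows "\<exists>b. \<forall>m. x \<in> E m b"
proof -
  define good where "good n b0 \<longleftrightarrow> (\<forall>N\<ge>n. \<exists>b. (\<forall>i<n. b i = b0 i) \<and> (\<forall>i<N. b i \<le> k i) \<and> (\<forall>m\<le>N. x \<in> E m b))"
    for n and b0 :: "nat \<Rightarrow> nat"
  have "\<exists>f. \<forall>n. good n (f n) \<and> (\<exists>j. f (Suc n) = (f n)(n := j))"
  proof (rule dependent_nat_choice)
    show "\<exists>b0. good 0 b0" using ex unfolding good_def by auto
  next
    fix b0 n assume g: "good n b0"
    have "\<exists>j\<le>k n. good (Suc n) (b0(n := j))"
    proof (rule ccontr)
      assume "\<not> ?thesis"
      then have "\<exists>N\<ge>Suc n. \<not> (\<exists>b. (\<forall>i<Suc n. b i = (b0(n := j)) i) \<and> (\<forall>i<N. b i \<le> k i) \<and> (\<forall>m\<le>N. x \<in> E m b))"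
        if "j \<le> k n" for j
        using that unfolding good_def by blast
      then obtain N where N: "\<And>j. j \<le> k n \<Longrightarrow> N j \<ge> Suc n"
        "\<And>j b. j \<le> k n \<Longrightarrow> \<forall>i<Suc n. b i = (b0(n := j)) i \<Longrightarrow> \<forall>i<N j. b i \<le> k i \<Longrightarrow> \<forall>m\<le>N j. x \<in> E m b \<Longrightarrow> False"
        by (metis (no_types))
      \<comment> \<open>If each of the finitely many values of entry \<open>n\<close> failed at its
        own depth \<open>N j\<close>, all of them would fail at the largest depth, where the good
        prefix still has an extension.\<close>
      define Nm where "Nm = Max (N ` {..k n})"
      have le: "N j \<le> Nm" if "j \<le> k n" for j unfolding Nm_def using that by auto
      have "Nm \<ge> Suc n" using le[OF le0] N(1)[OF le0] by (rule order_trans[rotated])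
      then obtain b where b: "\<forall>i<n. b i = b0 i" "\<forall>i<Nm. b i \<le> k i" "\<forall>m\<le>Nm. x \<in> E m b"
        using g[unfolded good_def, rule_format, OF Suc_leD] by blast
      have "b n \<le> k n" using b(2) \<open>Nm \<ge> Suc n\<close> by auto
      from N(2)[OF this, of b] show False
        using b le[OF \<open>b n \<le> k n\<close>] by (auto simp: less_Suc_eq)
    qed
    then show "\<exists>b1. good (Suc n) b1 \<and> (\<exists>j. b1 = b0(n := j))" by blast
  qed
  then obtain f where f: "\<And>n. good n (f n)" "\<And>n. \<exists>j. f (Suc n) = (f n)(n := j)" by blast
  have stable: "f (n + d) i = f n i" if "i < n" for n d i
  proof (induction d)
    case (Suc d)
    obtain j where "f (Suc (n + d)) = (f (n + d))(n + d := j)" using f(2) by blast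
    then show ?case using Suc that by simp
  qed simp
  define b where "b i = f (Suc i) i" for i
  have "x \<in> E m b" for m
  proof -
    obtain b' where b': "\<forall>i<m. b' i = f m i" "\<forall>m'\<le>m. x \<in> E m' b'"
      using f(1)[of m] unfolding good_def by blast
    have "b i = b' i" if "i < m" for i
      using stable[of i "Suc i" "m - Suc i"] that b'(1) by (simp add: b_def)
    then show ?thesis using E[of m] b'(2) unfolding finitely_determined_def by (metis order_refl)
  qed
  then show ?thesis by blast
qed

text \<open>Choquet's capacitability argument. Outer measure is continuous along increasing
  sequences of arbitrary sets, so the entries of the branches can be bounded one after the other
  without falling to \<open>c\<close>. Bounded branches leave at stage \<open>n\<close> a finite
  union of rectangles, and compactness of the second factors lets projection commute with the
  decreasing intersection.\<close>

lemma souslin_inner_approximation: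
  assumes M: "finite_measure M" and C: "compact C" and B: "souslin M C B"
    and c: "c < outer_measure_of M (fst ` B)"
  shows "\<exists>V\<in>sets M. V \<subseteq> fst ` B \<and> c \<le> emeasure M V"
proof -
  interpret finite_measure M by fact
  obtain E where E: "\<And>n b. E n b \<in> rectangle_paving M C" "\<And>n. finitely_determined n (E n)"
    "B = {x. \<exists>b::nat \<Rightarrow> nat. \<forall>n::nat. x \<in> E n b}"
    using B unfolding souslin_def by blast
  define W where "W n k = fst ` {x. \<exists>b. (\<forall>i<n. b i \<le> k i) \<and> (\<forall>m. x \<in> E m b)}" for n and k :: "nat \<Rightarrow> nat"
  have W_space: "W n k \<subseteq> space M" for n k
    unfolding W_def using rectangle_paving_sub[OF E(1)] by fastforce
  \<comment> \<open>The bound on entry \<open>n\<close> is chosen so large that the outer measure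
    stays above \<open>c\<close>; earlier bounds are never changed.\<close>
  have "\<exists>f. \<forall>n. c < outer_measure_of M (W n (f n)) \<and> (\<exists>j. f (Suc n) = (f n)(n := j))"
  proof (rule dependent_nat_choice)
    show "\<exists>k. c < outer_measure_of M (W 0 k)" using c unfolding W_def E(3) by auto
  next
    fix k n assume *: "c < outer_measure_of M (W n k)"
    have eq: "W n k = (\<Union>j. W (Suc n) (k(n := j)))"
    proof (intro set_eqI iffI)
      fix w assume "w \<in> W n k"
      then obtain t b where "\<forall>i<n. b i \<le> k i" "\<forall>m. (w, t) \<in> E m b" unfolding W_def by auto
      moreover from this have "\<forall>i<Suc n. b i \<le> (k(n := b n)) i" unfolding less_Suc_eq by simp
      ultimately have "(\<forall>i<Suc n. b i \<le> (k(n := b n)) i) \<and> (\<forall>m. (w, t) \<in> E m b)" by blast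
      then have "w \<in> W (Suc n) (k(n := b n))" unfolding W_def
        by (intro image_eqI[where x = "(w, t)"] CollectI exI[of _ b]) simp_all
      then show "w \<in> (\<Union>j. W (Suc n) (k(n := j)))" by blast
    next
      fix w assume "w \<in> (\<Union>j. W (Suc n) (k(n := j)))"
      then obtain j t b where "\<forall>i<Suc n. b i \<le> (k(n := j)) i" "\<forall>m. (w, t) \<in> E m b" unfolding W_def by auto
      then have "(\<forall>i<n. b i \<le> k i) \<and> (\<forall>m. (w, t) \<in> E m b)"
        by (metis fun_upd_other less_SucI nat_neq_iff)
      then show "w \<in> W n k" unfolding W_def
        by (intro image_eqI[where x = "(w, t)"] CollectI exI[of _ b]) simp_all
    qed
    have "incseq (\<lambda>j. W (Suc n) (k(n := j)))"
    proof (rule incseq_SucI)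
      fix j
      have "(\<forall>i<Suc n. b i \<le> (k(n := j)) i) \<Longrightarrow> (\<forall>i<Suc n. b i \<le> (k(n := Suc j)) i)" for b :: "nat \<Rightarrow> nat"
        by (auto simp: less_Suc_eq)
      then show "W (Suc n) (k(n := j)) \<subseteq> W (Suc n) (k(n := Suc j))"
        unfolding W_def by (intro image_mono) blast
    qed
    with * have "c < (SUP j. outer_measure_of M (W (Suc n) (k(n := j))))"
      by (subst SUP_outer_measure_of_incseq) (auto simp: eq W_space[THEN subsetD])
    then show "\<exists>k'. c < outer_measure_of M (W (Suc n) k') \<and> (\<exists>j. k' = k(n := j))"
      unfolding less_SUP_iff by blast
  qed
  then obtain f where f: "\<And>n. c < outer_measure_of M (W n (f n))" "\<And>n. \<exists>j. f (Suc n) = (f n)(n := j)" by blast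
  have stable: "f (n + d) i = f n i" if "i < n" for n d i
  proof (induction d)
    case (Suc d)
    obtain j where "f (Suc (n + d)) = (f (n + d))(n + d := j)" using f(2) by blast
    then show ?case using Suc that by simp
  qed simp
  define k where "k i = f (Suc i) i" for i
  have k: "k i = f n i" if "i < n" for i n
    using stable[of i "Suc i" "n - Suc i"] that by (simp add: k_def)
  \<comment> \<open>Compared with \<open>W\<close>, the conditions beyond stage \<open>n\<close> are
    dropped. The set becomes larger, but it is a finite union of rectangles with measurable
    projection.\<close>
  define D where "D n = {x. \<exists>b. (\<forall>i<n. b i \<le> k i) \<and> (\<forall>m\<le>n. x \<in> E m b)}" for n
  have W_D: "W n (f n) \<subseteq> fst ` D n" for n
    unfolding W_def D_def using k by (intro image_mono) auto
  define S where "S n = PiE {..<n} (\<lambda>i. {..k i})" for n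
  have D_eq: "D n = (\<Union>s\<in>S n. (space M \<times> C) \<inter> (\<Inter>m\<in>{..n}. E m s))" for n
  proof (intro set_eqI iffI)
    fix x assume "x \<in> D n"
    then obtain b where b: "\<forall>i<n. b i \<le> k i" "\<forall>m\<le>n. x \<in> E m b" unfolding D_def by auto
    have "E m (restrict b {..<n}) = E m b" if "m \<le> n" for m
      using E(2)[of m] that unfolding finitely_determined_def by (metis lessThan_iff order_less_le_trans restrict_apply')
    then show "x \<in> (\<Union>s\<in>S n. (space M \<times> C) \<inter> (\<Inter>m\<in>{..n}. E m s))"
      using b rectangle_paving_sub[OF E(1), of 0 b] unfolding S_def
      by (intro UN_I[of "restrict b {..<n}"]) auto
  next
    fix x assume "x \<in> (\<Union>s\<in>S n. (space M \<times> C) \<inter> (\<Inter>m\<in>{..n}. E m s))"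
    then show "x \<in> D n" unfolding S_def D_def by (auto simp: PiE_iff)
  qed
  have "(space M \<times> C) \<inter> (\<Inter>m\<in>{..n}. E m s) \<in> rectangle_paving M C" for n s
    by (rule rectangle_paving_INT) (auto intro: E(1))
  then have "\<forall>p. \<exists>q. (space M \<times> C) \<inter> (\<Inter>m\<in>{..fst p}. E m (snd p)) = fst q \<times> (C \<inter> snd q) \<and>
      fst q \<in> sets M \<and> closed (snd q)"
    unfolding rectangle_paving_def by fastforce
  from choice[OF this] obtain q where q: "\<And>p. (space M \<times> C) \<inter> (\<Inter>m\<in>{..fst p}. E m (snd p)) = fst (q p) \<times> (C \<inter> snd (q p))"
      "\<And>p. fst (q p) \<in> sets M" "\<And>p. closed (snd (q p))" by blast
  define A K where "A n s = fst (q (n, s))" and "K n s = snd (q (n, s))" for n s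
  have AK: "(space M \<times> C) \<inter> (\<Inter>m\<in>{..n}. E m s) = A n s \<times> (C \<inter> K n s)"
    "A n s \<in> sets M" "closed (K n s)" for n s
    using q[of "(n, s)"] unfolding A_def K_def by simp_all
  have D_AK: "D n = (\<Union>s\<in>S n. A n s \<times> (C \<inter> K n s))" for n
    unfolding D_eq AK ..
  have fin: "finite (S n)" for n unfolding S_def by (intro finite_PiE) auto
  have D_meas: "fst ` D n \<in> sets M" for n
  proof -
    have "fst ` D n = (\<Union>s\<in>{s\<in>S n. C \<inter> K n s \<noteq> {}}. A n s)"
      unfolding D_AK by force
    then show ?thesis using fin AK(2) by auto
  qed
  have D_dec: "decseq D"
  proof (rule decseq_SucI)
    fix n
    have "\<exists>b. (\<forall>i<n. b i \<le> k i) \<and> (\<forall>m\<le>n. x \<in> E m b)"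
      if "\<exists>b. (\<forall>i<Suc n. b i \<le> k i) \<and> (\<forall>m\<le>Suc n. x \<in> E m b)" for x
    proof -
      from that obtain b where "\<forall>i<Suc n. b i \<le> k i" "\<forall>m\<le>Suc n. x \<in> E m b" by blast
      then have "\<forall>i<n. b i \<le> k i" "\<forall>m\<le>n. x \<in> E m b" by simp_all
      then show ?thesis by blast
    qed
    then show "D (Suc n) \<subseteq> D n" unfolding D_def by blast
  qed
  define V where "V = (\<Inter>n. fst ` D n)"
  have V_meas: "V \<in> sets M" unfolding V_def using D_meas by auto
  have c_le: "c \<le> emeasure M (fst ` D n)" for n
  proof -
    have "outer_measure_of M (W n (f n)) \<le> outer_measure_of M (fst ` D n)"
      by (intro outer_measure_of_mono W_D)
    then show ?thesis using f(1)[of n] D_meas[of n] by simp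
  qed
  have "decseq (\<lambda>n. fst ` D n)"
    using D_dec unfolding decseq_def by (auto dest: image_mono)
  then have "(INF n. emeasure M (fst ` D n)) = emeasure M V"
    unfolding V_def using D_meas by (intro INF_emeasure_decseq) auto
  then have "c \<le> emeasure M V" using c_le by (metis INF_greatest)
  moreover have "V \<subseteq> fst ` B"
  proof
    fix w assume "w \<in> V"
    define Q where "Q n = {t. (w, t) \<in> D n}" for n
    \<comment> \<open>The slices over \<open>w\<close> are nonempty, compact and decreasing, so one
      time \<open>t\<close> serves all stages; Koenig's lemma then gives one branch for all
      stages.\<close>
    have "(\<Inter>n. Q n) \<noteq> {}"
    proof (rule compact_nest)
      fix n
      have "Q n = (\<Union>s\<in>{s\<in>S n. w \<in> A n s}. C \<inter> K n s)"
        unfolding Q_def D_AK by auto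
      moreover have "compact (\<Union>s\<in>{s\<in>S n. w \<in> A n s}. C \<inter> K n s)"
        using fin[of n] AK(3) C by (intro compact_UN) (auto intro: compact_Int_closed)
      ultimately show "compact (Q n)" by simp
      show "Q n \<noteq> {}" using \<open>w \<in> V\<close> unfolding V_def Q_def by fastforce
    next
      fix m n :: nat assume "m \<le> n"
      then show "Q n \<subseteq> Q m" using D_dec unfolding Q_def decseq_def by auto
    qed
    then obtain t where t: "\<And>n. (w, t) \<in> D n" unfolding Q_def by auto
    have "\<exists>b. \<forall>m. (w, t) \<in> E m b"
      using t by (intro Koenig_bounded[OF E(2), of k]) (auto simp: D_def)
    then show "w \<in> fst ` B" unfolding E(3) by force
  qed
  ultimately show ?thesis using V_meas by blast
qed

text \<open>Inner approximations exhaust the measure of a measurable hull \<open>U\<close> of the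
  projection, which is therefore squeezed between two measurable sets of equal finite measure;
  completeness finishes. A null hull is treated apart, since no number lies below its
  measure.\<close>

theorem measurable_projection:
  fixes C :: "real set"
  assumes M: "finite_measure M" "complete_measure M" and C: "compact C"
    and B: "B \<in> sets (M \<Otimes>\<^sub>M restrict_space borel C)"
  shows "fst ` B \<in> sets M"
proof -
  interpret finite_measure M by fact
  interpret complete_measure M by fact
  let ?W = "fst ` B"
  have W: "?W \<subseteq> space M"
    using sets.sets_into_space[OF B] by (auto simp: space_pair_measure)
  obtain U where U: "U \<in> sets M" "?W \<subseteq> U" "outer_measure_of M ?W = emeasure M U"
    using outer_measure_of_attain[OF W] by auto
  show ?thesis
  proof (cases "emeasure M U = 0")
    case True
    then show ?thesis using complete[OF U(2)] U(1) by auto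
  next
    case False
    then obtain u :: "nat \<Rightarrow> ennreal" where u: "\<And>n. u n < emeasure M U" "u \<longlonglongrightarrow> emeasure M U"
      using approx_from_below_dense_linorder[of 0 "emeasure M U"] by (auto simp: zero_less_iff_neq_zero)
    have "\<forall>n. \<exists>V. V \<in> sets M \<and> V \<subseteq> ?W \<and> u n \<le> emeasure M V"
    proof
      fix n
      have "u n < outer_measure_of M ?W" unfolding U(3) by (rule u(1))
      from souslin_inner_approximation[OF M(1) C souslin_measurable[OF B] this]
      show "\<exists>V. V \<in> sets M \<and> V \<subseteq> ?W \<and> u n \<le> emeasure M V" unfolding Bex_def .
    qed
    from choice[OF this] obtain V where V: "\<And>n. V n \<in> sets M" "\<And>n. V n \<subseteq> ?W" "\<And>n. u n \<le> emeasure M (V n)"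
      by blast
    have "u n \<le> emeasure M (\<Union>n. V n)" for n
      using V(3)[of n] by (rule order_trans) (auto intro!: emeasure_mono V)
    then have "emeasure M U \<le> emeasure M (\<Union>n. V n)"
      using u(2) by (intro LIMSEQ_le_const2) auto
    moreover have "emeasure M (\<Union>n. V n) \<le> emeasure M U"
      using V(2) U(1,2) by (intro emeasure_mono) blast+
    ultimately have eq: "emeasure M (\<Union>n. V n) = emeasure M U" by (rule antisym[rotated])
    have fin: "emeasure M (\<Union>n. V n) < \<infinity>" by (simp add: less_top[symmetric])
    have sets: "(\<Union>n. V n) \<in> sets M" and sub: "(\<Union>n. V n) \<subseteq> ?W" using V(1,2) by blast+
    show ?thesis
      by (rule complete_sets_sandwich[OF sets U(1) sub U(2) eq fin])
  qed
qed

subsection \<open>Differences of measures and conditional expectations\<close>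

text \<open>Domination on the semiring makes the difference a premeasure there; Caratheodory extends
  it, and uniqueness of extensions carries the additive identity to the whole sigma-algebra.\<close>

lemma finite_measure_difference:
  assumes G: "semiring_of_sets \<Omega> G"
    and N0: "finite_measure N0" "sets N0 = sigma_sets \<Omega> G"
    and N1: "finite_measure N1" "sets N1 = sigma_sets \<Omega> G"
    and le: "\<And>A. A \<in> G \<Longrightarrow> emeasure N0 A \<le> emeasure N1 A"
    and cover: "range C \<subseteq> G" "(\<Union>i::nat. C i) = \<Omega>"
  obtains N where "sets N = sigma_sets \<Omega> G"
    "\<And>A. A \<in> sigma_sets \<Omega> G \<Longrightarrow> emeasure N1 A = emeasure N0 A + emeasure N A"
proof -
  interpret semiring_of_sets \<Omega> G by fact
  interpret N0: finite_measure N0 by fact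
  interpret N1: finite_measure N1 by fact
  define \<mu> where "\<mu> A = ennreal (measure N1 A - measure N0 A)" for A
  have le': "measure N0 A \<le> measure N1 A" if "A \<in> G" for A
    using le[OF that] by (simp add: N0.emeasure_eq_measure N1.emeasure_eq_measure)
  have G_sub: "G \<subseteq> sigma_sets \<Omega> G" by auto
  have "countably_additive G \<mu>"
    unfolding countably_additive_def
  proof (intro allI impI)
    fix A :: "nat \<Rightarrow> 'a set" assume A: "range A \<subseteq> G" "disjoint_family A" "(\<Union>i. A i) \<in> G"
    have "(\<lambda>i. measure N0 (A i)) sums measure N0 (\<Union>i. A i)"
      using A G_sub N0(2) by (intro N0.finite_measure_UNION) auto
    moreover have "(\<lambda>i. measure N1 (A i)) sums measure N1 (\<Union>i. A i)"
      using A G_sub N1(2) by (intro N1.finite_measure_UNION) auto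
    ultimately have s: "(\<lambda>i. measure N1 (A i) - measure N0 (A i)) sums (measure N1 (\<Union>i. A i) - measure N0 (\<Union>i. A i))"
      by (intro sums_diff)
    have "(\<Sum>i. \<mu> (A i)) = ennreal (\<Sum>i. measure N1 (A i) - measure N0 (A i))"
      unfolding \<mu>_def using A le' s by (intro suminf_ennreal2) (auto simp: sums_iff image_subset_iff)
    then show "(\<Sum>i. \<mu> (A i)) = \<mu> (\<Union>i. A i)"
      using s by (simp add: \<mu>_def sums_iff)
  qed
  moreover have "positive G \<mu>"
    unfolding positive_def \<mu>_def by simp
  ultimately obtain \<mu>' :: "'a set \<Rightarrow> ennreal" where \<mu>': "\<And>A. A \<in> G \<Longrightarrow> \<mu>' A = \<mu> A" "measure_space \<Omega> (sigma_sets \<Omega> G) \<mu>'"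
    using caratheodory by blast
  define N where "N = measure_of \<Omega> (sigma_sets \<Omega> G) \<mu>'"
  have sets_N: "sets N = sigma_sets \<Omega> G"
    unfolding N_def by (rule sigma_algebra.sets_measure_of_eq[OF sigma_algebra_sigma_sets[OF space_closed]])
  have em_N: "emeasure N A = \<mu>' A" if "A \<in> sigma_sets \<Omega> G" for A
    using \<mu>'(2) that unfolding N_def measure_space_def
    by (intro emeasure_measure_of_sigma) auto
  define N2 where "N2 = measure_of \<Omega> (sigma_sets \<Omega> G) (\<lambda>A. emeasure N0 A + emeasure N A)"
  have sets_N2: "sets N2 = sigma_sets \<Omega> G"
    unfolding N2_def by (rule sigma_algebra.sets_measure_of_eq[OF sigma_algebra_sigma_sets[OF space_closed]])
  have em_N2: "emeasure N2 A = emeasure N0 A + emeasure N A" if "A \<in> sigma_sets \<Omega> G" for A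
    unfolding N2_def
  proof (rule emeasure_measure_of_sigma)
    show "sigma_algebra \<Omega> (sigma_sets \<Omega> G)" using space_closed by (rule sigma_algebra_sigma_sets)
    show "countably_additive (sigma_sets \<Omega> G) (\<lambda>A. emeasure N0 A + emeasure N A)"
      unfolding countably_additive_def
    proof (intro allI impI)
      fix A :: "nat \<Rightarrow> 'a set" assume "range A \<subseteq> sigma_sets \<Omega> G" "disjoint_family A" "(\<Union>i. A i) \<in> sigma_sets \<Omega> G"
      then show "(\<Sum>i. emeasure N0 (A i) + emeasure N (A i)) = emeasure N0 (\<Union>i. A i) + emeasure N (\<Union>i. A i)"
        by (subst suminf_add[symmetric]) (simp_all add: suminf_emeasure N0(2) sets_N)
    qed
  qed (use that in \<open>auto simp: positive_def\<close>)
  have "N1 = N2"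
  proof (rule measure_eqI_generator_eq[of G \<Omega> _ _ C])
    show "Int_stable G" by (auto simp: Int_stable_def)
    show "G \<subseteq> Pow \<Omega>" by (rule space_closed)
    fix A assume "A \<in> G"
    then show "emeasure N1 A = emeasure N2 A"
      using le'[of A] by (auto simp: em_N2 em_N \<mu>' \<mu>_def N0.emeasure_eq_measure N1.emeasure_eq_measure simp flip: ennreal_plus)
  qed (use N1(2) sets_N2 cover in auto)
  then show ?thesis
    using that[OF sets_N] em_N2 by auto
qed

text \<open>An inequality between measures does not pass from an arbitrary intersection-stable
  generator to the sigma-algebra. From a semiring it does, because the difference is again a
  measure.\<close>

corollary finite_measure_mono_semiring:
  assumes "semiring_of_sets \<Omega> G"
    and "finite_measure N0" "sets N0 = sigma_sets \<Omega> G" "finite_measure N1" "sets N1 = sigma_sets \<Omega> G"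
    and "\<And>A. A \<in> G \<Longrightarrow> emeasure N0 A \<le> emeasure N1 A"
    and "range C \<subseteq> G" "(\<Union>i::nat. C i) = \<Omega>" and "A \<in> sigma_sets \<Omega> G"
  shows "emeasure N0 A \<le> emeasure N1 A"
  using finite_measure_difference[OF assms(1-8)] assms(9) by (metis le_iff_add)

lemma (in complete_measure) measurable_AE_eq:
  fixes f g :: "'a \<Rightarrow> 'b::topological_space"
  assumes g: "g \<in> borel_measurable M" and eq: "AE \<omega> in M. f \<omega> = g \<omega>"
  shows "f \<in> borel_measurable M"
proof (rule measurableI)
  fix B :: "'b set" assume B: "B \<in> sets borel"
  show "f -` B \<inter> space M \<in> sets M"
  proof (rule in_sets_AE)
    show "g -` B \<inter> space M \<in> sets M" using g B by (rule measurable_sets)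
    show "AE \<omega> in M. \<omega> \<in> g -` B \<inter> space M \<longleftrightarrow> \<omega> \<in> f -` B \<inter> space M"
      using eq by eventually_elim auto
  qed auto
qed simp

text \<open>\<open>nn_cond_exp\<close> is 0 by definition for a nonmeasurable function. The equation
  would then force \<open>g\<close>, hence \<open>f\<close>, to vanish almost everywhere, and
  completeness would make \<open>f\<close> measurable after all. So measurability is read off the
  equation, which spares a direct proof for integrals of running suprema.\<close>

lemma nn_cond_exp_set_integral:
  assumes M: "prob_space M" "complete_measure M" and sub: "subalgebra M G"
    and eq: "AE \<omega> in M. nn_cond_exp M G f \<omega> = g \<omega>"
    and zero: "\<And>\<omega>. g \<omega> = 0 \<Longrightarrow> f \<omega> = 0"
  shows "f \<in> borel_measurable M" and "A \<in> sets G \<Longrightarrow> (\<integral>\<^sup>+\<omega>\<in>A. f \<omega> \<partial>M) = (\<integral>\<^sup>+\<omega>\<in>A. g \<omega> \<partial>M)"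
proof -
  interpret prob_space M by fact
  interpret complete_measure M by fact
  interpret finite_measure_subalgebra M G using sub by unfold_locales
  show meas: "f \<in> borel_measurable M"
  proof (rule ccontr)
    assume "f \<notin> borel_measurable M"
    then have "AE \<omega> in M. f \<omega> = 0"
      using eq zero by (auto simp: nn_cond_exp_def)
    then have "f \<in> borel_measurable M"
      by (rule measurable_AE_eq[OF borel_measurable_const])
    then show False using \<open>f \<notin> borel_measurable M\<close> by blast
  qed
  assume A: "A \<in> sets G"
  have "(\<integral>\<^sup>+\<omega>\<in>A. f \<omega> \<partial>M) = (\<integral>\<^sup>+\<omega>. indicator A \<omega> * f \<omega> \<partial>M)"
    by (simp add: mult.commute)
  also have "\<dots> = (\<integral>\<^sup>+\<omega>. indicator A \<omega> * nn_cond_exp M G f \<omega> \<partial>M)"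
    using A meas by (intro nn_cond_exp_intg[symmetric]) auto
  also have "\<dots> = (\<integral>\<^sup>+\<omega>\<in>A. g \<omega> \<partial>M)"
    using eq by (intro nn_integral_cong_AE) (auto simp: mult.commute)
  finally show "(\<integral>\<^sup>+\<omega>\<in>A. f \<omega> \<partial>M) = (\<integral>\<^sup>+\<omega>\<in>A. g \<omega> \<partial>M)" .
qed

text \<open>The hypothesis is tested on the set where the inequality fails: there the difference is
  positive, yet its integral is nonpositive, so the set is null.\<close>

lemma real_cond_exp_leI:
  fixes f g :: "'a \<Rightarrow> real"
  assumes M: "prob_space M" and sub: "subalgebra M G" and int: "integrable M f" "integrable M g"
    and le: "\<And>A. A \<in> sets G \<Longrightarrow> (\<integral>\<omega>\<in>A. f \<omega> \<partial>M) \<le> (\<integral>\<omega>\<in>A. g \<omega> \<partial>M)"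
  shows "AE \<omega> in M. real_cond_exp M G f \<omega> \<le> real_cond_exp M G g \<omega>"
proof -
  interpret prob_space M by fact
  interpret finite_measure_subalgebra M G using sub by unfold_locales
  let ?f = "real_cond_exp M G f" and ?g = "real_cond_exp M G g"
  let ?A = "{\<omega>\<in>space M. ?g \<omega> < ?f \<omega>}"
  have A: "?A \<in> sets G"
  proof -
    have "space G = space M" using sub by (simp add: subalgebra_def)
    moreover have "{\<omega>\<in>space G. ?g \<omega> < ?f \<omega>} \<in> sets G" by measurable
    ultimately show ?thesis by (simp only:)
  qed
  then have AM: "?A \<in> sets M" using sub by (auto simp: subalgebra_def)
  have int': "integrable M ?f" "integrable M ?g" using int by (auto intro: real_cond_exp_int)
  have si: "integrable M (\<lambda>\<omega>. indicator ?A \<omega> * (?f \<omega> - ?g \<omega>))"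
    using integrable_mult_indicator[OF AM, of "\<lambda>\<omega>. ?f \<omega> - ?g \<omega>"] int' by simp
  have nn: "0 \<le> indicator ?A \<omega> * (?f \<omega> - ?g \<omega>)" for \<omega> by (auto simp: indicator_def)
  have ia: "integrable M (\<lambda>\<omega>. indicator ?A \<omega> * ?f \<omega>)" "integrable M (\<lambda>\<omega>. indicator ?A \<omega> * ?g \<omega>)"
    using int' AM integrable_mult_indicator[OF AM int'(1)] integrable_mult_indicator[OF AM int'(2)] by simp_all
  have "(\<integral>\<omega>. indicator ?A \<omega> * (?f \<omega> - ?g \<omega>) \<partial>M) = (\<integral>\<omega>\<in>?A. ?f \<omega> \<partial>M) - (\<integral>\<omega>\<in>?A. ?g \<omega> \<partial>M)"
    unfolding set_lebesgue_integral_def using ia by (simp add: right_diff_distrib)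
  also have "\<dots> = (\<integral>\<omega>\<in>?A. f \<omega> \<partial>M) - (\<integral>\<omega>\<in>?A. g \<omega> \<partial>M)"
    using real_cond_exp_intA[OF int(1) A] real_cond_exp_intA[OF int(2) A] by simp
  also have "\<dots> \<le> 0" using le[OF A] by simp
  finally have "(\<integral>\<omega>. indicator ?A \<omega> * (?f \<omega> - ?g \<omega>) \<partial>M) \<le> 0" .
  moreover have "0 \<le> (\<integral>\<omega>. indicator ?A \<omega> * (?f \<omega> - ?g \<omega>) \<partial>M)"
    using nn by (intro integral_nonneg_AE) auto
  ultimately have "(\<integral>\<omega>. indicator ?A \<omega> * (?f \<omega> - ?g \<omega>) \<partial>M) = 0" by simp
  then have "AE \<omega> in M. indicator ?A \<omega> * (?f \<omega> - ?g \<omega>) = 0"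
    using integral_nonneg_eq_0_iff_AE[OF si] nn by auto
  then show ?thesis
    using AE_space by eventually_elim (auto simp: indicator_def split: if_splits)
qed

subsection \<open>Stopping times and progressive processes\<close>

locale usual_filtered_space = prob_space M + complete_measure M for M :: "'a measure" +
  fixes F :: "ennreal \<Rightarrow> 'a measure"
  assumes usual: "usual_conditions M F"
begin

sublocale filtration "space M" F
  using usual by (simp add: usual_conditions_def)

lemma sets_F_M: "sets (F t) \<subseteq> sets M"
  using usual by (simp add: usual_conditions_def)

lemma F_in_M: "A \<in> sets (F t) \<Longrightarrow> A \<in> sets M"
  using sets_F_M by blast

lemma subalgebra_F: "subalgebra M (F t)"
  using sets_F_M by (simp add: subalgebra_def space_F)

lemma null_in_F: "A \<in> null_sets M \<Longrightarrow> A \<in> sets (F t)"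
  using usual sets_F_mono[OF zero_le, of t] unfolding usual_conditions_def by blast

lemma F_right_continuous: "t < \<infinity> \<Longrightarrow> (\<And>s. t < s \<Longrightarrow> A \<in> sets (F s)) \<Longrightarrow> A \<in> sets (F t)"
  using usual unfolding usual_conditions_def by blast

text \<open>Right-continuity of the filtration allows strict inequalities, the form in which entry
  times and level times are described.\<close>

lemma stopping_timeI_less:
  assumes S: "\<And>t. 0 < t \<Longrightarrow> {\<omega>\<in>space M. S \<omega> < ennreal t} \<in> sets (F (ennreal t))"
  shows "stopping_time F S"
proof (rule stopping_timeI)
  fix t :: ennreal
  show "Measurable.pred (F t) (\<lambda>\<omega>. S \<omega> \<le> t)"
  proof (cases t)
    case (real r)
    have "{\<omega>\<in>space M. S \<omega> \<le> t} \<in> sets (F s)" if s: "t < s" for s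
    proof -
      obtain d where d: "t < d" "d < s" using dense[OF s] by blast
      then obtain d' where d': "d = ennreal d'" "d' > r" "d' \<ge> 0"
        using real by (cases d) (auto simp: ennreal_less_iff top.extremum_strict not_less)
      obtain N where N: "inverse (real (Suc N)) < d' - r"
        using reals_Archimedean[of "d' - r"] d' by auto
      \<comment> \<open>The shift by \<open>N\<close> keeps all \<open>x n\<close> in
        \<open>(r, d']\<close> with \<open>ennreal d' < s\<close>, so every set
        \<open>{S < x n}\<close> already belongs to \<open>F s\<close>.\<close>
      define x where "x n = r + inverse (real (Suc (N + n)))" for n
      have x_le: "x n \<le> d'" for n
      proof -
        have "inverse (real (Suc (N + n))) \<le> inverse (real (Suc N))" by (simp add: field_simps)
        then show ?thesis using N unfolding x_def by linarith
      qed
      have x_pos: "r < x n" for n unfolding x_def by simp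
      have x_lim: "x \<longlonglongrightarrow> r"
      proof -
        have "(\<lambda>n. r + inverse (real (Suc n))) \<longlonglongrightarrow> r + 0"
          by (intro tendsto_intros LIMSEQ_inverse_real_of_nat)
        from LIMSEQ_ignore_initial_segment[OF this, of N] show ?thesis
          unfolding x_def by (simp add: add.commute)
      qed
      have "S \<omega> \<le> t" if *: "\<And>n. S \<omega> < ennreal (x n)" for \<omega>
      proof -
        have "(\<lambda>n. ennreal (x n)) \<longlonglongrightarrow> ennreal r" using x_lim by (intro tendsto_ennrealI)
        then have "S \<omega> \<le> ennreal r" by (rule LIMSEQ_le_const) (use * less_imp_le in blast)
        then show ?thesis using real by simp
      qed
      moreover have "S \<omega> < ennreal (x n)" if "S \<omega> \<le> t" for \<omega> n
      proof -
        have "t < ennreal (x n)" using real x_pos[of n] by (simp add: ennreal_lessI)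
        then show ?thesis using that by (rule le_less_trans[rotated])
      qed
      ultimately have "{\<omega>\<in>space M. S \<omega> \<le> t} = (\<Inter>n. {\<omega>\<in>space M. S \<omega> < ennreal (x n)})"
        by blast
      moreover have "{\<omega>\<in>space M. S \<omega> < ennreal (x n)} \<in> sets (F s)" for n
      proof -
        have "0 < x n" using real x_pos[of n] by simp
        moreover have "ennreal (x n) \<le> s"
          using x_le[of n] d d' by (metis ennreal_leI less_imp_le order_trans)
        ultimately show ?thesis using S sets_F_mono by blast
      qed
      ultimately show ?thesis by auto
    qed
    moreover have "t < \<infinity>" using real by simp
    ultimately have "{\<omega>\<in>space M. S \<omega> \<le> t} \<in> sets (F t)"
      by (rule F_right_continuous[rotated])
    then show ?thesis unfolding pred_def space_F .
  qed simp
qed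

lemma subalgebra_pre_sigma:
  assumes "stopping_time F \<tau>" shows "subalgebra M (pre_sigma \<tau>)"
proof -
  have "A \<in> sets M" if "A \<in> sets (pre_sigma \<tau>)" for A
    using F_in_M[OF sets_pre_sigmaD[OF assms that, of top]] by simp
  then show ?thesis by (auto simp: subalgebra_def space_pre_sigma)
qed

lemma pre_sigma_in_M: "stopping_time F \<tau> \<Longrightarrow> A \<in> sets (pre_sigma \<tau>) \<Longrightarrow> A \<in> sets M"
  using subalgebra_pre_sigma by (auto simp: subalgebra_def)

lemma in_pre_sigma_const: "A \<in> sets (F t) \<Longrightarrow> A \<in> sets (pre_sigma (\<lambda>_. t))"
proof (rule sets_pre_sigmaI[OF stopping_time_const])
  fix s assume A: "A \<in> sets (F t)"
  show "{\<omega> \<in> A. t \<le> s} \<in> sets (F s)"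
    using A sets_F_mono[of t s] by (cases "t \<le> s") auto
qed

lemma stopping_time_measurable: "stopping_time F \<tau> \<Longrightarrow> \<tau> \<in> borel_measurable M"
  by (rule measurable_stopping_time[OF _ sets_F_M space_F])

text \<open>\<open>F t\<close> contains all null sets of \<open>M\<close>, so the restriction of
  \<open>M\<close> to it is complete and the projection theorem applies within
  \<open>F t\<close>.\<close>

lemma projection_F:
  assumes B: "B \<in> sets (F t \<Otimes>\<^sub>M restrict_space borel {a..b::real})"
  shows "fst ` B \<in> sets (F t)"
proof -
  let ?N = "restr_to_subalg M (F t)"
  have sets: "sets ?N = sets (F t)" by (rule sets_restr_to_subalg[OF subalgebra_F])
  have "fst ` B \<in> sets ?N"
  proof (rule measurable_projection[where C = "{a..b}"])
    show "finite_measure ?N" using subalgebra_F finite_measure_axioms by (rule finite_measure_restr_to_subalg)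
    show "complete_measure ?N"
    proof
      fix A B assume "B \<subseteq> A" "A \<in> null_sets ?N"
      then have "B \<in> null_sets M"
        using null_sets_restr_to_subalg[OF subalgebra_F] complete2 by blast
      then show "B \<in> sets ?N" using null_in_F sets by blast
    qed
    show "B \<in> sets (?N \<Otimes>\<^sub>M restrict_space borel {a..b})"
      using B sets_pair_measure_cong[OF sets refl] by blast
  qed simp
  then show ?thesis using sets by simp
qed

text \<open>Time is discretized: \<open>k n u\<close> is the cell of \<open>u\<close> at stage
  \<open>n\<close> and \<open>r T n\<close> picks a representative of a cell inside
  \<open>[0,T]\<close>. The sampled process is then measurable with respect to \<open>F T\<close>,
  cell by cell.\<close>

lemma progressiveI_limit:
  fixes Z :: "real \<Rightarrow> 'a \<Rightarrow> real"
  assumes Z: "adapted F Z"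
    and r: "\<And>T n u. 0 \<le> T \<Longrightarrow> 0 \<le> u \<Longrightarrow> u \<le> T \<Longrightarrow> r T n (k n u) \<in> {0..T}"
    and r': "\<And>T n i. 0 \<le> T \<Longrightarrow> r T n i \<in> {0..T}"
    and k: "\<And>n. k n \<in> borel \<rightarrow>\<^sub>M count_space (UNIV::int set)"
    and lim: "\<And>T u \<omega>. 0 \<le> T \<Longrightarrow> 0 \<le> u \<Longrightarrow> u \<le> T \<Longrightarrow> \<omega> \<in> space M \<Longrightarrow> (\<lambda>n. Z (r T n (k n u)) \<omega>) \<longlonglongrightarrow> Z u \<omega>"
  shows "progressive F Z"
  unfolding progressive_def
proof (intro allI impI)
  fix T :: real assume T: "0 \<le> T"
  let ?N = "F (ennreal T) \<Otimes>\<^sub>M restrict_space borel {0..T}"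
  show "(\<lambda>(\<omega>, s). Z s \<omega>) \<in> borel_measurable ?N"
  proof (rule borel_measurable_LIMSEQ_real)
    fix n :: nat
    have "(\<lambda>x. Z (r T n (k n (snd x))) (fst x)) \<in> borel_measurable ?N"
    proof (rule measurable_compose_countable[where f = "\<lambda>i x. Z (r T n i) (fst x)" and g = "\<lambda>x. k n (snd x)"])
      fix i
      have "r T n i \<in> {0..T}" using r'[OF T] .
      then have "Z (r T n i) \<in> borel_measurable (F (ennreal T))"
        using Z sets_F_mono[of "ennreal (r T n i)" "ennreal T"] unfolding adapted_def
        by (intro measurable_from_subalg[of "F (ennreal T)" "F (ennreal (r T n i))"])
           (auto simp: subalgebra_def space_F ennreal_leI)
      then show "(\<lambda>x. Z (r T n i) (fst x)) \<in> borel_measurable ?N" by measurable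
    next
      have "snd \<in> ?N \<rightarrow>\<^sub>M borel"
        by (rule measurable_compose[OF measurable_snd measurable_restrict_space1]) simp
      then show "(\<lambda>x. k n (snd x)) \<in> ?N \<rightarrow>\<^sub>M count_space UNIV"
        using k by (rule measurable_compose)
    qed
    then show "(\<lambda>(\<omega>, u). Z (r T n (k n u)) \<omega>) \<in> borel_measurable ?N"
      by (simp add: case_prod_beta)
  next
    fix x assume "x \<in> space ?N"
    then show "(\<lambda>n. case x of (\<omega>, u) \<Rightarrow> Z (r T n (k n u)) \<omega>) \<longlonglongrightarrow> (case x of (\<omega>, s) \<Rightarrow> Z s \<omega>)"
      using lim[OF T] by (auto simp: space_pair_measure space_F space_restrict_space)
  qed
qed

text \<open>The grid point lies strictly to the right of \<open>u\<close>, so right-continuity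
  applies; it is capped at \<open>T\<close>, and for \<open>u = T\<close> the cap returns
  \<open>T\<close> itself.\<close>

lemma progressive_cadlag:
  assumes Z: "adapted F Z" and c: "\<And>\<omega>. \<omega> \<in> space M \<Longrightarrow> cadlag (\<lambda>t. Z t \<omega>)"
  shows "progressive F Z"
proof (rule progressiveI_limit[where r = "\<lambda>T n i. max 0 (min T (of_int (i + 1) / real (Suc n)))" and k = "\<lambda>n u. \<lfloor>real (Suc n) * u\<rfloor>"])
  fix T u :: real and \<omega> assume T: "0 \<le> T" and u: "0 \<le> u" "u \<le> T" and \<omega>: "\<omega> \<in> space M"
  define x where "x n = of_int (\<lfloor>real (Suc n) * u\<rfloor> + 1) / real (Suc n)" for n
  have x: "u < x n" "x n \<le> u + inverse (real (Suc n))" for n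
  proof -
    have "real (Suc n) * u < of_int (\<lfloor>real (Suc n) * u\<rfloor> + 1)" by linarith
    then show "u < x n" unfolding x_def by (simp add: field_simps del: of_nat_Suc)
    have "of_int (\<lfloor>real (Suc n) * u\<rfloor> + 1) \<le> real (Suc n) * u + 1" by linarith
    then have "x n \<le> (real (Suc n) * u + 1) / real (Suc n)" unfolding x_def by (intro divide_right_mono) auto
    then show "x n \<le> u + inverse (real (Suc n))" by (simp add: field_simps del: of_nat_Suc)
  qed
  have x_lim: "x \<longlonglongrightarrow> u"
  proof (rule tendsto_sandwich[OF _ _ tendsto_const])
    show "(\<lambda>n. u + inverse (real (Suc n))) \<longlonglongrightarrow> u"
      using tendsto_add[OF tendsto_const[of u] LIMSEQ_inverse_real_of_nat] by simp
    show "\<forall>\<^sub>F n in sequentially. u \<le> x n" by (intro always_eventually allI less_imp_le x(1))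
    show "\<forall>\<^sub>F n in sequentially. x n \<le> u + inverse (real (Suc n))" by (intro always_eventually allI x(2))
  qed
  have eq: "max 0 (min T (x n)) = min T (x n)" for n using x(1)[of n] u T by auto
  have "(\<lambda>n. Z (min T (x n)) \<omega>) \<longlonglongrightarrow> Z u \<omega>"
  proof (cases "u = T")
    case True
    then show ?thesis using x(1) by (simp add: min_absorb1 less_imp_le)
  next
    case False
    have cont: "((\<lambda>t. Z t \<omega>) \<longlongrightarrow> Z u \<omega>) (at_right u)"
      using c[OF \<omega>] u unfolding cadlag_def continuous_within by auto
    have "filterlim (\<lambda>n. min T (x n)) (at_right u) sequentially"
      unfolding filterlim_at
    proof
      show "(\<lambda>n. min T (x n)) \<longlonglongrightarrow> u" using tendsto_min[OF tendsto_const[of T] x_lim] u by (simp add: min_absorb2)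
      show "\<forall>\<^sub>F n in sequentially. min T (x n) \<in> {u<..} \<and> min T (x n) \<noteq> u"
      proof (intro always_eventually allI)
        fix n show "min T (x n) \<in> {u<..} \<and> min T (x n) \<noteq> u" using x(1)[of n] u False by auto
      qed
    qed
    then show ?thesis by (rule filterlim_compose[OF cont])
  qed
  then show "(\<lambda>n. Z (max 0 (min T (of_int (\<lfloor>real (Suc n) * u\<rfloor> + 1) / real (Suc n)))) \<omega>) \<longlonglongrightarrow> Z u \<omega>"
    using eq unfolding x_def by simp
qed (use Z in auto)

text \<open>The mirror image: the grid point lies strictly to the left of \<open>u\<close>, cut off
  at 0, and for \<open>u = 0\<close> the cut returns 0.\<close>

lemma progressive_left_continuous:
  assumes Z: "adapted F Z" and c: "\<And>\<omega>. \<omega> \<in> space M \<Longrightarrow> nondecreasing_left_cont (\<lambda>t. Z t \<omega>)"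
  shows "progressive F Z"
proof (rule progressiveI_limit[where r = "\<lambda>T n i. max 0 (min T (of_int (i - 1) / real (Suc n)))" and k = "\<lambda>n u. \<lceil>real (Suc n) * u\<rceil>"])
  fix T u :: real and \<omega> assume T: "0 \<le> T" and u: "0 \<le> u" "u \<le> T" and \<omega>: "\<omega> \<in> space M"
  define x where "x n = of_int (\<lceil>real (Suc n) * u\<rceil> - 1) / real (Suc n)" for n
  have x: "x n < u" "u - inverse (real (Suc n)) \<le> x n" for n
  proof -
    have "of_int (\<lceil>real (Suc n) * u\<rceil> - 1) < real (Suc n) * u" by linarith
    then show "x n < u" unfolding x_def by (simp add: field_simps del: of_nat_Suc)
    have "real (Suc n) * u - 1 \<le> of_int (\<lceil>real (Suc n) * u\<rceil> - 1)" by linarith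
    then have "(real (Suc n) * u - 1) / real (Suc n) \<le> x n" unfolding x_def by (intro divide_right_mono) auto
    then show "u - inverse (real (Suc n)) \<le> x n" by (simp add: field_simps del: of_nat_Suc)
  qed
  have x_lim: "x \<longlonglongrightarrow> u"
  proof (rule tendsto_sandwich[OF _ _ _ tendsto_const])
    show "(\<lambda>n. u - inverse (real (Suc n))) \<longlonglongrightarrow> u"
      using tendsto_diff[OF tendsto_const[of u] LIMSEQ_inverse_real_of_nat] by simp
    show "\<forall>\<^sub>F n in sequentially. x n \<le> u" by (intro always_eventually allI less_imp_le x(1))
    show "\<forall>\<^sub>F n in sequentially. u - inverse (real (Suc n)) \<le> x n" by (intro always_eventually allI x(2))
  qed
  have eq: "max 0 (min T (x n)) = max 0 (x n)" for n using x(1)[of n] u T by auto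
  have "(\<lambda>n. Z (max 0 (x n)) \<omega>) \<longlonglongrightarrow> Z u \<omega>"
  proof (cases "u = 0")
    case True
    then show ?thesis using x(1) by (simp add: max_absorb1 less_imp_le)
  next
    case False
    have cont: "((\<lambda>t. Z t \<omega>) \<longlongrightarrow> Z u \<omega>) (at_left u)"
      using c[OF \<omega>] u False unfolding nondecreasing_left_cont_def continuous_within by auto
    have "filterlim (\<lambda>n. max 0 (x n)) (at_left u) sequentially"
      unfolding filterlim_at
    proof
      show "(\<lambda>n. max 0 (x n)) \<longlonglongrightarrow> u" using tendsto_max[OF tendsto_const[of 0] x_lim] u by (simp add: max_absorb2)
      show "\<forall>\<^sub>F n in sequentially. max 0 (x n) \<in> {..<u} \<and> max 0 (x n) \<noteq> u"
      proof (intro always_eventually allI)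
        fix n show "max 0 (x n) \<in> {..<u} \<and> max 0 (x n) \<noteq> u" using x(1)[of n] u False by auto
      qed
    qed
    then show ?thesis by (rule filterlim_compose[OF cont])
  qed
  then show "(\<lambda>n. Z (max 0 (min T (of_int (\<lceil>real (Suc n) * u\<rceil> - 1) / real (Suc n)))) \<omega>) \<longlonglongrightarrow> Z u \<omega>"
    using eq unfolding x_def by simp
qed (use Z in auto)

text \<open>Adapted cadlag processes generate the optional sets and are progressive, so the identity
  map on each window \<open>[0,T]\<close> is measurable into the optional sigma-algebra.\<close>

lemma progressive_optional:
  assumes "optional_process M F Z"
  shows "progressive F Z"
  unfolding progressive_def
proof (intro allI impI)
  fix T :: real assume T: "0 \<le> T"
  let ?N = "F (ennreal T) \<Otimes>\<^sub>M restrict_space borel {0..T}"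
  have "(\<lambda>x. x) \<in> ?N \<rightarrow>\<^sub>M optional_algebra M F"
    unfolding optional_algebra_def
  proof (rule measurable_measure_of)
    show "(\<lambda>x. x) \<in> space ?N \<rightarrow> space M \<times> {0..}"
      by (auto simp: space_pair_measure space_F space_restrict_space)
    fix Y assume "Y \<in> {(\<lambda>(\<omega>, t). Z t \<omega>) -` B \<inter> space M \<times> {0..} |Z B.
          adapted F Z \<and> (\<forall>\<omega>\<in>space M. cadlag (\<lambda>t. Z t \<omega>)) \<and> B \<in> sets (borel :: real measure)}"
    then obtain Z :: "real \<Rightarrow> 'a \<Rightarrow> real" and B where
      Y: "Y = (\<lambda>(\<omega>, t). Z t \<omega>) -` B \<inter> space M \<times> {0..}" and Z: "adapted F Z" "\<forall>\<omega>\<in>space M. cadlag (\<lambda>t. Z t \<omega>)"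
      and B: "B \<in> sets borel" by auto
    have "(\<lambda>(\<omega>, s). Z s \<omega>) \<in> borel_measurable ?N"
      using progressive_cadlag[OF Z(1)] Z(2) T unfolding progressive_def by auto
    then have "(\<lambda>(\<omega>, s). Z s \<omega>) -` B \<inter> space ?N \<in> sets ?N" using B by (rule measurable_sets)
    also have "(\<lambda>(\<omega>, s). Z s \<omega>) -` B \<inter> space ?N = (\<lambda>x. x) -` Y \<inter> space ?N"
      unfolding Y by (auto simp: space_pair_measure space_F space_restrict_space)
    finally show "(\<lambda>x. x) -` Y \<inter> space ?N \<in> sets ?N" .
  qed auto
  from measurable_compose[OF this] assms show "(\<lambda>(\<omega>, s). Z s \<omega>) \<in> borel_measurable ?N"
    unfolding optional_process_def by auto
qed

text \<open>Values at negative times are arbitrary, and \<open>max 0 s\<close> replaces them. The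
  windows \<open>[0,n]\<close> exhaust the time axis.\<close>

lemma progressive_measurable:
  assumes Z: "progressive F Z"
  shows "(\<lambda>(\<omega>, s). Z (max 0 s) \<omega>) \<in> borel_measurable (M \<Otimes>\<^sub>M borel)"
proof (rule borel_measurable_LIMSEQ_real)
  fix n :: nat
  let ?T = "real n"
  let ?N = "F (ennreal ?T) \<Otimes>\<^sub>M restrict_space borel {0..?T}"
  have "(\<lambda>x. (fst x, min ?T (max 0 (snd x)))) \<in> M \<Otimes>\<^sub>M borel \<rightarrow>\<^sub>M ?N"
  proof (rule measurable_Pair)
    have "(\<lambda>x. x) \<in> M \<rightarrow>\<^sub>M F (ennreal ?T)"
      using subalgebra_F by (intro measurable_from_subalg[of M "F (ennreal ?T)"]) auto
    then show "fst \<in> M \<Otimes>\<^sub>M borel \<rightarrow>\<^sub>M F (ennreal ?T)"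
      using measurable_compose[OF measurable_fst] by auto
    show "(\<lambda>x. min ?T (max 0 (snd x))) \<in> M \<Otimes>\<^sub>M borel \<rightarrow>\<^sub>M restrict_space borel {0..?T}"
      by (rule measurable_restrict_space2) auto
  qed
  from measurable_compose[OF this, of "\<lambda>(\<omega>, s). Z s \<omega>" borel]
  show "(\<lambda>(\<omega>, s). Z (min ?T (max 0 s)) \<omega>) \<in> borel_measurable (M \<Otimes>\<^sub>M borel)"
    using Z unfolding progressive_def by (simp add: case_prod_beta)
next
  fix x :: "'a \<times> real"
  obtain N :: nat where N: "max 0 (snd x) \<le> real N" using real_arch_simple by blast
  then have "eventually (\<lambda>n. (case x of (\<omega>, s) \<Rightarrow> Z (min (real n) (max 0 s)) \<omega>) = (case x of (\<omega>, s) \<Rightarrow> Z (max 0 s) \<omega>)) sequentially"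
    by (intro eventually_sequentiallyI[of N]) (auto simp: case_prod_beta min_absorb2)
  then show "(\<lambda>n. case x of (\<omega>, s) \<Rightarrow> Z (min (real n) (max 0 s)) \<omega>) \<longlonglongrightarrow> (case x of (\<omega>, s) \<Rightarrow> Z (max 0 s) \<omega>)"
    by (rule tendsto_eventually)
qed

end

subsection \<open>Entry times and predictable sets\<close>

text \<open>Entry strictly after \<tau>: an entry at \<tau> itself is skipped, and the value is
  \<infinity> if no later one exists. Strictness is what matches this time with the last binding
  time before a given one.\<close>

definition next_entry :: "(real \<Rightarrow> 'a \<Rightarrow> bool) \<Rightarrow> ('a \<Rightarrow> ennreal) \<Rightarrow> 'a \<Rightarrow> ennreal" where
  "next_entry D \<tau> \<omega> = (INF u\<in>{u. 0 \<le> u \<and> \<tau> \<omega> < ennreal u \<and> D u \<omega>}. ennreal u)"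

lemma next_entry_less_iff:
  "next_entry D \<tau> \<omega> < t \<longleftrightarrow> (\<exists>u\<ge>0. \<tau> \<omega> < ennreal u \<and> ennreal u < t \<and> D u \<omega>)"
  unfolding next_entry_def INF_less_iff by auto

lemma next_entry_ge: "\<tau> \<omega> \<le> next_entry D \<tau> \<omega>"
  unfolding next_entry_def by (auto intro!: INF_greatest)

lemma next_entry_le: "0 \<le> u \<Longrightarrow> \<tau> \<omega> < ennreal u \<Longrightarrow> D u \<omega> \<Longrightarrow> next_entry D \<tau> \<omega> \<le> ennreal u"
  unfolding next_entry_def by (auto intro: INF_lower)

text \<open>The event is known at the left end of an interval that is open there, and time 0 is left
  out: intersections and differences of such sets are again finite disjoint unions of them.\<close>

definition predictable_rectangles :: "'a measure \<Rightarrow> (ennreal \<Rightarrow> 'a measure) \<Rightarrow> ('a \<times> real) set set" where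
  "predictable_rectangles M F = {A \<times> {s<..t} | A s t. A \<in> sets (F (ennreal s)) \<and> 0 \<le> s \<and> s \<le> t}"

definition predictable :: "'a measure \<Rightarrow> (ennreal \<Rightarrow> 'a measure) \<Rightarrow> ('a \<times> real) measure" where
  "predictable M F = sigma (space M \<times> {0<..}) (predictable_rectangles M F)"

context usual_filtered_space
begin

lemma ennreal_less_rational:
  assumes "x < ennreal u" obtains q where "q \<in> \<rat>" "0 \<le> q" "q < u" "x \<le> ennreal q"
proof -
  obtain r where r: "0 \<le> r" "x = ennreal r" "r < u"
    using assms by (cases x) (auto simp: ennreal_less_iff top.extremum_strict)
  obtain q where "q \<in> \<rat>" "r < q" "q < u" using Rats_dense_in_real[OF r(3)] by auto
  then show ?thesis using r by (intro that[of q]) (auto intro: ennreal_leI)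
qed

lemma stochastic_ray_eq:
  assumes "A \<subseteq> space M"
  shows "{(\<omega>, u). \<omega> \<in> A \<and> \<tau> \<omega> < ennreal u} =
     (\<Union>q\<in>{q\<in>\<rat>. 0 \<le> q}. {\<omega>\<in>A. \<tau> \<omega> \<le> ennreal q} \<times> {q<..})" (is "?L = ?R")
proof (intro equalityI subsetI)
  fix z assume "z \<in> ?L"
  then obtain \<omega> u where z: "z = (\<omega>, u)" "\<omega> \<in> A" "\<tau> \<omega> < ennreal u" by auto
  from z(3) obtain q where "q \<in> \<rat>" "0 \<le> q" "q < u" "\<tau> \<omega> \<le> ennreal q" by (rule ennreal_less_rational)
  then show "z \<in> ?R" using z by auto
next
  fix z assume "z \<in> ?R"
  then obtain q \<omega> u where z: "z = (\<omega>, u)" "\<omega> \<in> A" "\<tau> \<omega> \<le> ennreal q" "q < u" "0 \<le> q" by auto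
  then have "\<tau> \<omega> < ennreal u" using ennreal_lessI[of u q] by (auto intro: le_less_trans)
  then show "z \<in> ?L" using z by auto
qed

text \<open>The debut theorem: that an entry occurs after \<tau> and before \<open>T\<close> is the
  projection of a progressive set on \<open>[0,T]\<close>.\<close>

lemma stopping_time_next_entry:
  assumes D: "\<And>T. 0 \<le> T \<Longrightarrow>
      {(\<omega>, u). \<omega> \<in> space M \<and> 0 \<le> u \<and> u \<le> T \<and> D u \<omega>} \<in> sets (F (ennreal T) \<Otimes>\<^sub>M restrict_space borel {0..T})"
    and \<tau>: "stopping_time F \<tau>"
  shows "stopping_time F (next_entry D \<tau>)"
proof (rule stopping_timeI_less)
  fix T :: real assume T: "0 < T"
  let ?N = "F (ennreal T) \<Otimes>\<^sub>M restrict_space borel {0..T}"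
  let ?B = "{(\<omega>, u). \<omega> \<in> space M \<and> 0 \<le> u \<and> u \<le> T \<and> D u \<omega>}"
  let ?Q = "\<lambda>q. {\<omega>\<in>space M. \<tau> \<omega> \<le> ennreal q} \<times> ({0..T} \<inter> {q<..<T})"
  have "?Q q \<in> sets ?N" for q
  proof (cases "q \<le> T")
    case True
    have "{\<omega>\<in>space M. \<tau> \<omega> \<le> ennreal q} \<in> sets (F (ennreal T))"
      using stopping_time_le_const[OF \<tau>, of "ennreal q" "ennreal T"] True
      by (simp add: pred_def space_F ennreal_leI)
    then show ?thesis by (intro pair_measureI) (auto simp: sets_restrict_space)
  next
    case False
    then have "?Q q = {}" by auto
    then show ?thesis by (simp only: sets.empty_sets)
  qed
  then have "(\<Union>q\<in>{q\<in>\<rat>. 0 \<le> q}. ?Q q) \<in> sets ?N"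
    by (intro sets.countable_UN') (auto intro: countable_subset[OF _ countable_rat])
  then have "?B \<inter> (\<Union>q\<in>{q\<in>\<rat>. 0 \<le> q}. ?Q q) \<in> sets ?N"
    using D[of T] T by (intro sets.Int) auto
  from projection_F[OF this]
  have "fst ` (?B \<inter> (\<Union>q\<in>{q\<in>\<rat>. 0 \<le> q}. ?Q q)) \<in> sets (F (ennreal T))" .
  also have "fst ` (?B \<inter> (\<Union>q\<in>{q\<in>\<rat>. 0 \<le> q}. ?Q q)) = {\<omega>\<in>space M. next_entry D \<tau> \<omega> < ennreal T}"
  proof (intro equalityI subsetI)
    fix \<omega> assume "\<omega> \<in> fst ` (?B \<inter> (\<Union>q\<in>{q\<in>\<rat>. 0 \<le> q}. ?Q q))"
    then obtain u q where u: "\<omega> \<in> space M" "0 \<le> u" "D u \<omega>" "\<tau> \<omega> \<le> ennreal q" "q < u" "u < T" "0 \<le> q" by auto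
    then have "\<tau> \<omega> < ennreal u" "ennreal u < ennreal T"
      using ennreal_lessI[of u q] by (auto intro: le_less_trans ennreal_lessI)
    then show "\<omega> \<in> {\<omega>\<in>space M. next_entry D \<tau> \<omega> < ennreal T}"
      using u unfolding next_entry_less_iff by (intro CollectI conjI exI[of _ u]) auto
  next
    fix \<omega> assume "\<omega> \<in> {\<omega>\<in>space M. next_entry D \<tau> \<omega> < ennreal T}"
    then obtain u where u: "\<omega> \<in> space M" "0 \<le> u" "\<tau> \<omega> < ennreal u" "ennreal u < ennreal T" "D u \<omega>"
      unfolding next_entry_less_iff by auto
    from u(3) obtain q where q: "q \<in> \<rat>" "0 \<le> q" "q < u" "\<tau> \<omega> \<le> ennreal q" by (rule ennreal_less_rational)
    have "u < T" using u by (simp add: ennreal_less_iff)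
    then have "(\<omega>, u) \<in> ?Q q" "(\<omega>, u) \<in> ?B" using u q by simp_all
    moreover have "q \<in> {q\<in>\<rat>. 0 \<le> q}" using q by simp
    ultimately have "(\<omega>, u) \<in> ?B \<inter> (\<Union>q\<in>{q\<in>\<rat>. 0 \<le> q}. ?Q q)" by blast
    then have "fst (\<omega>, u) \<in> fst ` (?B \<inter> (\<Union>q\<in>{q\<in>\<rat>. 0 \<le> q}. ?Q q))" by (rule imageI)
    then show "\<omega> \<in> fst ` (?B \<inter> (\<Union>q\<in>{q\<in>\<rat>. 0 \<le> q}. ?Q q))" by simp
  qed
  finally show "{\<omega>\<in>space M. next_entry D \<tau> \<omega> < ennreal T} \<in> sets (F (ennreal T))" .
qed

lemma predictable_rectangles_subset: "predictable_rectangles M F \<subseteq> Pow (space M \<times> {0<..})"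
  using sets.sets_into_space[of _ "F _"] unfolding predictable_rectangles_def by (fastforce simp: space_F)

lemma space_predictable: "space (predictable M F) = space M \<times> {0<..}"
  unfolding predictable_def using predictable_rectangles_subset by (rule space_measure_of)

lemma sets_predictable: "sets (predictable M F) = sigma_sets (space M \<times> {0<..}) (predictable_rectangles M F)"
  unfolding predictable_def using predictable_rectangles_subset by (rule sets_measure_of)

lemma predictable_rectanglesI:
  "A \<in> sets (F (ennreal s)) \<Longrightarrow> 0 \<le> s \<Longrightarrow> s \<le> t \<Longrightarrow> A \<times> {s<..t} \<in> predictable_rectangles M F"
  unfolding predictable_rectangles_def by blast

lemma semiring_predictable_rectangles: "semiring_of_sets (space M \<times> {0<..}) (predictable_rectangles M F)"
proof
  show "predictable_rectangles M F \<subseteq> Pow (space M \<times> {0<..})" by (rule predictable_rectangles_subset)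
  show empty: "{} \<in> predictable_rectangles M F"
    using predictable_rectanglesI[of "{}" 0 0] by simp
  fix a b assume "a \<in> predictable_rectangles M F" "b \<in> predictable_rectangles M F"
  then obtain A s t A' s' t' where a: "a = A \<times> {s<..t}" "A \<in> sets (F (ennreal s))" "0 \<le> s" "s \<le> t"
    and b: "b = A' \<times> {s'<..t'}" "A' \<in> sets (F (ennreal s'))" "0 \<le> s'" "s' \<le> t'"
    unfolding predictable_rectangles_def by auto
  have up: "A \<in> sets (F (ennreal r))" if "s \<le> r" for r
    using a(2) sets_F_mono[of "ennreal s" "ennreal r"] that by (auto intro: ennreal_leI)
  have up': "A' \<in> sets (F (ennreal r))" if "s' \<le> r" for r
    using b(2) sets_F_mono[of "ennreal s'" "ennreal r"] that by (auto intro: ennreal_leI)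
  show "a \<inter> b \<in> predictable_rectangles M F"
  proof (cases "max s s' \<le> min t t'")
    case True
    have "a \<inter> b = (A \<inter> A') \<times> {max s s'<..min t t'}" using a b by auto
    then show ?thesis using True up up' a b by (auto intro!: predictable_rectanglesI)
  next
    case False
    then have "a \<inter> b = {}" using a b by auto
    then show ?thesis using empty by simp
  qed
  show "\<exists>C\<subseteq>predictable_rectangles M F. finite C \<and> disjoint C \<and> a - b = \<Union>C"
  proof (cases "s' < t")
    case True
    \<comment> \<open>The overlap of the two time intervals is \<open>(p, q]\<close>; the outer
      \<open>max\<close> gives \<open>p = q\<close> when they do not meet. The difference consists
      of what precedes \<open>p\<close>, what follows \<open>q\<close>, and \<open>A - A'\<close> in
      between.\<close>
    define p q where "p = max s s'" and "q = max p (min t t')"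
    have pq: "s \<le> p" "p \<le> q" "q \<le> t" "s' \<le> p" using True a b unfolding p_def q_def by auto
    have eq: "u \<in> {s<..t} \<and> u \<in> {s'<..t'} \<longleftrightarrow> u \<in> {p<..q}" if "u \<in> {s<..t}" for u
      using that unfolding p_def q_def by auto
    let ?C = "{A \<times> {s<..p}, (A - A') \<times> {p<..q}, A \<times> {q<..t}}"
    have "?C \<subseteq> predictable_rectangles M F"
      using pq up up' a by (auto intro!: predictable_rectanglesI)
    moreover have "disjoint ?C"
      unfolding disjoint_def using pq by auto
    moreover have "a - b = \<Union>?C"
    proof (intro set_eqI iffI)
      fix z assume "z \<in> a - b"
      then show "z \<in> \<Union>?C" using a b eq[of "snd z"] pq by auto
    next
      fix z assume "z \<in> \<Union>?C"
      then show "z \<in> a - b" using a b eq[of "snd z"] pq by auto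
    qed
    ultimately show ?thesis by (intro exI[of _ ?C]) auto
  next
    case False
    then have "a - b = a" using a b by auto
    then show ?thesis using \<open>a \<in> predictable_rectangles M F\<close> by (intro exI[of _ "{a}"]) (auto simp: disjoint_def)
  qed
qed

lemma predictable_rectangle_sets:
  assumes "A \<in> sets (F (ennreal s))" "0 \<le> s"
  shows "A \<times> {s<..} \<in> sets (predictable M F)"
proof -
  have "A \<times> {s<..} = (\<Union>n::nat. A \<times> {s<..s + real n})"
  proof (intro equalityI subsetI)
    fix z assume z: "z \<in> A \<times> {s<..}"
    obtain n where "snd z - s \<le> real n" using real_arch_simple by blast
    then have "z \<in> A \<times> {s<..s + real n}" using z by (auto simp: mem_Times_iff)
    then show "z \<in> (\<Union>n::nat. A \<times> {s<..s + real n})" by blast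
  qed auto
  also have "\<dots> \<in> sets (predictable M F)"
    unfolding sets_predictable using assms
    by (intro sigma_sets.Union sigma_sets.Basic predictable_rectanglesI) auto
  finally show ?thesis .
qed

text \<open>A ray that is open on the left is a union over rational \<open>q\<close> of products of
  \<open>A \<inter> {\<tau> \<le> q}\<close>, an event of \<open>F q\<close>, with
  \<open>(q, \<infinity>)\<close>.\<close>

lemma stochastic_ray_predictable:
  assumes "stopping_time F \<tau>" "A \<in> sets (pre_sigma \<tau>)"
  shows "{(\<omega>, u). \<omega> \<in> A \<and> \<tau> \<omega> < ennreal u} \<in> sets (predictable M F)"
proof -
  have "A \<subseteq> space M" using assms pre_sigma_in_M sets.sets_into_space by blast
  then show ?thesis
    unfolding stochastic_ray_eq[OF \<open>A \<subseteq> space M\<close>] using assms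
    by (intro sets.countable_UN' predictable_rectangle_sets sets_pre_sigmaD)
       (auto intro: countable_subset[OF _ countable_rat] predictable_rectangle_sets sets_pre_sigmaD)
qed

lemma left_continuous_greater_eq:
  assumes f: "nondecreasing_left_cont f" and u: "0 < u"
  shows "c < f u \<longleftrightarrow> (\<exists>q\<in>{q\<in>\<rat>. 0 \<le> q}. q < u \<and> c < f q)"
proof
  assume c: "c < f u"
  have "(f \<longlongrightarrow> f u) (at_left u)" using f u unfolding nondecreasing_left_cont_def continuous_within by auto
  then have "eventually (\<lambda>x. c < f x) (at_left u)" using c by (rule order_tendstoD)
  moreover have "eventually (\<lambda>x. 0 < x) (at_left u)" using u by (intro eventually_at_leftI[of 0]) auto
  ultimately have "eventually (\<lambda>x. c < f x \<and> 0 < x) (at_left u)" by (rule eventually_conj)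
  then obtain b where b: "b < u" "\<And>y. b < y \<Longrightarrow> y < u \<Longrightarrow> c < f y \<and> 0 < y"
    unfolding eventually_at_left_field by blast
  obtain q where "q \<in> \<rat>" "b < q" "q < u" using Rats_dense_in_real[OF b(1)] by auto
  then show "\<exists>q\<in>{q\<in>\<rat>. 0 \<le> q}. q < u \<and> c < f q" using b(2)[of q] by (intro bexI[of _ q]) auto
next
  assume "\<exists>q\<in>{q\<in>\<rat>. 0 \<le> q}. q < u \<and> c < f q"
  then show "c < f u" using f u unfolding nondecreasing_left_cont_def
    by (auto elim!: order_less_le_trans intro!: mono_onD[of "{0..}" f])
qed

lemma predictable_sets_M: "B \<in> sets (predictable M F) \<Longrightarrow> B \<in> sets (M \<Otimes>\<^sub>M borel)"
  unfolding sets_predictable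
proof (induction rule: sigma_sets.induct)
  case (Basic a)
  then show ?case using F_in_M unfolding predictable_rectangles_def by auto
next
  case (Compl a)
  then show ?case by (intro sets.Diff pair_measureI) auto
qed auto

text \<open>Predictable sets are progressive. For the density of the multiplier this gives
  measurability of its mass on \<open>[0,t]\<close> with respect to \<open>F t\<close>.\<close>

lemma predictable_sets_F:
  assumes "B \<in> sets (predictable M F)" and T: "0 \<le> T"
  shows "B \<inter> (space M \<times> {0..T}) \<in> sets (F (ennreal T) \<Otimes>\<^sub>M restrict_space borel {0..T})"
  using assms(1) unfolding sets_predictable
proof (induction rule: sigma_sets.induct)
  case (Basic a)
  then obtain A s t where a: "a = A \<times> {s<..t}" "A \<in> sets (F (ennreal s))" "0 \<le> s" "s \<le> t"
    unfolding predictable_rectangles_def by auto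
  then have "A \<subseteq> space M" using sets.sets_into_space space_F by blast
  show ?case
  proof (cases "s \<le> T")
    case True
    then have "A \<in> sets (F (ennreal T))" using a sets_F_mono[of "ennreal s" "ennreal T"] by (auto intro: ennreal_leI)
    moreover have "a \<inter> (space M \<times> {0..T}) = A \<times> ({0..T} \<inter> {s<..t})" using a \<open>A \<subseteq> space M\<close> by auto
    ultimately show ?thesis by (auto intro!: pair_measureI simp: sets_restrict_space)
  next
    case False
    then have "a \<inter> (space M \<times> {0..T}) = {}" using a by auto
    then show ?thesis by (simp only: sets.empty_sets)
  qed
next
  case (Compl a)
  have "(space M \<times> {0<..} - a) \<inter> (space M \<times> {0..T}) = (space M \<times> ({0..T} \<inter> {0<..})) - (a \<inter> (space M \<times> {0..T}))"
    by auto
  moreover have "space M \<times> ({0..T} \<inter> {0<..}) \<in> sets (F (ennreal T) \<Otimes>\<^sub>M restrict_space borel {0..T})"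
    using sets.top[of "F (ennreal T)"] by (intro pair_measureI) (auto simp: sets_restrict_space space_F)
  ultimately show ?case using Compl.IH by (simp only: sets.Diff)
next
  case (Union a)
  have "(\<Union>i. a i) \<inter> (space M \<times> {0..T}) = (\<Union>i. a i \<inter> (space M \<times> {0..T}))" by auto
  moreover have "(\<Union>i. a i \<inter> (space M \<times> {0..T})) \<in> sets (F (ennreal T) \<Otimes>\<^sub>M restrict_space borel {0..T})"
    by (intro sets.countable_nat_UN image_subsetI Union.IH)
  ultimately show ?case by (simp only:)
qed auto

end

subsection \<open>Concave profit functions\<close>

locale profit =
  fixes R :: "real \<Rightarrow> real \<Rightarrow> real"
  assumes profit: "profit_function R"
begin

lemma R_nonneg: "0 \<le> z \<Longrightarrow> 0 \<le> R x z"
  and R_zero: "R x 0 = 0"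
  and R_mono: "0 \<le> a \<Longrightarrow> a \<le> b \<Longrightarrow> R x a \<le> R x b"
  and R_measurable_first: "0 \<le> z \<Longrightarrow> (\<lambda>x. R x z) \<in> borel_measurable borel"
  using profit unfolding profit_function_def by (auto intro: mono_onD)

lemma DERIV_R: "0 < z \<Longrightarrow> (R x has_real_derivative deriv (R x) z) (at z)"
  using profit unfolding profit_function_def DERIV_deriv_iff_real_differentiable by blast

lemma marginal_nonneg:
  assumes "0 < z" shows "0 \<le> deriv (R x) z"
proof (rule mono_on_imp_deriv_nonneg)
  show "mono_on {0..} (R x)" using profit unfolding profit_function_def by blast
  show "(R x has_real_derivative deriv (R x) z) (at z)" using assms by (rule DERIV_R)
  show "z \<in> interior {0..}" using assms by (simp add: interior_real_atLeast)
qed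

lemma R_tangent:
  assumes a: "0 < a" and b: "0 \<le> b"
  shows "R x b \<le> R x a + deriv (R x) a * (b - a)"
proof -
  have "convex_on {0..} (\<lambda>z. - R x z)"
  proof (rule convex_onI)
    fix t u v :: real assume t: "0 < t" "t < 1" and uv: "u \<in> {0..}" "v \<in> {0..}"
    have "(1 - t) * R x u + t * R x v \<le> R x ((1 - t) * u + t * v)"
    proof (cases "u = v")
      case True
      then show ?thesis by (simp add: algebra_simps)
    next
      case False
      then show ?thesis
        using profit t uv unfolding profit_function_def strictly_concave_on_def by (meson less_imp_le)
    qed
    then show "- R x ((1 - t) *\<^sub>R u + t *\<^sub>R v) \<le> (1 - t) * - R x u + t * - R x v" by simp
  qed simp
  then have "- R x b - (- R x a) \<ge> (- deriv (R x) a) * (b - a)"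
  proof (rule convex_on_imp_above_tangent)
    show "((\<lambda>z. - R x z) has_real_derivative - deriv (R x) a) (at a within {0..})"
      using DERIV_R[OF a, of x] by (intro DERIV_minus) (rule has_field_derivative_at_within)
  qed (use a b in \<open>auto simp: interior_real_atLeast\<close>)
  then show ?thesis by simp
qed

lemma marginal_antimono:
  assumes "0 < a" "a \<le> b" shows "deriv (R x) b \<le> deriv (R x) a"
proof (cases "a = b")
  case False
  have "R x b \<le> R x a + deriv (R x) a * (b - a)" "R x a \<le> R x b + deriv (R x) b * (a - b)"
    using assms by (auto intro: R_tangent)
  then have "deriv (R x) b * (b - a) \<le> deriv (R x) a * (b - a)" by (simp add: algebra_simps)
  then show ?thesis using assms False by simp
qed simp

text \<open>The tangent at \<open>z\<close>, evaluated at 0 where \<open>R\<close> vanishes. This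
  bounds marginal profit by profit and is the source of its integrability.\<close>

lemma marginal_times_le: "0 < z \<Longrightarrow> deriv (R x) z * z \<le> R x z"
  using R_tangent[of z 0 x] R_zero by simp

text \<open>\<open>R\<close> is measurable in the first argument and continuous in the second at
  positive values, so rounding the second argument to a grid gives measurable approximations. The
  value at 0 is set by hand, as differentiability is assumed only at positive arguments.\<close>

lemma measurable_R:
  "(\<lambda>p. if 0 < snd p then R (fst p) (snd p) else 0) \<in> borel_measurable (borel \<Otimes>\<^sub>M borel)"
proof (rule borel_measurable_LIMSEQ_real)
  fix n :: nat
  let ?g = "\<lambda>i (p :: real \<times> real). if 0 < snd p then R (fst p) (max 0 (of_int (i + 1) / real (Suc n))) else 0"
  show "(\<lambda>p. ?g \<lfloor>real (Suc n) * snd p\<rfloor> p) \<in> borel_measurable (borel \<Otimes>\<^sub>M borel)"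
  proof (rule measurable_compose_countable[where f = ?g])
    fix i :: int
    have "(\<lambda>p. R (fst p) (max 0 (of_int (i + 1) / real (Suc n)))) \<in> borel_measurable (borel \<Otimes>\<^sub>M borel)"
      by (rule measurable_compose[OF measurable_fst R_measurable_first]) simp
    then show "?g i \<in> borel_measurable (borel \<Otimes>\<^sub>M borel)" by measurable
  qed measurable
next
  fix p :: "real \<times> real"
  show "(\<lambda>n. if 0 < snd p then R (fst p) (max 0 (of_int (\<lfloor>real (Suc n) * snd p\<rfloor> + 1) / real (Suc n))) else 0)
      \<longlonglongrightarrow> (if 0 < snd p then R (fst p) (snd p) else 0)"
  proof (cases "0 < snd p")
    case True
    define x where "x n = of_int (\<lfloor>real (Suc n) * snd p\<rfloor> + 1) / real (Suc n)" for n
    have x: "snd p < x n" "x n \<le> snd p + inverse (real (Suc n))" for n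
    proof -
      have "real (Suc n) * snd p < of_int (\<lfloor>real (Suc n) * snd p\<rfloor> + 1)" by linarith
      then show "snd p < x n" unfolding x_def by (simp add: field_simps del: of_nat_Suc)
      have "of_int (\<lfloor>real (Suc n) * snd p\<rfloor> + 1) \<le> real (Suc n) * snd p + 1" by linarith
      then have "x n \<le> (real (Suc n) * snd p + 1) / real (Suc n)" unfolding x_def by (intro divide_right_mono) auto
      then show "x n \<le> snd p + inverse (real (Suc n))" by (simp add: field_simps del: of_nat_Suc)
    qed
    have "x \<longlonglongrightarrow> snd p"
    proof (rule tendsto_sandwich[OF _ _ tendsto_const])
      show "(\<lambda>n. snd p + inverse (real (Suc n))) \<longlonglongrightarrow> snd p"
        using tendsto_add[OF tendsto_const[of "snd p"] LIMSEQ_inverse_real_of_nat] by simp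
      show "\<forall>\<^sub>F n in sequentially. snd p \<le> x n" by (intro always_eventually allI less_imp_le x(1))
      show "\<forall>\<^sub>F n in sequentially. x n \<le> snd p + inverse (real (Suc n))" by (intro always_eventually allI x(2))
    qed
    moreover have "isCont (R (fst p)) (snd p)" using DERIV_R[OF True] by (rule DERIV_isCont)
    ultimately have "(\<lambda>n. R (fst p) (x n)) \<longlonglongrightarrow> R (fst p) (snd p)" by (rule isCont_tendsto_compose[rotated])
    moreover have "max 0 (x n) = x n" for n using x(1)[of n] True by simp
    ultimately show ?thesis using True unfolding x_def by simp
  qed simp
qed

text \<open>The derivative is a limit of difference quotients along a fixed null sequence, each of
  which is jointly measurable.\<close>

lemma measurable_marginal:
  "(\<lambda>p. if 0 < snd p then deriv (R (fst p)) (snd p) else 0) \<in> borel_measurable (borel \<Otimes>\<^sub>M borel)"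
proof (rule borel_measurable_LIMSEQ_real)
  fix n :: nat
  let ?h = "inverse (real (Suc n))"
  let ?R = "\<lambda>p. if 0 < snd p then R (fst p) (snd p) else 0"
  have 1: "(\<lambda>p. ?R (fst p, snd p + ?h)) \<in> borel_measurable (borel \<Otimes>\<^sub>M borel)"
    by (rule measurable_compose[OF _ measurable_R]) measurable
  have "(\<lambda>p. if 0 < snd p then (?R (fst p, snd p + ?h) - ?R p) / ?h else 0) \<in> borel_measurable (borel \<Otimes>\<^sub>M borel)"
    using 1 measurable_R by measurable
  then show "(\<lambda>p. if 0 < snd p then (?R (fst p, snd p + ?h) - ?R p) / ?h else 0) \<in> borel_measurable (borel \<Otimes>\<^sub>M borel)" .
next
  fix p :: "real \<times> real"
  let ?R = "\<lambda>p. if 0 < snd p then R (fst p) (snd p) else 0"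
  show "(\<lambda>n. if 0 < snd p then (?R (fst p, snd p + inverse (real (Suc n))) - ?R p) / inverse (real (Suc n)) else 0)
     \<longlonglongrightarrow> (if 0 < snd p then deriv (R (fst p)) (snd p) else 0)"
  proof (cases "0 < snd p")
    case True
    have pos: "0 < snd p + inverse (real (Suc n))" for n using True by (intro add_pos_pos) auto
    have "((\<lambda>h. (R (fst p) (snd p + h) - R (fst p) (snd p)) / h) \<longlongrightarrow> deriv (R (fst p)) (snd p)) (at 0)"
      using DERIV_R[OF True] unfolding DERIV_def .
    moreover have "filterlim (\<lambda>n. inverse (real (Suc n))) (at 0) sequentially"
      unfolding filterlim_at using LIMSEQ_inverse_real_of_nat by simp
    ultimately have "(\<lambda>n. (R (fst p) (snd p + inverse (real (Suc n))) - R (fst p) (snd p)) / inverse (real (Suc n)))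
        \<longlonglongrightarrow> deriv (R (fst p)) (snd p)" by (rule filterlim_compose)
    then show ?thesis using True pos by simp
  qed simp
qed

lemma marginal_profit_antimono:
  assumes "z \<le> w" shows "marginal_profit R x w \<le> marginal_profit R x z"
proof (cases "z \<le> 0 \<or> w = \<infinity>")
  case True
  then show ?thesis using assms by (auto simp: marginal_profit_def)
next
  case False
  then obtain a b where "z = ereal a" "w = ereal b" "0 < a" "a \<le> b"
    using assms by (cases z; cases w) auto
  then show ?thesis by (auto simp: marginal_profit_def intro!: ennreal_leI marginal_antimono)
qed

lemma marginal_profit_ereal: "0 < z \<Longrightarrow> marginal_profit R x (ereal z) = ennreal (deriv (R x) z)"
  by (simp add: marginal_profit_def)

lemma measurable_marginal_profit:
  "(\<lambda>p. marginal_profit R (fst p) (snd p)) \<in> borel_measurable (borel \<Otimes>\<^sub>M borel)"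
proof -
  have m: "(\<lambda>p. (\<lambda>p. if 0 < snd p then deriv (R (fst p)) (snd p) else 0) (fst p, real_of_ereal (snd p)))
      \<in> borel_measurable (borel \<Otimes>\<^sub>M borel)"
    by (rule measurable_compose[OF _ measurable_marginal]) measurable
  have "marginal_profit R (fst p) (snd p) = (if snd p \<le> 0 then \<infinity> else if snd p = \<infinity> then 0 else
      ennreal ((\<lambda>p. if 0 < snd p then deriv (R (fst p)) (snd p) else 0) (fst p, real_of_ereal (snd p))))" for p
    by (cases "snd p") (auto simp: marginal_profit_def)
  then have eq: "(\<lambda>p. marginal_profit R (fst p) (snd p)) = (\<lambda>p. if snd p \<le> 0 then \<infinity> else if snd p = \<infinity> then 0 else
      ennreal ((\<lambda>p. if 0 < snd p then deriv (R (fst p)) (snd p) else 0) (fst p, real_of_ereal (snd p))))"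
    by (rule ext)
  show ?thesis unfolding eq by (intro measurable_If measurable_compose[OF m] measurable_ennreal) measurable
qed

end

subsection \<open>Level times and Stieltjes measures\<close>

definition level_time :: "(real \<Rightarrow> real) \<Rightarrow> real \<Rightarrow> ennreal" where
  "level_time f c = (INF u\<in>{u. 0 \<le> u \<and> c < f u}. ennreal u)"

text \<open>By left-continuity a level exceeded at \<open>t > 0\<close> was exceeded shortly before.
  No time precedes 0, which explains the proviso at \<open>t = 0\<close>: there both sides are
  false.\<close>

lemma level_time_less_iff:
  assumes f: "nondecreasing_left_cont f" and t: "0 < t \<or> (t = 0 \<and> f 0 \<le> c)"
  shows "level_time f c < ennreal t \<longleftrightarrow> c < f t"
proof -
  have m: "f a \<le> f b" if "0 \<le> a" "a \<le> b" for a b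
    using f that unfolding nondecreasing_left_cont_def by (auto intro: mono_onD)
  show ?thesis
  proof
    assume "level_time f c < ennreal t"
    then obtain u where "0 \<le> u" "c < f u" "ennreal u < ennreal t" unfolding level_time_def INF_less_iff by auto
    then show "c < f t" using m[of u t] by (simp add: ennreal_less_iff)
  next
    assume c: "c < f t"
    then have t: "0 < t" using t by auto
    have "(f \<longlongrightarrow> f t) (at_left t)" using f t unfolding nondecreasing_left_cont_def continuous_within by auto
    then have "eventually (\<lambda>x. c < f x) (at_left t)" using c by (rule order_tendstoD)
    moreover have "eventually (\<lambda>x. x \<in> {0<..<t}) (at_left t)" using t by (rule eventually_at_left_real)
    ultimately have "eventually (\<lambda>x. c < f x \<and> x \<in> {0<..<t}) (at_left t)" by (rule eventually_conj)
    then obtain u where "c < f u" "0 < u" "u < t"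
      using eventually_happens[of _ "at_left t"] by (auto simp: trivial_limit_at_left_real)
    then show "level_time f c < ennreal t"
      unfolding level_time_def INF_less_iff by (auto intro!: exI[of _ u] ennreal_lessI)
  qed
qed

lemma level_time_finite_iff:
  "level_time f c < \<infinity> \<longleftrightarrow> (\<exists>u\<ge>0. c < f u)"
  unfolding level_time_def INF_less_iff by auto

lemma measurable_level_time:
  assumes f: "\<And>x. x \<in> space N \<Longrightarrow> nondecreasing_left_cont (f x)"
    and c: "c \<in> borel_measurable N" and ft: "\<And>t. 0 \<le> t \<Longrightarrow> (\<lambda>x. f x t) \<in> borel_measurable N"
  shows "(\<lambda>x. level_time (f x) (c x)) \<in> borel_measurable N"
proof (rule borel_measurableI_less)
  fix y :: ennreal
  note [measurable] = c
  show "{x\<in>space N. level_time (f x) (c x) < y} \<in> sets N"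
  proof (cases y)
    case (real t)
    show ?thesis
    proof (cases "t = 0")
      case True
      then show ?thesis using real by simp
    next
      case False
      then have [measurable]: "(\<lambda>x. f x t) \<in> borel_measurable N" using real ft by auto
      have "{x\<in>space N. level_time (f x) (c x) < y} = {x\<in>space N. c x < f x t}"
        using real False f level_time_less_iff by auto
      then show ?thesis by simp
    qed
  next
    case top
    have [measurable]: "(\<lambda>x. f x (real n)) \<in> borel_measurable N" for n using ft by auto
    have "(\<exists>u\<ge>0. c x < f x u) \<longleftrightarrow> (\<exists>n::nat. c x < f x (real n))" if "x \<in> space N" for x
    proof
      assume "\<exists>u\<ge>0. c x < f x u"
      then obtain u where u: "0 \<le> u" "c x < f x u" by blast
      obtain n where "u \<le> real n" using real_arch_simple by blast
      then have "f x u \<le> f x (real n)"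
        using f[OF that] u unfolding nondecreasing_left_cont_def by (auto intro: mono_onD)
      then show "\<exists>n::nat. c x < f x (real n)" using u by (intro exI[of _ n]) simp
    next
      assume "\<exists>n::nat. c x < f x (real n)"
      then show "\<exists>u\<ge>0. c x < f x u" using of_nat_0_le_iff by blast
    qed
    then have "{x\<in>space N. level_time (f x) (c x) < y} = {x\<in>space N. \<exists>n::nat. c x < f x (real n)}"
      using top level_time_finite_iff by auto
    then show ?thesis by simp
  qed
qed

text \<open>\<open>df\<close> is the image of Lebesgue measure on the levels under the generalized
  inverse of \<open>f\<close>: the levels passed during \<open>[a,b)\<close> with
  \<open>0 \<le> a \<le> b\<close> are exactly \<open>[f a, f b)\<close>. Levels below
  \<open>f 0\<close> also have level time 0 but are never passed, hence the condition on
  \<open>c\<close>.\<close>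

lemma nn_integral_left_stieltjes:
  assumes f: "nondecreasing_left_cont f" and g: "g \<in> borel_measurable borel"
  shows "(\<integral>\<^sup>+t\<in>{0..}. g t \<partial>left_stieltjes f) =
    (\<integral>\<^sup>+c. g (enn2real (level_time f c)) * indicator {c. f 0 \<le> c \<and> level_time f c < \<infinity>} c \<partial>lborel)"
proof -
  have m: "f a \<le> f b" if "0 \<le> a" "a \<le> b" for a b
    using f that unfolding nondecreasing_left_cont_def by (auto intro: mono_onD)
  have lt[measurable]: "level_time f \<in> borel_measurable borel"
    by (rule measurable_level_time[where f = "\<lambda>_. f" and c = "\<lambda>c. c"]) (use f in auto)
  let ?C = "{c. f 0 \<le> c \<and> level_time f c < \<infinity>}"
  let ?h = "\<lambda>c. enn2real (level_time f c)"
  have C: "?C \<in> sets borel" by measurable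
  let ?S = "left_stieltjes f"
  have sets_S[measurable_cong]: "sets ?S = sets borel" unfolding left_stieltjes_def by simp
  have space_S: "space ?S = UNIV" using sets_eq_imp_space_eq[OF sets_S] by simp
  let ?N1 = "density ?S (indicator {0..})" and ?N2 = "distr (density lborel (indicator ?C)) borel ?h"
  have h: "?h c < t \<longleftrightarrow> c < f t" if "c \<in> ?C" "0 \<le> t" for c t
  proof -
    have "level_time f c = ennreal (?h c)" using that by simp
    then have "?h c < t \<longleftrightarrow> level_time f c < ennreal t" using that by (metis enn2real_nonneg ennreal_less_iff)
    then show ?thesis using level_time_less_iff[OF f, of t c] that by (cases "t = 0") auto
  qed
  have N12: "emeasure ?N1 {a..<b} = ennreal (if max a 0 \<le> b then f b - f (max a 0) else 0)"
    "emeasure ?N2 {a..<b} = ennreal (if max a 0 \<le> b then f b - f (max a 0) else 0)" for a b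
  proof -
    have "emeasure ?N1 {a..<b} = (\<integral>\<^sup>+t. indicator {0..} t * indicator {a..<b} t \<partial>?S)"
      by (rule emeasure_density) (simp_all add: sets_S)
    also have "\<dots> = (\<integral>\<^sup>+t. indicator ({0..} \<inter> {a..<b}) t \<partial>?S)"
      by (simp only: indicator_inter_arith)
    also have "\<dots> = emeasure ?S ({0..} \<inter> {a..<b})" by (rule nn_integral_indicator) (simp add: sets_S)
    also have "{0..} \<inter> {a..<b} = {max a 0..<b}" by auto
    also have "emeasure ?S {max a 0..<b} = ennreal (if max a 0 \<le> b then f b - f (max a 0) else 0)"
      using emeasure_left_stieltjes_Ico[OF f, of "max a 0" b] by auto
    finally show "emeasure ?N1 {a..<b} = ennreal (if max a 0 \<le> b then f b - f (max a 0) else 0)" .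
    have "emeasure ?N2 {a..<b} = emeasure (density lborel (indicator ?C)) (?h -` {a..<b} \<inter> UNIV)"
      by (subst emeasure_distr) auto
    also have "\<dots> = (\<integral>\<^sup>+c. indicator ?C c * indicator (?h -` {a..<b} \<inter> UNIV) c \<partial>lborel)"
    proof (rule emeasure_density)
      show "?h -` {a..<b} \<inter> UNIV \<in> sets lborel"
        using measurable_sets[of ?h borel borel "{a..<b}"] by simp
    qed (use C in auto)
    also have "\<dots> = (\<integral>\<^sup>+c. indicator (?C \<inter> ?h -` {a..<b}) c \<partial>lborel)"
      by (intro nn_integral_cong) (auto simp: indicator_def)
    also have "?C \<inter> ?h -` {a..<b} = (if max a 0 \<le> b then {f (max a 0)..<f b} else {})"
    proof (cases "max a 0 \<le> b")
      case True
      have "c \<in> ?C \<inter> ?h -` {a..<b} \<longleftrightarrow> f (max a 0) \<le> c \<and> c < f b" for c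
      proof
        assume c: "c \<in> ?C \<inter> ?h -` {a..<b}"
        then have cC: "c \<in> ?C" and hc: "a \<le> ?h c" "?h c < b" by auto
        have "c < f b" using h[OF cC, of b] hc True by simp
        moreover have "\<not> ?h c < max a 0" using hc enn2real_nonneg[of "level_time f c"] by linarith
        then have "f (max a 0) \<le> c" using h[OF cC, of "max a 0"] by simp
        ultimately show "f (max a 0) \<le> c \<and> c < f b" by simp
      next
        assume c: "f (max a 0) \<le> c \<and> c < f b"
        have "f 0 \<le> f (max a 0)" by (rule m) auto
        moreover have "level_time f c < \<infinity>" unfolding level_time_finite_iff using c True by (intro exI[of _ b]) simp
        ultimately have cC: "c \<in> ?C" using c by simp
        have "?h c < b" using h[OF cC, of b] c True by simp
        moreover have "\<not> ?h c < max a 0" unfolding h[OF cC max.cobounded2] using c by linarith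
        then have "a \<le> ?h c" by linarith
        ultimately show "c \<in> ?C \<inter> ?h -` {a..<b}" using cC by (intro IntI vimageI2) (simp_all only: atLeastLessThan_iff)
      qed
      then have "?C \<inter> ?h -` {a..<b} = {f (max a 0)..<f b}" by (intro set_eqI) (simp only: atLeastLessThan_iff)
      then show ?thesis using True by simp
    next
      case False
      have "c \<notin> ?h -` {a..<b}" for c
      proof
        assume "c \<in> ?h -` {a..<b}"
        then have "a \<le> ?h c" "?h c < b" by auto
        then show False using False enn2real_nonneg[of "level_time f c"] by linarith
      qed
      then have "?C \<inter> ?h -` {a..<b} = {}" by blast
      then show ?thesis by (simp only: False if_False)
    qed
    also have "(\<integral>\<^sup>+c. indicator (if max a 0 \<le> b then {f (max a 0)..<f b} else {}) c \<partial>lborel) =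
        ennreal (if max a 0 \<le> b then f b - f (max a 0) else 0)"
      using m[of "max a 0" b] by auto
    finally show "emeasure ?N2 {a..<b} = ennreal (if max a 0 \<le> b then f b - f (max a 0) else 0)" .
  qed
  have "?N1 = ?N2"
  proof (rule measure_eqI_generator_eq[where E = "range (\<lambda>(a, b). {a..<b::real})" and \<Omega> = UNIV and A = "\<lambda>n. {- real n..<real n}"])
    show "Int_stable (range (\<lambda>(a, b). {a..<b::real}))"
      unfolding Int_stable_def
    proof safe
      fix a b c d :: real
      have "{a..<b} \<inter> {c..<d} = {max a c..<min b d}" by auto
      then show "{a..<b} \<inter> {c..<d} \<in> range (\<lambda>(a, b). {a..<b})" by auto
    qed
    show "sets ?N1 = sigma_sets UNIV (range (\<lambda>(a, b). {a..<b::real}))"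
      by (simp add: sets_S) (subst borel_eq_atLeastLessThan, simp)
    show "sets ?N2 = sigma_sets UNIV (range (\<lambda>(a, b). {a..<b::real}))"
      by simp (subst borel_eq_atLeastLessThan, simp)
    show "(\<Union>n. {- real n..<real n}) = UNIV"
    proof (intro set_eqI iffI UNIV_I)
      fix x :: real
      obtain n where "\<bar>x\<bar> < real n" using reals_Archimedean2 by blast
      then have "x \<in> {- real n..<real n}" by auto
      then show "x \<in> (\<Union>n. {- real n..<real n})" by blast
    qed
    show "X \<in> range (\<lambda>(a, b). {a..<b}) \<Longrightarrow> emeasure ?N1 X = emeasure ?N2 X" for X
      using N12 by auto
  qed (auto simp: N12)
  have "(\<integral>\<^sup>+t\<in>{0..}. g t \<partial>?S) = (\<integral>\<^sup>+t. g t \<partial>?N1)"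
    using g by (subst nn_integral_density) (auto simp: mult.commute sets_S measurable_cong_sets[OF sets_S refl])
  also have "\<dots> = (\<integral>\<^sup>+t. g t \<partial>?N2)" using \<open>?N1 = ?N2\<close> by simp
  also have "\<dots> = (\<integral>\<^sup>+c. g (?h c) \<partial>density lborel (indicator ?C))"
    using g by (subst nn_integral_distr) auto
  also have "\<dots> = (\<integral>\<^sup>+c. g (?h c) * indicator ?C c \<partial>lborel)"
    using g C by (subst nn_integral_density) (auto simp: mult.commute)
  finally show ?thesis .
qed

lemma nn_integral_exp_ray:
  assumes "0 < \<delta>" "0 \<le> a"
  shows "(\<integral>\<^sup>+s. ennreal (\<delta> * exp (- \<delta> * s)) * indicator {a<..} s \<partial>lborel) = ennreal (exp (- \<delta> * a))"
proof -
  have "filterlim (\<lambda>s. - \<delta> * s) at_bot at_top"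
    using assms by (intro filterlim_tendsto_neg_mult_at_bot[OF tendsto_const] filterlim_ident) auto
  then have "((\<lambda>s. - exp (- \<delta> * s)) \<longlongrightarrow> - 0) at_top"
    by (intro tendsto_minus filterlim_compose[OF exp_at_bot])
  then have "(\<integral>\<^sup>+s. ennreal (\<delta> * exp (- \<delta> * s)) * indicator {a..} s \<partial>lborel) = ennreal (- 0 - (- exp (- \<delta> * a)))"
    using assms by (intro nn_integral_FTC_atLeast) (auto intro!: derivative_eq_intros)
  moreover have "(\<integral>\<^sup>+s. ennreal (\<delta> * exp (- \<delta> * s)) * indicator {a<..} s \<partial>lborel) =
      (\<integral>\<^sup>+s. ennreal (\<delta> * exp (- \<delta> * s)) * indicator {a..} s \<partial>lborel)"
    using AE_lborel_singleton[of a] by (intro nn_integral_cong_AE) (auto simp: indicator_def)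
  ultimately show ?thesis by simp
qed

text \<open>Integration by parts through levels: each level contributes the discount factor at its
  level time, which is the integral of \<delta> \<open>exp (- \<delta> * s)\<close> over later
  \<open>s\<close>. After exchanging integrals, the levels passed before \<open>s\<close> fill
  \<open>[f 0, f s)\<close>.\<close>

lemma nn_integral_exp_left_stieltjes:
  assumes f: "nondecreasing_left_cont f" and \<delta>: "0 < \<delta>"
  shows "(\<integral>\<^sup>+t\<in>{0..}. ennreal (exp (- \<delta> * t)) \<partial>left_stieltjes f) =
    (\<integral>\<^sup>+s\<in>{0..}. ennreal (\<delta> * exp (- \<delta> * s) * (f s - f 0)) \<partial>lborel)"
proof -
  have m: "f a \<le> f b" if "0 \<le> a" "a \<le> b" for a b
    using f that unfolding nondecreasing_left_cont_def by (auto intro: mono_onD)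
  let ?C = "{c. f 0 \<le> c \<and> level_time f c < \<infinity>}"
  have lt[measurable]: "level_time f \<in> borel_measurable borel"
    by (rule measurable_level_time[where f = "\<lambda>_. f" and c = "\<lambda>c. c"]) (use f in auto)
  let ?I = "\<lambda>c s. if f 0 \<le> c \<and> level_time f c < ennreal s then 1 else 0 :: ennreal"
  let ?d = "\<lambda>s. ennreal (\<delta> * exp (- \<delta> * s))"
  have I: "indicator {enn2real (level_time f c)<..} s * indicator ?C c = ?I c s" for c s
  proof (cases "level_time f c")
    case (real r)
    then show ?thesis by (cases "0 \<le> s") (auto simp: indicator_def ennreal_less_iff ennreal_neg)
  qed (auto simp: indicator_def top.extremum_strict)
  have "(\<integral>\<^sup>+t\<in>{0..}. ennreal (exp (- \<delta> * t)) \<partial>left_stieltjes f) =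
    (\<integral>\<^sup>+c. ennreal (exp (- \<delta> * enn2real (level_time f c))) * indicator ?C c \<partial>lborel)"
    by (rule nn_integral_left_stieltjes[OF f]) measurable
  also have "\<dots> = (\<integral>\<^sup>+c. (\<integral>\<^sup>+s. ?d s * indicator {enn2real (level_time f c)<..} s \<partial>lborel) * indicator ?C c \<partial>lborel)"
    using nn_integral_exp_ray[OF \<delta>] by (intro nn_integral_cong) simp
  also have "\<dots> = (\<integral>\<^sup>+c. (\<integral>\<^sup>+s. ?d s * ?I c s \<partial>lborel) \<partial>lborel)"
    by (intro nn_integral_cong, subst nn_integral_multc[symmetric]) (simp_all only: mult.assoc I, measurable)
  also have "\<dots> = (\<integral>\<^sup>+s. (\<integral>\<^sup>+c. ?d s * ?I c s \<partial>lborel) \<partial>lborel)"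
    by (rule lborel_pair.Fubini') measurable
  also have "\<dots> = (\<integral>\<^sup>+s. ?d s * (\<integral>\<^sup>+c. ?I c s \<partial>lborel) \<partial>lborel)"
    by (intro nn_integral_cong nn_integral_cmult) measurable
  also have "\<dots> = (\<integral>\<^sup>+s. ?d s * (ennreal (f s - f 0) * indicator {0..} s) \<partial>lborel)"
  proof (intro nn_integral_cong arg_cong2[where f = times] refl)
    fix s :: real
    have "?I c s = indicator (if 0 \<le> s then {f 0..<f s} else {}) c" for c
    proof (cases "f 0 \<le> c \<and> 0 \<le> s")
      case True
      then have "level_time f c < ennreal s \<longleftrightarrow> c < f s" by (intro level_time_less_iff[OF f]) auto
      then show ?thesis using True by (simp add: indicator_def)
    qed (auto simp: indicator_def ennreal_neg)
    then show "(\<integral>\<^sup>+c. ?I c s \<partial>lborel) = ennreal (f s - f 0) * indicator {0..} s"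
      using m[of 0 s] by simp
  qed
  also have "\<dots> = (\<integral>\<^sup>+s\<in>{0..}. ennreal (\<delta> * exp (- \<delta> * s) * (f s - f 0)) \<partial>lborel)"
    using \<delta> m by (intro nn_integral_cong) (auto simp: indicator_def ennreal_mult[symmetric])
  finally show ?thesis .
qed

subsection \<open>The candidate and the base capacity process\<close>

locale investment = usual_filtered_space M F + profit R
  for M :: "'a measure" and F :: "ennreal \<Rightarrow> 'a measure" and R :: "real \<Rightarrow> real \<Rightarrow> real" +
  fixes \<delta> y \<theta>\<^sub>o :: real and \<theta> X l :: "real \<Rightarrow> 'a \<Rightarrow> real"
  assumes delta_pos: "0 < \<delta>" and y_pos: "0 < y"
    and resource: "resource_process M F \<theta> \<theta>\<^sub>o"
    and X_progressive: "progressive F X"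
    and R_integrable: "integrable (M \<Otimes>\<^sub>M restrict_space lborel {0..})
           (\<lambda>(\<omega>, t). exp (- \<delta> * t) * R (X t \<omega>) (\<theta> t \<omega>))"
    and admissible_nonempty: "admissible M F \<theta> y \<noteq> {}"
    and base: "base_capacity M F \<delta> R X l"
begin

section \<open>Admissibility of the candidate\<close>

abbreviation "\<nu> \<equiv> nu_star l \<theta> y"

lemma theta_adapted: "adapted F \<theta>"
  and theta_left_cont: "\<omega> \<in> space M \<Longrightarrow> nondecreasing_left_cont (\<lambda>t. \<theta> t \<omega>)"
  and theta_zero: "\<omega> \<in> space M \<Longrightarrow> \<theta> 0 \<omega> = \<theta>\<^sub>o"
  and theta_sup: "(\<integral>\<^sup>+\<omega>. (SUP t\<in>{0..}. ennreal (\<theta> t \<omega>)) \<partial>M) < \<infinity>"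
  using resource unfolding resource_process_def by auto

lemma theta_mono: "\<omega> \<in> space M \<Longrightarrow> 0 \<le> a \<Longrightarrow> a \<le> b \<Longrightarrow> \<theta> a \<omega> \<le> \<theta> b \<omega>"
  using theta_left_cont[of \<omega>] unfolding nondecreasing_left_cont_def by (auto intro: mono_onD)

text \<open>An admissible capacity starts at \<open>y\<close> and stays below \<theta>, whose
  initial value is a constant; an inequality between constants that holds almost surely holds
  outright.\<close>

lemma y_le_theta: "\<omega> \<in> space M \<Longrightarrow> 0 \<le> t \<Longrightarrow> y \<le> \<theta> t \<omega>"
proof -
  assume \<omega>: "\<omega> \<in> space M" and t: "0 \<le> t"
  obtain \<mu> where "AE \<omega> in M. \<mu> 0 \<omega> = y" "AE \<omega> in M. \<forall>t\<ge>0. \<mu> t \<omega> \<le> \<theta> t \<omega>"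
    using admissible_nonempty unfolding admissible_def by auto
  then have "AE \<omega> in M. y \<le> \<theta>\<^sub>o"
    using AE_space by eventually_elim (auto simp: theta_zero[symmetric])
  then have "y \<le> \<theta>\<^sub>o" by simp
  also have "\<dots> \<le> \<theta> t \<omega>" using theta_mono[OF \<omega>, of 0 t] t \<omega> by (simp add: theta_zero)
  finally show ?thesis .
qed

text \<open>The maximum lies between \<open>y\<close> and \<open>\<theta> t\<close>, hence is
  finite, and the conversion to a real number in \<open>nu_star\<close> loses nothing.\<close>

lemma ereal_nu:
  assumes "\<omega> \<in> space M" "0 \<le> t"
  shows "ereal (\<nu> t \<omega>) = max (SUP s\<in>{0..<t}. ereal (min (l s \<omega>) (\<theta> s \<omega>))) (ereal y)"
    and nu_le_theta: "\<nu> t \<omega> \<le> \<theta> t \<omega>"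
proof -
  let ?m = "max (SUP s\<in>{0..<t}. ereal (min (l s \<omega>) (\<theta> s \<omega>))) (ereal y)"
  have le: "?m \<le> ereal (\<theta> t \<omega>)"
    using y_le_theta[OF assms] theta_mono[OF assms(1)] by (auto intro!: SUP_least simp: min_le_iff_disj)
  have ge: "ereal y \<le> ?m" by simp
  have "\<bar>m\<bar> \<noteq> \<infinity>" if "ereal y \<le> m" "m \<le> ereal (\<theta> t \<omega>)" for m using that by (cases m) auto
  from this[OF ge le] have "\<bar>?m\<bar> \<noteq> \<infinity>" .
  then show eq: "ereal (\<nu> t \<omega>) = ?m" unfolding nu_star_def by (simp add: ereal_real)
  show "\<nu> t \<omega> \<le> \<theta> t \<omega>" using le unfolding eq[symmetric] by simp
qed

text \<open>A strict inequality turns the supremum into an existence statement, so superlevel sets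
  of \<nu> become projections. The alternative \<open>c < y\<close> covers \<open>t = 0\<close>,
  where no \<open>s\<close> is available.\<close>

lemma less_nu_iff:
  assumes "\<omega> \<in> space M" "0 \<le> t"
  shows "c < \<nu> t \<omega> \<longleftrightarrow> c < y \<or> (\<exists>s. 0 \<le> s \<and> s < t \<and> c < l s \<omega> \<and> c < \<theta> s \<omega>)"
proof -
  have "c < \<nu> t \<omega> \<longleftrightarrow> ereal c < ereal (\<nu> t \<omega>)" by simp
  also have "\<dots> \<longleftrightarrow> c < y \<or> (\<exists>s. 0 \<le> s \<and> s < t \<and> c < l s \<omega> \<and> c < \<theta> s \<omega>)"
    unfolding ereal_nu[OF assms] less_max_iff_disj less_SUP_iff by auto
  finally show ?thesis .
qed

lemma y_le_nu: "\<omega> \<in> space M \<Longrightarrow> 0 \<le> t \<Longrightarrow> y \<le> \<nu> t \<omega>"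
  using less_nu_iff[of \<omega> t] by (metis linorder_not_less order_less_irrefl)

lemma nu_pos: "\<omega> \<in> space M \<Longrightarrow> 0 \<le> t \<Longrightarrow> 0 < \<nu> t \<omega>"
  using y_le_nu y_pos by fastforce

lemma nu_zero: "\<omega> \<in> space M \<Longrightarrow> \<nu> 0 \<omega> = y"
  using less_nu_iff[of \<omega> 0 y] y_le_nu[of \<omega> 0] by auto

lemma nu_mono:
  assumes "\<omega> \<in> space M" "0 \<le> a" "a \<le> b" shows "\<nu> a \<omega> \<le> \<nu> b \<omega>"
proof (rule ccontr)
  assume "\<not> \<nu> a \<omega> \<le> \<nu> b \<omega>"
  then have "\<nu> b \<omega> < \<nu> a \<omega>" by simp
  then have "\<nu> b \<omega> < \<nu> b \<omega>"
    using less_nu_iff[of \<omega> a "\<nu> b \<omega>"] less_nu_iff[of \<omega> b "\<nu> b \<omega>"] assms by (meson order_less_le_trans order_trans)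
  then show False by simp
qed

lemma min_le_nu: "\<omega> \<in> space M \<Longrightarrow> 0 \<le> s \<Longrightarrow> s < t \<Longrightarrow> min (l s \<omega>) (\<theta> s \<omega>) \<le> \<nu> t \<omega>"
  using less_nu_iff[of \<omega> t "\<nu> t \<omega>"] by (fastforce simp: min_le_iff_disj not_less)

text \<open>The supremum runs over \<open>[0,t)\<close>: whatever lifts \<open>\<nu> t\<close> above
  a level \<open>c \<ge> y\<close> happens at some \<open>s < t\<close> and has already lifted \<nu>
  on \<open>(s,t)\<close>.\<close>

lemma nu_left_cont:
  assumes \<omega>: "\<omega> \<in> space M" shows "nondecreasing_left_cont (\<lambda>t. \<nu> t \<omega>)"
  unfolding nondecreasing_left_cont_def
proof (intro conjI allI impI)
  show "mono_on {0..} (\<lambda>t. \<nu> t \<omega>)" using nu_mono[OF \<omega>] by (auto intro!: mono_onI)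
  fix t :: real assume t: "0 < t"
  show "continuous (at_left t) (\<lambda>t. \<nu> t \<omega>)"
    unfolding continuous_within
  proof (rule order_tendstoI)
    fix c assume c: "c < \<nu> t \<omega>"
    have ev: "\<forall>\<^sub>F x in at_left t. x \<in> {s<..<t}" if "s < t" for s using that by (rule eventually_at_left_real)
    show "\<forall>\<^sub>F x in at_left t. c < \<nu> x \<omega>"
    proof (cases "c < y")
      case True
      show ?thesis using ev[OF t] by eventually_elim (use True y_le_nu[OF \<omega>] in \<open>auto intro: less_le_trans\<close>)
    next
      case False
      then obtain s where s: "0 \<le> s" "s < t" "c < l s \<omega>" "c < \<theta> s \<omega>" using c less_nu_iff[OF \<omega>, of t c] t by auto
      show ?thesis using ev[OF s(2)]
      proof eventually_elim
        case (elim x)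
        then show ?case using s less_nu_iff[OF \<omega>, of x c] by auto
      qed
    qed
  next
    fix c assume c: "\<nu> t \<omega> < c"
    show "\<forall>\<^sub>F x in at_left t. \<nu> x \<omega> < c"
      using eventually_at_left_real[OF t]
    proof eventually_elim
      case (elim x)
      then have "\<nu> x \<omega> \<le> \<nu> t \<omega>" by (intro nu_mono[OF \<omega>]) auto
      then show ?case using c by (rule le_less_trans)
    qed
  qed
qed

lemma l_progressive: "progressive F l"
  using base progressive_optional unfolding base_capacity_def by auto

lemma l_urc: "\<omega> \<in> space M \<Longrightarrow> 0 \<le> t \<Longrightarrow> ereal (l t \<omega>) = Limsup (at_right t) (\<lambda>s. ereal (l s \<omega>))"
  using base unfolding base_capacity_def upper_right_continuous_def by auto

lemma theta_progressive: "progressive F \<theta>"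
  using progressive_left_continuous theta_adapted theta_left_cont by auto

text \<open>For \<open>c \<ge> y\<close> the event \<open>c < \<nu> t\<close> is the projection of a
  progressive set of times before \<open>t\<close>, so the uncountable supremum is harmless.\<close>

lemma nu_adapted: "adapted F \<nu>"
  unfolding adapted_def
proof (intro allI impI)
  fix t :: real assume t: "0 \<le> t"
  show "\<nu> t \<in> borel_measurable (F (ennreal t))"
  proof (rule borel_measurableI_greater)
    fix c
    let ?N = "F (ennreal t) \<Otimes>\<^sub>M restrict_space borel {0..t}"
    have [measurable]: "(\<lambda>(\<omega>, s). l s \<omega>) \<in> borel_measurable ?N" "(\<lambda>(\<omega>, s). \<theta> s \<omega>) \<in> borel_measurable ?N"
      using l_progressive theta_progressive t unfolding progressive_def by auto
    have snd: "snd \<in> borel_measurable ?N"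
      by (rule measurable_compose[OF measurable_snd measurable_restrict_space1]) simp
    let ?B = "{x\<in>space ?N. c < (case x of (\<omega>, s) \<Rightarrow> l s \<omega>) \<and> c < (case x of (\<omega>, s) \<Rightarrow> \<theta> s \<omega>) \<and> snd x < t}"
    have "?B \<in> sets ?N" using snd by measurable
    from projection_F[OF this]
    have "fst ` ?B \<in> sets (F (ennreal t))" .
    moreover have "fst ` ?B = {\<omega>\<in>space M. \<exists>s. 0 \<le> s \<and> s < t \<and> c < l s \<omega> \<and> c < \<theta> s \<omega>}"
    proof (intro equalityI subsetI)
      fix \<omega> assume "\<omega> \<in> {\<omega>\<in>space M. \<exists>s. 0 \<le> s \<and> s < t \<and> c < l s \<omega> \<and> c < \<theta> s \<omega>}"
      then obtain s where "\<omega> \<in> space M" "0 \<le> s" "s < t" "c < l s \<omega>" "c < \<theta> s \<omega>" by auto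
      then have "(\<omega>, s) \<in> ?B" by (simp add: space_pair_measure space_F space_restrict_space)
      then show "\<omega> \<in> fst ` ?B" by (rule image_eqI[rotated]) simp
    qed (auto simp: space_pair_measure space_F space_restrict_space)
    moreover have "{\<omega>\<in>space (F (ennreal t)). c < \<nu> t \<omega>} =
        (if c < y then space (F (ennreal t)) else {\<omega>\<in>space M. \<exists>s. 0 \<le> s \<and> s < t \<and> c < l s \<omega> \<and> c < \<theta> s \<omega>})"
      using less_nu_iff[OF _ t] by (auto simp: space_F)
    ultimately show "{\<omega>\<in>space (F (ennreal t)). c < \<nu> t \<omega>} \<in> sets (F (ennreal t))" by simp
  qed
qed

lemma nu_admissible: "\<nu> \<in> admissible M F \<theta> y"
  unfolding admissible_def using nu_adapted nu_left_cont nu_pos nu_zero nu_le_theta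
  by (auto intro!: AE_I2 less_imp_le)

lemma nu_progressive: "progressive F \<nu>"
  using progressive_left_continuous nu_adapted nu_left_cont by auto

text \<open>Stated through \<open>l\<close> and not as equality of \<nu> and \<theta>: the
  unconstrained target reaches the bound, so that \<nu> is at least \<open>\<theta> u\<close> right
  after \<open>u\<close>.\<close>

definition binding :: "real \<Rightarrow> 'a \<Rightarrow> bool" where
  "binding u \<omega> \<longleftrightarrow> \<theta> u \<omega> \<le> l u \<omega>"

abbreviation "next_binding \<equiv> next_entry binding"

lemma stopping_time_next_binding:
  assumes "stopping_time F \<tau>" shows "stopping_time F (next_binding \<tau>)"
proof (rule stopping_time_next_entry[OF _ assms])
  fix T :: real assume T: "0 \<le> T"
  let ?N = "F (ennreal T) \<Otimes>\<^sub>M restrict_space borel {0..T}"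
  have [measurable]: "(\<lambda>(\<omega>, s). l s \<omega>) \<in> borel_measurable ?N" "(\<lambda>(\<omega>, s). \<theta> s \<omega>) \<in> borel_measurable ?N"
    using l_progressive theta_progressive T unfolding progressive_def by auto
  have "{x\<in>space ?N. (case x of (\<omega>, s) \<Rightarrow> \<theta> s \<omega>) \<le> (case x of (\<omega>, s) \<Rightarrow> l s \<omega>)} \<in> sets ?N" by measurable
  also have "{x\<in>space ?N. (case x of (\<omega>, s) \<Rightarrow> \<theta> s \<omega>) \<le> (case x of (\<omega>, s) \<Rightarrow> l s \<omega>)} =
      {(\<omega>, u). \<omega> \<in> space M \<and> 0 \<le> u \<and> u \<le> T \<and> binding u \<omega>}"
    by (auto simp: space_pair_measure space_F space_restrict_space binding_def)
  finally show "{(\<omega>, u). \<omega> \<in> space M \<and> 0 \<le> u \<and> u \<le> T \<and> binding u \<omega>} \<in> sets ?N" .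
qed

text \<open>Upper right-continuity of \<open>l\<close> makes the set of binding times closed from the right.\<close>
lemma binding_next_binding:
  assumes \<omega>: "\<omega> \<in> space M" and r: "0 \<le> r" "next_binding \<tau> \<omega> = ennreal r"
  shows "binding r \<omega>"
proof (rule ccontr)
  assume nb: "\<not> binding r \<omega>"
  then have "l r \<omega> < \<theta> r \<omega>" by (simp add: binding_def)
  then have "Limsup (at_right r) (\<lambda>s. ereal (l s \<omega>)) < ereal (\<theta> r \<omega>)"
    unfolding l_urc[OF \<omega> r(1), symmetric] by simp
  then have "\<forall>\<^sub>F s in at_right r. ereal (l s \<omega>) < ereal (\<theta> r \<omega>)" by (rule Limsup_lessD)
  then obtain b where b: "r < b" "\<And>s. r < s \<Longrightarrow> s < b \<Longrightarrow> l s \<omega> < \<theta> r \<omega>"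
    unfolding eventually_at_right_field by auto
  have "next_binding \<tau> \<omega> < ennreal b" using r b by (simp add: ennreal_lessI)
  then obtain u where u: "0 \<le> u" "\<tau> \<omega> < ennreal u" "ennreal u < ennreal b" "binding u \<omega>"
    unfolding next_entry_less_iff by auto
  have "r \<le> u" using next_entry_le[of u \<tau> \<omega> binding] u r by (simp add: ennreal_le_iff)
  moreover have "u < b" using u by (simp add: ennreal_less_iff)
  moreover have "r \<noteq> u" using u nb by auto
  ultimately have "l u \<omega> < \<theta> r \<omega>" using b by auto
  moreover have "\<theta> r \<omega> \<le> \<theta> u \<omega>" using theta_mono[OF \<omega> r(1) \<open>r \<le> u\<close>] .
  ultimately show False using u(4) by (simp add: binding_def)
qed

lemma not_binding_before_next:
  assumes "\<tau> \<omega> < ennreal u" "ennreal u < next_binding \<tau> \<omega>" "0 \<le> u"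
  shows "\<not> binding u \<omega>"
  using next_entry_le[of u \<tau> \<omega> binding] assms by auto

section \<open>The running supremum of the base capacity and its pathwise comparison with the
  candidate\<close>

definition running_sup :: "ennreal \<Rightarrow> real \<Rightarrow> 'a \<Rightarrow> ereal" where
  "running_sup t s \<omega> = (SUP u\<in>{u\<in>times_from t. u < s}. ereal (l u \<omega>))"

lemma running_sup_antimono: "t \<le> t' \<Longrightarrow> running_sup t' s \<omega> \<le> running_sup t s \<omega>"
  unfolding running_sup_def times_from_def by (intro SUP_subset_mono) auto

text \<open>In \<open>s\<close> the supremum is nondecreasing, and its superlevel sets are unions of
  open rays; so no measurability of the path of \<open>l\<close> enters.\<close>

lemma measurable_running_sup: "(\<lambda>s. running_sup t s \<omega>) \<in> borel_measurable borel"
proof (rule borel_measurableI_greater)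
  fix c :: ereal
  have "{s \<in> space borel. c < running_sup t s \<omega>} = (\<Union>u\<in>{u\<in>times_from t. c < ereal (l u \<omega>)}. {u<..})"
    unfolding running_sup_def less_SUP_iff by auto
  also have "\<dots> \<in> sets borel" by (intro borel_open open_UN) auto
  finally show "{s \<in> space borel. c < running_sup t s \<omega>} \<in> sets borel" .
qed

definition marginal_flow :: "real \<Rightarrow> 'a \<Rightarrow> real" where
  "marginal_flow s \<omega> = exp (- \<delta> * s) * deriv (R (X s \<omega>)) (\<nu> s \<omega>)"

definition base_flow :: "ennreal \<Rightarrow> real \<Rightarrow> 'a \<Rightarrow> ennreal" where
  "base_flow t s \<omega> = ennreal (exp (- \<delta> * s)) * marginal_profit R (X s \<omega>) (running_sup t s \<omega>)"

text \<open>The integral in the equation of \<open>base_capacity\<close> before conditioning. Using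
  the open ray instead of \<open>times_from t\<close> changes the domain by at most one
  point.\<close>

definition base_value :: "ennreal \<Rightarrow> 'a \<Rightarrow> ennreal" where
  "base_value t \<omega> = (\<integral>\<^sup>+s\<in>{s. t < ennreal s}. base_flow t s \<omega> \<partial>lborel)"

lemma times_from_AE: "AE s in lborel. s \<in> times_from t \<longleftrightarrow> t < ennreal s"
proof -
  have "AE s in lborel. s \<noteq> enn2real t" by (rule AE_lborel_singleton)
  then show ?thesis
  proof eventually_elim
    case (elim s)
    have "0 < s" if "t < ennreal s" using that by (metis ennreal_neg less_le_not_le linorder_not_less not_less_zero)
    moreover have "t \<noteq> ennreal s" if "0 \<le> s" using elim that by auto
    ultimately show ?case unfolding times_from_def by (auto simp: less_le)
  qed
qed

lemma X_path_measurable: "\<omega> \<in> space M \<Longrightarrow> (\<lambda>s. X (max 0 s) \<omega>) \<in> borel_measurable borel"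
  using measurable_Pair2[OF progressive_measurable[OF X_progressive], of \<omega>] by simp

lemma positive_time: "t < ennreal s \<Longrightarrow> 0 < s"
  by (metis ennreal_neg linorder_not_less not_less_zero)

lemma base_flow_measurable:
  assumes \<omega>: "\<omega> \<in> space M"
  shows "(\<lambda>s. base_flow t s \<omega> * indicator {s. u < ennreal s} s) \<in> borel_measurable borel"
proof -
  have "(\<lambda>s. marginal_profit R (X (max 0 s) \<omega>) (running_sup t s \<omega>)) \<in> borel_measurable borel"
    using measurable_compose[OF measurable_Pair[OF X_path_measurable[OF \<omega>] measurable_running_sup] measurable_marginal_profit]
    by simp
  then have "(\<lambda>s. ennreal (exp (- \<delta> * s)) * marginal_profit R (X (max 0 s) \<omega>) (running_sup t s \<omega>) * indicator {s. u < ennreal s} s)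
      \<in> borel_measurable borel" by measurable
  moreover have "base_flow t s \<omega> * indicator {s. u < ennreal s} s =
      ennreal (exp (- \<delta> * s)) * marginal_profit R (X (max 0 s) \<omega>) (running_sup t s \<omega>) * indicator {s. u < ennreal s} s" for s
    using positive_time[of u s] by (auto simp: base_flow_def indicator_def)
  ultimately show ?thesis by presburger
qed

lemma base_value_split:
  assumes \<omega>: "\<omega> \<in> space M" and "t \<le> t'"
  shows "base_value t \<omega> = (\<integral>\<^sup>+s\<in>{s. t < ennreal s \<and> ennreal s \<le> t'}. base_flow t s \<omega> \<partial>lborel)
      + (\<integral>\<^sup>+s\<in>{s. t' < ennreal s}. base_flow t s \<omega> \<partial>lborel)"
proof -
  note m[measurable] = base_flow_measurable[OF \<omega>]
  have "(\<lambda>s. base_flow t s \<omega> * indicator {s. t < ennreal s \<and> ennreal s \<le> t'} s) =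
      (\<lambda>s. base_flow t s \<omega> * indicator {s. t < ennreal s} s * indicator {s. ennreal s \<le> t'} s)"
    by (auto simp: indicator_def)
  then have [measurable]: "(\<lambda>s. base_flow t s \<omega> * indicator {s. t < ennreal s \<and> ennreal s \<le> t'} s) \<in> borel_measurable borel"
    by simp
  have "base_value t \<omega> = (\<integral>\<^sup>+s. base_flow t s \<omega> * indicator {s. t < ennreal s \<and> ennreal s \<le> t'} s
      + base_flow t s \<omega> * indicator {s. t' < ennreal s} s \<partial>lborel)"
    unfolding base_value_def using assms(2) by (intro nn_integral_cong) (auto simp: indicator_def)
  also have "\<dots> = (\<integral>\<^sup>+s\<in>{s. t < ennreal s \<and> ennreal s \<le> t'}. base_flow t s \<omega> \<partial>lborel)
      + (\<integral>\<^sup>+s\<in>{s. t' < ennreal s}. base_flow t s \<omega> \<partial>lborel)"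
    by (intro nn_integral_add) auto
  finally show ?thesis .
qed

text \<open>Up to \<open>t'\<close> the supremum dominates \<nu>, and by concavity its marginal
  profit is smaller. Beyond \<open>t'\<close> a shorter window lowers the supremum and raises the
  marginal profit.\<close>

lemma base_value_le:
  assumes \<omega>: "\<omega> \<in> space M" and le: "t \<le> t'"
    and nu: "\<And>s. t < ennreal s \<Longrightarrow> ereal (\<nu> s \<omega>) \<le> running_sup t s \<omega>"
  shows "base_value t \<omega> \<le> (\<integral>\<^sup>+s\<in>{s. t < ennreal s \<and> ennreal s \<le> t'}. ennreal (marginal_flow s \<omega>) \<partial>lborel) + base_value t' \<omega>"
  unfolding base_value_split[OF \<omega> le]
proof (rule add_mono)
  show "(\<integral>\<^sup>+s\<in>{s. t < ennreal s \<and> ennreal s \<le> t'}. base_flow t s \<omega> \<partial>lborel) \<le>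
      (\<integral>\<^sup>+s\<in>{s. t < ennreal s \<and> ennreal s \<le> t'}. ennreal (marginal_flow s \<omega>) \<partial>lborel)"
  proof (rule nn_integral_mono)
    fix s
    show "base_flow t s \<omega> * indicator {s. t < ennreal s \<and> ennreal s \<le> t'} s \<le>
        ennreal (marginal_flow s \<omega>) * indicator {s. t < ennreal s \<and> ennreal s \<le> t'} s"
    proof (cases "t < ennreal s")
      case True
      have "marginal_profit R (X s \<omega>) (running_sup t s \<omega>) \<le> marginal_profit R (X s \<omega>) (ereal (\<nu> s \<omega>))"
        by (rule marginal_profit_antimono[OF nu[OF True]])
      also have "\<dots> = ennreal (deriv (R (X s \<omega>)) (\<nu> s \<omega>))"
        using positive_time[OF True] by (intro marginal_profit_ereal nu_pos[OF \<omega>]) simp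
      finally have "base_flow t s \<omega> \<le> ennreal (marginal_flow s \<omega>)"
        unfolding base_flow_def marginal_flow_def by (subst ennreal_mult') (auto intro: mult_left_mono)
      then show ?thesis by (rule mult_right_mono) simp
    qed simp
  qed
  show "(\<integral>\<^sup>+s\<in>{s. t' < ennreal s}. base_flow t s \<omega> \<partial>lborel) \<le> base_value t' \<omega>"
    unfolding base_value_def base_flow_def
    by (intro nn_integral_mono mult_right_mono mult_left_mono marginal_profit_antimono running_sup_antimono le) auto
qed

text \<open>The opposite comparison. The hypothesis \<open>after\<close> says that beyond
  \<open>t'\<close> nothing is lost by forgetting \<open>l\<close> on \<open>[t,t')\<close>.\<close>

lemma base_value_ge:
  assumes \<omega>: "\<omega> \<in> space M" and le: "t \<le> t'"
    and nu: "\<And>s. t < ennreal s \<Longrightarrow> ennreal s \<le> t' \<Longrightarrow> running_sup t s \<omega> \<le> ereal (\<nu> s \<omega>)"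
    and after: "\<And>s. t' < ennreal s \<Longrightarrow> running_sup t s \<omega> \<le> running_sup t' s \<omega>"
  shows "(\<integral>\<^sup>+s\<in>{s. t < ennreal s \<and> ennreal s \<le> t'}. ennreal (marginal_flow s \<omega>) \<partial>lborel) + base_value t' \<omega> \<le> base_value t \<omega>"
  unfolding base_value_split[OF \<omega> le]
proof (rule add_mono)
  show "(\<integral>\<^sup>+s\<in>{s. t < ennreal s \<and> ennreal s \<le> t'}. ennreal (marginal_flow s \<omega>) \<partial>lborel) \<le>
      (\<integral>\<^sup>+s\<in>{s. t < ennreal s \<and> ennreal s \<le> t'}. base_flow t s \<omega> \<partial>lborel)"
  proof (rule nn_integral_mono)
    fix s
    show "ennreal (marginal_flow s \<omega>) * indicator {s. t < ennreal s \<and> ennreal s \<le> t'} s \<le>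
        base_flow t s \<omega> * indicator {s. t < ennreal s \<and> ennreal s \<le> t'} s"
    proof (cases "t < ennreal s \<and> ennreal s \<le> t'")
      case True
      have "ennreal (deriv (R (X s \<omega>)) (\<nu> s \<omega>)) = marginal_profit R (X s \<omega>) (ereal (\<nu> s \<omega>))"
        using positive_time[of t s] True by (intro marginal_profit_ereal[symmetric] nu_pos[OF \<omega>]) simp
      also have "\<dots> \<le> marginal_profit R (X s \<omega>) (running_sup t s \<omega>)"
        using nu True by (intro marginal_profit_antimono) auto
      finally have "ennreal (marginal_flow s \<omega>) \<le> base_flow t s \<omega>"
        unfolding base_flow_def marginal_flow_def by (subst ennreal_mult') (auto intro: mult_left_mono)
      then show ?thesis by (rule mult_right_mono) simp
    qed simp
  qed
  show "base_value t' \<omega> \<le> (\<integral>\<^sup>+s\<in>{s. t' < ennreal s}. base_flow t s \<omega> \<partial>lborel)"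
    unfolding base_value_def
  proof (rule nn_integral_mono)
    fix s
    show "base_flow t' s \<omega> * indicator {s. t' < ennreal s} s \<le> base_flow t s \<omega> * indicator {s. t' < ennreal s} s"
    proof (cases "t' < ennreal s")
      case True
      then show ?thesis unfolding base_flow_def
        by (intro mult_right_mono mult_left_mono marginal_profit_antimono after) auto
    qed simp
  qed
qed

text \<open>From \<tau> on, \<nu> is explained by what \<open>l\<close> does from \<tau> on. Times
  of increase of \<nu> have this property, but so do next binding times, at which \<nu> may stay
  constant because it already equals \<theta>. Nothing is required where \<tau> is infinite.\<close>

definition increase_time :: "('a \<Rightarrow> ennreal) \<Rightarrow> bool" where
  "increase_time \<tau> \<longleftrightarrow> stopping_time F \<tau> \<and>
     (\<forall>\<omega>\<in>space M. \<forall>s. \<tau> \<omega> < ennreal s \<longrightarrow> ereal (\<nu> s \<omega>) \<le> running_sup (\<tau> \<omega>) s \<omega>)"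

lemma running_sup_geI: "0 \<le> u \<Longrightarrow> t \<le> ennreal u \<Longrightarrow> u < s \<Longrightarrow> ereal (l u \<omega>) \<le> running_sup t s \<omega>"
  unfolding running_sup_def times_from_def by (intro SUP_upper) auto

text \<open>A time \<open>u\<close> at which \<open>l\<close> lifts \<nu> above a level
  \<open>c \<ge> \<nu> t\<close> cannot precede \<open>t\<close>; it therefore belongs to the window
  of the supremum.\<close>

lemma nu_le_running_sup:
  assumes \<omega>: "\<omega> \<in> space M" and t: "0 \<le> t" "t < s" and b: "\<nu> t \<omega> < \<nu> s \<omega> \<or> ereal (\<nu> t \<omega>) \<le> running_sup (ennreal t) s \<omega>"
  shows "ereal (\<nu> s \<omega>) \<le> running_sup (ennreal t) s \<omega>"
proof (rule ccontr)
  assume "\<not> ?thesis"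
  then have less: "running_sup (ennreal t) s \<omega> < ereal (\<nu> s \<omega>)" by simp
  \<comment> \<open>The level separates \<open>\<nu> s\<close> from both \<open>\<nu> t\<close> and
    the supremum; the hypothesis \<open>b\<close> guarantees that \<open>\<nu> t < \<nu> s\<close>
    once the supremum is assumed too small.\<close>
  obtain c where c: "\<nu> t \<omega> \<le> c" "c < \<nu> s \<omega>" "running_sup (ennreal t) s \<omega> \<le> ereal c"
  proof (cases "running_sup (ennreal t) s \<omega>")
    case (real r)
    then show thesis using less b by (intro that[of "max (\<nu> t \<omega>) r"]) auto
  next
    case MInf
    then show thesis using b by (intro that[of "\<nu> t \<omega>"]) auto
  qed (use less in simp)
  then have "\<not> c < y" using y_le_nu[OF \<omega> t(1)] by auto
  then obtain u where u: "0 \<le> u" "u < s" "c < l u \<omega>" "c < \<theta> u \<omega>"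
    using c(2) less_nu_iff[OF \<omega>, of s c] t by auto
  show False
  proof (cases "u < t")
    case True
    then have "c < \<nu> t \<omega>" using u less_nu_iff[OF \<omega> t(1), of c] by auto
    then show False using c by simp
  next
    case False
    then have "ereal (l u \<omega>) \<le> running_sup (ennreal t) s \<omega>" using u by (intro running_sup_geI) (auto intro: ennreal_leI)
    then show False using c(3) u(3) by (metis ereal_less_eq(3) leD order_trans)
  qed
qed

text \<open>The infimum is attained, and at a binding time
  \<open>l \<ge> \<theta> \<ge> \<nu>\<close>, so the running supremum starts above \<nu>.\<close>

lemma increase_time_next_binding:
  assumes \<tau>: "stopping_time F \<tau>" shows "increase_time (next_binding \<tau>)"
  unfolding increase_time_def
proof (intro conjI ballI allI impI)
  fix \<omega> s assume \<omega>: "\<omega> \<in> space M" and s: "next_binding \<tau> \<omega> < ennreal s"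
  then obtain r where r: "0 \<le> r" "next_binding \<tau> \<omega> = ennreal r"
    by (cases "next_binding \<tau> \<omega>") (auto simp: top.extremum_strict)
  have rs: "r < s" using s r by (simp add: ennreal_less_iff)
  have "\<nu> r \<omega> \<le> l r \<omega>"
    using nu_le_theta[OF \<omega> r(1)] binding_next_binding[OF \<omega> r] by (simp add: binding_def)
  then have "ereal (\<nu> r \<omega>) \<le> running_sup (ennreal r) s \<omega>"
    using running_sup_geI[of r "ennreal r" s \<omega>] r rs by (metis ereal_less_eq(3) order_refl order_trans)
  then show "ereal (\<nu> s \<omega>) \<le> running_sup (next_binding \<tau> \<omega>) s \<omega>"
    unfolding r(2) by (intro nu_le_running_sup[OF \<omega> r(1) rs]) simp
qed (rule stopping_time_next_binding[OF \<tau>])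

text \<open>At the level time \<open>r\<close> one has \<open>\<nu> r \<le> c\<close>, while
  \<open>c < \<nu> s\<close> for every later \<open>s\<close>: \<nu> has truly increased since
  \<open>r\<close>.\<close>

lemma increase_time_level:
  assumes c: "y \<le> c" shows "increase_time (\<lambda>\<omega>. level_time (\<lambda>t. \<nu> t \<omega>) c)"
  unfolding increase_time_def
proof (intro conjI ballI allI impI)
  show "stopping_time F (\<lambda>\<omega>. level_time (\<lambda>t. \<nu> t \<omega>) c)"
  proof (rule stopping_timeI_less)
    fix t :: real assume t: "0 < t"
    have "{\<omega>\<in>space M. level_time (\<lambda>t. \<nu> t \<omega>) c < ennreal t} = {\<omega>\<in>space (F (ennreal t)). c < \<nu> t \<omega>}"
      using level_time_less_iff[OF nu_left_cont] t by (auto simp: space_F)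
    moreover have "\<nu> t \<in> borel_measurable (F (ennreal t))" using nu_adapted t unfolding adapted_def by auto
    ultimately show "{\<omega>\<in>space M. level_time (\<lambda>t. \<nu> t \<omega>) c < ennreal t} \<in> sets (F (ennreal t))" by simp
  qed
  fix \<omega> s assume \<omega>: "\<omega> \<in> space M" and s: "level_time (\<lambda>t. \<nu> t \<omega>) c < ennreal s"
  then obtain r where r: "0 \<le> r" "level_time (\<lambda>t. \<nu> t \<omega>) c = ennreal r"
    by (cases "level_time (\<lambda>t. \<nu> t \<omega>) c") (auto simp: top.extremum_strict)
  \<comment> \<open>The case \<open>r = 0\<close> of the criterion needs
    \<open>\<nu> 0 \<le> c\<close>; this is where \<open>y \<le> c\<close> enters.\<close>
  have "level_time (\<lambda>t. \<nu> t \<omega>) c < ennreal r \<longleftrightarrow> c < \<nu> r \<omega>"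
    by (rule level_time_less_iff[OF nu_left_cont[OF \<omega>]]) (use r c nu_zero[OF \<omega>] in auto)
  then have "\<not> c < \<nu> r \<omega>" using r by simp
  moreover have "c < \<nu> s \<omega>"
    using level_time_less_iff[OF nu_left_cont[OF \<omega>], of s c] s positive_time[OF s] by auto
  ultimately show "ereal (\<nu> s \<omega>) \<le> running_sup (level_time (\<lambda>t. \<nu> t \<omega>) c) s \<omega>"
    unfolding r(2) using s r by (intro nu_le_running_sup[OF \<omega>]) (auto simp: ennreal_less_iff)
qed

text \<open>Before the next binding time \<open>\<nu>\<close> dominates the running supremum; upper right-continuity covers the
  value of \<open>l\<close> at the initial time itself, at which the constraint may be binding.\<close>
lemma running_sup_le_nu:
  assumes \<omega>: "\<omega> \<in> space M" and s: "\<tau> \<omega> < ennreal s" "ennreal s \<le> next_binding \<tau> \<omega>"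
  shows "running_sup (\<tau> \<omega>) s \<omega> \<le> ereal (\<nu> s \<omega>)"
  unfolding running_sup_def
proof (rule SUP_least)
  fix u assume "u \<in> {u\<in>times_from (\<tau> \<omega>). u < s}"
  then have u: "0 \<le> u" "\<tau> \<omega> \<le> ennreal u" "u < s" by (auto simp: times_from_def)
  have gt: "l v \<omega> \<le> \<nu> s \<omega>" if v: "\<tau> \<omega> < ennreal v" "v < s" for v
  proof -
    have v0: "0 \<le> v" using positive_time[OF v(1)] by simp
    then have "ennreal v < ennreal s" using v by (simp add: ennreal_lessI)
    then have "\<not> binding v \<omega>"
      using s v v0 by (intro not_binding_before_next) (auto intro: less_le_trans)
    then show ?thesis using min_le_nu[OF \<omega> v0 v(2)] by (simp add: binding_def min_def split: if_splits)
  qed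
  show "ereal (l u \<omega>) \<le> ereal (\<nu> s \<omega>)"
    unfolding l_urc[OF \<omega> u(1)]
  proof (rule Limsup_bounded)
    show "\<forall>\<^sub>F v in at_right u. ereal (l v \<omega>) \<le> ereal (\<nu> s \<omega>)"
      using eventually_at_right_real[OF u(3)]
    proof eventually_elim
      case (elim v)
      then have "ennreal u < ennreal v" using u by (simp add: ennreal_lessI)
      then show ?case using gt[of v] u elim by (auto intro: le_less_trans)
    qed
  qed
qed

text \<open>Values of \<open>l\<close> from \<tau> up to the binding time \<open>r\<close> are at
  most \<open>\<nu> r\<close>, and \<open>\<nu> r \<le> \<theta> r \<le> l r\<close>. So
  \<open>l r\<close> alone outweighs them and the past of \<open>r\<close> can be forgotten.\<close>

lemma running_sup_after_next_binding:
  assumes \<omega>: "\<omega> \<in> space M" and s: "next_binding \<tau> \<omega> < ennreal s"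
  shows "running_sup (\<tau> \<omega>) s \<omega> \<le> running_sup (next_binding \<tau> \<omega>) s \<omega>"
proof -
  obtain r where r: "0 \<le> r" "next_binding \<tau> \<omega> = ennreal r"
    using s by (cases "next_binding \<tau> \<omega>") (auto simp: top.extremum_strict)
  have rs: "r < s" using s r by (simp add: ennreal_less_iff)
  have b: "\<theta> r \<omega> \<le> l r \<omega>" using binding_next_binding[OF \<omega> r] by (simp add: binding_def)
  have lr: "ereal (l r \<omega>) \<le> running_sup (next_binding \<tau> \<omega>) s \<omega>"
    using r rs by (intro running_sup_geI) auto
  show ?thesis
    unfolding running_sup_def[of "\<tau> \<omega>"]
  proof (rule SUP_least)
    fix u assume "u \<in> {u\<in>times_from (\<tau> \<omega>). u < s}"
    then have u: "0 \<le> u" "\<tau> \<omega> \<le> ennreal u" "u < s" by (auto simp: times_from_def)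
    show "ereal (l u \<omega>) \<le> running_sup (next_binding \<tau> \<omega>) s \<omega>"
    proof (cases "r \<le> u")
      case True
      then show ?thesis using r u by (intro running_sup_geI) (auto intro: ennreal_leI)
    next
      case False
      then have "ennreal u < ennreal r" using u r by (intro ennreal_lessI) auto
      with u(2) have "\<tau> \<omega> < ennreal r" by (rule le_less_trans)
      then have "running_sup (\<tau> \<omega>) r \<omega> \<le> ereal (\<nu> r \<omega>)" using r by (intro running_sup_le_nu[OF \<omega>]) auto
      moreover have "ereal (l u \<omega>) \<le> running_sup (\<tau> \<omega>) r \<omega>" using u False by (intro running_sup_geI) auto
      moreover have "ereal (\<nu> r \<omega>) \<le> ereal (l r \<omega>)" using nu_le_theta[OF \<omega> r(1)] b by simp
      ultimately show ?thesis using lr by (meson order_trans)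
    qed
  qed
qed

end

subsection \<open>The marginal gain at the candidate\<close>

text \<open>Being open at \<tau>, such rays are predictable and their differences are the stochastic
  intervals open on the left and closed on the right. Paths with \<tau> infinite contribute
  nothing.\<close>

definition stochastic_ray :: "'a set \<Rightarrow> ('a \<Rightarrow> ennreal) \<Rightarrow> ('a \<times> real) set" where
  "stochastic_ray A \<tau> = {(\<omega>, u). \<omega> \<in> A \<and> \<tau> \<omega> < ennreal u}"

context investment
begin

abbreviation "Q \<equiv> M \<Otimes>\<^sub>M (lborel :: real measure)"

lemma sets_Q: "sets Q = sets (M \<Otimes>\<^sub>M borel)"
  by (rule sets_pair_measure_cong) simp_all

lemma measurable_Q: "borel_measurable Q = borel_measurable (M \<Otimes>\<^sub>M borel)"
  by (rule measurable_cong_sets[OF sets_Q refl])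

lemma stochastic_ray_sets[measurable]:
  assumes "A \<in> sets M" and [measurable]: "\<tau> \<in> borel_measurable M"
  shows "stochastic_ray A \<tau> \<in> sets Q"
proof -
  have eq: "stochastic_ray A \<tau> = {p\<in>space Q. \<tau> (fst p) < ennreal (snd p)} \<inter> (A \<times> UNIV)"
    using sets.sets_into_space[OF assms(1)] by (auto simp: stochastic_ray_def space_pair_measure)
  have 1: "{p\<in>space Q. \<tau> (fst p) < ennreal (snd p)} \<in> sets Q" by measurable
  have 2: "A \<times> UNIV \<in> sets Q" using assms(1) by (intro pair_measureI) auto
  show ?thesis unfolding eq by (rule sets.Int[OF 1 2])
qed

lemma ray_difference_sets:
  assumes "A \<in> sets M" "\<tau> \<in> borel_measurable M" "\<rho> \<in> borel_measurable M"
  shows "stochastic_ray A \<tau> - stochastic_ray A \<rho> \<in> sets Q"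
  using assms by (intro sets.Diff stochastic_ray_sets)

section \<open>Marginal profit, marginal cost and their integrability\<close>

definition flow :: "'a \<times> real \<Rightarrow> real" where
  "flow p = (if 0 < snd p then marginal_flow (snd p) (fst p) else 0)"

definition decay :: "'a \<times> real \<Rightarrow> real" where
  "decay p = (if 0 < snd p then \<delta> * exp (- \<delta> * snd p) else 0)"

text \<open>The function g of the overview, extended by 0 to nonpositive times.\<close>

definition gain :: "'a \<times> real \<Rightarrow> real" where
  "gain p = flow p - decay p"

lemma progressive_measurable_Q:
  "progressive F Z \<Longrightarrow> (\<lambda>p. Z (max 0 (snd p)) (fst p)) \<in> borel_measurable Q"
  using progressive_measurable[of Z] unfolding measurable_Q by (simp add: case_prod_beta)

lemma measurable_R_process:
  assumes "progressive F Z"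
  shows "(\<lambda>p. if 0 < snd p \<and> 0 < Z (snd p) (fst p) then R (X (snd p) (fst p)) (Z (snd p) (fst p)) else 0) \<in> borel_measurable Q"
proof -
  let ?f = "\<lambda>p :: 'a \<times> real. (X (max 0 (snd p)) (fst p), Z (max 0 (snd p)) (fst p))"
  have "?f \<in> Q \<rightarrow>\<^sub>M borel \<Otimes>\<^sub>M borel"
    by (intro measurable_Pair progressive_measurable_Q X_progressive assms)
  from measurable_compose[OF this measurable_R]
  have "(\<lambda>p. if 0 < snd (?f p) then R (fst (?f p)) (snd (?f p)) else 0) \<in> borel_measurable Q" .
  then have "(\<lambda>p. if 0 < snd p then (if 0 < snd (?f p) then R (fst (?f p)) (snd (?f p)) else 0) else 0) \<in> borel_measurable Q"
    by measurable
  also have "(\<lambda>p. if 0 < snd p then (if 0 < snd (?f p) then R (fst (?f p)) (snd (?f p)) else 0) else 0) =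
      (\<lambda>p. if 0 < snd p \<and> 0 < Z (snd p) (fst p) then R (X (snd p) (fst p)) (Z (snd p) (fst p)) else 0)"
    by auto
  finally show ?thesis .
qed

lemma flow_measurable[measurable]: "flow \<in> borel_measurable Q"
proof -
  let ?f = "\<lambda>p :: 'a \<times> real. (X (max 0 (snd p)) (fst p), \<nu> (max 0 (snd p)) (fst p))"
  have "?f \<in> Q \<rightarrow>\<^sub>M borel \<Otimes>\<^sub>M borel"
    by (intro measurable_Pair progressive_measurable_Q X_progressive nu_progressive)
  from measurable_compose[OF this measurable_marginal]
  have "(\<lambda>p. if 0 < snd (?f p) then deriv (R (fst (?f p))) (snd (?f p)) else 0) \<in> borel_measurable Q" .
  then have "(\<lambda>p. if 0 < snd p then exp (- \<delta> * snd p) * (if 0 < snd (?f p) then deriv (R (fst (?f p))) (snd (?f p)) else 0) else 0) \<in> borel_measurable Q"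
    by measurable
  also have "?this \<longleftrightarrow> flow \<in> borel_measurable Q"
  proof (rule measurable_cong)
    fix p :: "'a \<times> real" assume "p \<in> space Q"
    then have "fst p \<in> space M" by (auto simp: space_pair_measure)
    then show "(if 0 < snd p then exp (- \<delta> * snd p) * (if 0 < snd (?f p) then deriv (R (fst (?f p))) (snd (?f p)) else 0) else 0) = flow p"
      using nu_pos[of "fst p" "snd p"] by (auto simp: flow_def marginal_flow_def)
  qed
  finally show ?thesis .
qed

lemma flow_nonneg: "p \<in> space Q \<Longrightarrow> 0 \<le> flow p"
  unfolding flow_def marginal_flow_def by (auto simp: space_pair_measure intro!: mult_nonneg_nonneg marginal_nonneg nu_pos)

lemma decay_nonneg: "0 \<le> decay p"
  using delta_pos by (simp add: decay_def)

lemma decay_measurable[measurable]: "decay \<in> borel_measurable Q"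
  unfolding decay_def by measurable

definition profit_bound :: "'a \<times> real \<Rightarrow> real" where
  "profit_bound p = (if 0 < snd p then exp (- \<delta> * snd p) * R (X (snd p) (fst p)) (\<theta> (snd p) (fst p)) else 0)"

lemma theta_pos: "\<omega> \<in> space M \<Longrightarrow> 0 \<le> t \<Longrightarrow> 0 < \<theta> t \<omega>"
  using y_le_theta y_pos by fastforce

lemma profit_bound_measurable[measurable]: "profit_bound \<in> borel_measurable Q"
proof -
  note m = measurable_R_process[OF theta_progressive]
  have "(\<lambda>p. exp (- \<delta> * snd p) * (if 0 < snd p \<and> 0 < \<theta> (snd p) (fst p) then R (X (snd p) (fst p)) (\<theta> (snd p) (fst p)) else 0)) \<in> borel_measurable Q"
    using m by measurable
  also have "?this \<longleftrightarrow> profit_bound \<in> borel_measurable Q"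
  proof (rule measurable_cong)
    fix p :: "'a \<times> real" assume "p \<in> space Q"
    then have "fst p \<in> space M" by (auto simp: space_pair_measure)
    then show "exp (- \<delta> * snd p) * (if 0 < snd p \<and> 0 < \<theta> (snd p) (fst p) then R (X (snd p) (fst p)) (\<theta> (snd p) (fst p)) else 0) = profit_bound p"
      using theta_pos[of "fst p" "snd p"] by (simp add: profit_bound_def)
  qed
  finally show ?thesis .
qed

lemma profit_bound_nonneg: "p \<in> space Q \<Longrightarrow> 0 \<le> profit_bound p"
  unfolding profit_bound_def by (auto simp: space_pair_measure intro!: mult_nonneg_nonneg R_nonneg less_imp_le[OF theta_pos])

lemma profit_bound_integrable: "integrable Q profit_bound"
proof (rule integrableI_bounded)
  let ?L = "restrict_space lborel {0..} :: real measure"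
  let ?f = "\<lambda>(\<omega>, t). exp (- \<delta> * t) * R (X t \<omega>) (\<theta> t \<omega>)"
  interpret L: sigma_finite_measure ?L
    by (intro sigma_finite_measure_restrict_space sigma_finite_lborel) auto
  have fm: "?f \<in> borel_measurable (M \<Otimes>\<^sub>M ?L)" using R_integrable by (rule borel_measurable_integrable)
  have "(\<integral>\<^sup>+p. ennreal (norm (profit_bound p)) \<partial>Q) = (\<integral>\<^sup>+\<omega>. \<integral>\<^sup>+t. ennreal (norm (profit_bound (\<omega>, t))) \<partial>lborel \<partial>M)"
    by (rule lborel.nn_integral_fst[symmetric]) measurable
  also have "\<dots> = (\<integral>\<^sup>+\<omega>. \<integral>\<^sup>+t. ennreal (norm (?f (\<omega>, t))) * indicator {0..} t \<partial>lborel \<partial>M)"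
  proof (rule nn_integral_cong, rule nn_integral_cong_AE)
    fix \<omega> assume "\<omega> \<in> space M"
    have "AE t in lborel. t \<noteq> (0::real)" by (rule AE_lborel_singleton)
    then show "AE t in lborel. ennreal (norm (profit_bound (\<omega>, t))) = ennreal (norm (?f (\<omega>, t))) * indicator {0..} t"
      by eventually_elim (auto simp: profit_bound_def indicator_def)
  qed
  also have "\<dots> = (\<integral>\<^sup>+\<omega>. \<integral>\<^sup>+t. ennreal (norm (?f (\<omega>, t))) \<partial>?L \<partial>M)"
    by (intro nn_integral_cong nn_integral_restrict_space[symmetric]) auto
  also have "\<dots> = (\<integral>\<^sup>+p. ennreal (norm (?f p)) \<partial>(M \<Otimes>\<^sub>M ?L))"
    by (intro L.nn_integral_fst measurable_compose[OF fm]) measurable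
  also have "\<dots> < \<infinity>" using R_integrable unfolding integrable_iff_bounded by auto
  finally show "(\<integral>\<^sup>+p. ennreal (norm (profit_bound p)) \<partial>Q) < \<infinity>" .
qed measurable

text \<open>Concavity gives \<open>R\<^sub>y(X, \<nu>) * \<nu> \<le> R(X, \<nu>)\<close>, and
  monotonicity replaces \<nu> by \<theta>, where integrability is assumed.\<close>

lemma flow_le:
  fixes p :: "'a \<times> real"
  assumes p: "p \<in> space Q" shows "flow p * \<nu> (max 0 (snd p)) (fst p) \<le> profit_bound p"
proof (cases "0 < snd p")
  case True
  obtain \<omega> s where p_eq: "p = (\<omega>, s)" and \<omega>: "\<omega> \<in> space M" using p by (auto simp: space_pair_measure)
  have s: "0 < s" using True p_eq by simp
  have "deriv (R (X s \<omega>)) (\<nu> s \<omega>) * \<nu> s \<omega> \<le> R (X s \<omega>) (\<nu> s \<omega>)"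
    using s by (intro marginal_times_le nu_pos[OF \<omega>]) simp
  also have "\<dots> \<le> R (X s \<omega>) (\<theta> s \<omega>)"
    using s nu_le_theta[OF \<omega>, of s] less_imp_le[OF nu_pos[OF \<omega>, of s]] by (intro R_mono) auto
  finally show ?thesis using s p_eq by (simp add: flow_def profit_bound_def marginal_flow_def mult.assoc)
qed (simp add: flow_def profit_bound_def)

text \<open>Dividing the preceding bound by \<nu> is harmless because
  \<open>\<nu> \<ge> y > 0\<close>; the candidate stays away from the singularity of the marginal
  profit at 0.\<close>

lemma flow_integrable: "integrable Q flow"
proof (rule Bochner_Integration.integrable_bound)
  show "integrable Q (\<lambda>p. profit_bound p / y)" using profit_bound_integrable by simp
  show "AE p in Q. norm (flow p) \<le> norm (profit_bound p / y)"
  proof (rule AE_I2)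
    fix p :: "'a \<times> real" assume p: "p \<in> space Q"
    have "flow p * y \<le> flow p * \<nu> (max 0 (snd p)) (fst p)"
      using p flow_nonneg[OF p] by (intro mult_left_mono y_le_nu) (auto simp: space_pair_measure)
    also have "\<dots> \<le> profit_bound p" by (rule flow_le[OF p])
    finally show "norm (flow p) \<le> norm (profit_bound p / y)"
      using flow_nonneg[OF p] profit_bound_nonneg[OF p] y_pos by (simp add: field_simps)
  qed
qed measurable

lemma discount_integral:
  "ennreal (discount \<delta> t) = (\<integral>\<^sup>+s. ennreal (\<delta> * exp (- \<delta> * s)) * indicator {s. t < ennreal s} s \<partial>lborel)"
proof (cases t)
  case (real r)
  then have "{s. t < ennreal s} = {r<..}" by (auto simp: ennreal_less_iff)
  then show ?thesis using nn_integral_exp_ray[OF delta_pos real(1)] real by (simp add: discount_def)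
next
  case top
  then show ?thesis by (simp add: discount_def top.extremum_strict)
qed

lemma decay_nn_integral:
  "(\<integral>\<^sup>+s. ennreal (decay (\<omega>, s)) * indicator {s. t < ennreal s} s \<partial>lborel) = ennreal (discount \<delta> t)"
  unfolding discount_integral
  by (intro nn_integral_cong) (auto simp: decay_def indicator_def dest: positive_time)

lemma decay_integrable: "integrable Q decay"
proof (rule integrableI_bounded)
  have "(\<integral>\<^sup>+p. ennreal (norm (decay p)) \<partial>Q) = (\<integral>\<^sup>+\<omega>. \<integral>\<^sup>+t. ennreal (norm (decay (\<omega>, t))) \<partial>lborel \<partial>M)"
    by (rule lborel.nn_integral_fst[symmetric]) measurable
  also have "\<dots> = (\<integral>\<^sup>+\<omega>. \<integral>\<^sup>+s. ennreal (decay (\<omega>, s)) * indicator {s. 0 < ennreal s} s \<partial>lborel \<partial>M)"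
    using delta_pos by (intro nn_integral_cong) (auto simp: decay_def indicator_def abs_mult)
  also have "\<dots> = ennreal (discount \<delta> 0)"
    unfolding decay_nn_integral by (simp add: emeasure_space_1)
  also have "\<dots> < \<infinity>" by simp
  finally show "(\<integral>\<^sup>+p. ennreal (norm (decay p)) \<partial>Q) < \<infinity>" .
qed measurable

lemma gain_measurable[measurable]: "gain \<in> borel_measurable Q"
  unfolding gain_def by measurable

lemma gain_integrable: "integrable Q gain"
  unfolding gain_def using flow_integrable decay_integrable by (rule Bochner_Integration.integrable_diff)

lemma nn_integral_set_Q:
  assumes f: "f \<in> borel_measurable Q" and A: "A \<in> sets M" and [measurable]: "\<tau> \<in> borel_measurable M" "\<rho> \<in> borel_measurable M"
  shows "(\<integral>\<^sup>+p\<in>stochastic_ray A \<tau> - stochastic_ray A \<rho>. ennreal (f p) \<partial>Q) =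
      (\<integral>\<^sup>+\<omega>\<in>A. (\<integral>\<^sup>+s\<in>{s. \<tau> \<omega> < ennreal s \<and> ennreal s \<le> \<rho> \<omega>}. ennreal (f (\<omega>, s)) \<partial>lborel) \<partial>M)"
proof -
  note [measurable] = f A
  have "(\<integral>\<^sup>+p\<in>stochastic_ray A \<tau> - stochastic_ray A \<rho>. ennreal (f p) \<partial>Q) =
      (\<integral>\<^sup>+\<omega>. \<integral>\<^sup>+s. ennreal (f (\<omega>, s)) * indicator (stochastic_ray A \<tau> - stochastic_ray A \<rho>) (\<omega>, s) \<partial>lborel \<partial>M)"
    by (rule lborel.nn_integral_fst[symmetric]) measurable
  also have "\<dots> = (\<integral>\<^sup>+\<omega>\<in>A. (\<integral>\<^sup>+s\<in>{s. \<tau> \<omega> < ennreal s \<and> ennreal s \<le> \<rho> \<omega>}. ennreal (f (\<omega>, s)) \<partial>lborel) \<partial>M)"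
  proof (rule nn_integral_cong)
    fix \<omega>
    have "ennreal (f (\<omega>, s)) * indicator (stochastic_ray A \<tau> - stochastic_ray A \<rho>) (\<omega>, s) =
        (if \<omega> \<in> A then ennreal (f (\<omega>, s)) * indicator {s. \<tau> \<omega> < ennreal s \<and> ennreal s \<le> \<rho> \<omega>} s else 0)" for s
      by (auto simp: indicator_def stochastic_ray_def not_less)
    then have "(\<integral>\<^sup>+s. ennreal (f (\<omega>, s)) * indicator (stochastic_ray A \<tau> - stochastic_ray A \<rho>) (\<omega>, s) \<partial>lborel) =
        (\<integral>\<^sup>+s. (if \<omega> \<in> A then ennreal (f (\<omega>, s)) * indicator {s. \<tau> \<omega> < ennreal s \<and> ennreal s \<le> \<rho> \<omega>} s else 0) \<partial>lborel)"
      by (simp only:)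
    also have "\<dots> = (\<integral>\<^sup>+s\<in>{s. \<tau> \<omega> < ennreal s \<and> ennreal s \<le> \<rho> \<omega>}. ennreal (f (\<omega>, s)) \<partial>lborel) * indicator A \<omega>"
      by (cases "\<omega> \<in> A") simp_all
    finally show "(\<integral>\<^sup>+s. ennreal (f (\<omega>, s)) * indicator (stochastic_ray A \<tau> - stochastic_ray A \<rho>) (\<omega>, s) \<partial>lborel) =
      (\<integral>\<^sup>+s\<in>{s. \<tau> \<omega> < ennreal s \<and> ennreal s \<le> \<rho> \<omega>}. ennreal (f (\<omega>, s)) \<partial>lborel) * indicator A \<omega>" .
  qed
  finally show ?thesis .
qed

text \<open>The defining equation of \<open>l\<close>, tested on events known at \<tau>.
  Measurability of the left side is obtained from the equation itself.\<close>

lemma base_value_equation: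
  assumes \<tau>: "stopping_time F \<tau>"
  shows "(\<lambda>\<omega>. base_value (\<tau> \<omega>) \<omega>) \<in> borel_measurable M"
    and "A \<in> sets (pre_sigma \<tau>) \<Longrightarrow>
      (\<integral>\<^sup>+\<omega>\<in>A. base_value (\<tau> \<omega>) \<omega> \<partial>M) = (\<integral>\<^sup>+\<omega>\<in>A. ennreal (discount \<delta> (\<tau> \<omega>)) \<partial>M)"
proof -
  have eq: "base_value (\<tau> \<omega>) \<omega> = (\<integral>\<^sup>+s\<in>times_from (\<tau> \<omega>). ennreal (exp (- \<delta> * s)) *
        marginal_profit R (X s \<omega>) (SUP u\<in>{u\<in>times_from (\<tau> \<omega>). u < s}. ereal (l u \<omega>)) \<partial>lborel)" for \<omega>
    unfolding base_value_def base_flow_def running_sup_def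
  proof (rule nn_integral_cong_AE)
    show "AE s in lborel. ennreal (exp (- \<delta> * s)) * marginal_profit R (X s \<omega>) (SUP u\<in>{u\<in>times_from (\<tau> \<omega>). u < s}. ereal (l u \<omega>)) *
        indicator {s. \<tau> \<omega> < ennreal s} s =
      ennreal (exp (- \<delta> * s)) * marginal_profit R (X s \<omega>) (SUP u\<in>{u\<in>times_from (\<tau> \<omega>). u < s}. ereal (l u \<omega>)) *
        indicator (times_from (\<tau> \<omega>)) s"
      using times_from_AE[of "\<tau> \<omega>"] by eventually_elim (auto simp: indicator_def)
  qed
  have ae: "AE \<omega> in M. nn_cond_exp M (pre_sigma \<tau>) (\<lambda>\<omega>. base_value (\<tau> \<omega>) \<omega>) \<omega> = ennreal (discount \<delta> (\<tau> \<omega>))"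
    using base \<tau> unfolding base_capacity_def eq by blast
  \<comment> \<open>The discount vanishes only where \<tau> is infinite, and there the domain of
    integration is empty.\<close>
  have zero: "base_value (\<tau> \<omega>) \<omega> = 0" if "ennreal (discount \<delta> (\<tau> \<omega>)) = 0" for \<omega>
  proof -
    have "\<tau> \<omega> = \<infinity>" using that by (auto simp: discount_def split: if_splits)
    then show ?thesis by (simp add: base_value_def top.extremum_strict)
  qed
  note * = nn_cond_exp_set_integral[OF prob_space_axioms complete_measure_axioms subalgebra_pre_sigma[OF \<tau>] ae zero]
  show "(\<lambda>\<omega>. base_value (\<tau> \<omega>) \<omega>) \<in> borel_measurable M" by (rule *(1))
  show "A \<in> sets (pre_sigma \<tau>) \<Longrightarrow>
      (\<integral>\<^sup>+\<omega>\<in>A. base_value (\<tau> \<omega>) \<omega> \<partial>M) = (\<integral>\<^sup>+\<omega>\<in>A. ennreal (discount \<delta> (\<tau> \<omega>)) \<partial>M)" by (rule *(2))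
qed

lemma discount_measurable[measurable]: "\<tau> \<in> borel_measurable N \<Longrightarrow> (\<lambda>\<omega>. discount \<delta> (\<tau> \<omega>)) \<in> borel_measurable N"
proof -
  assume [measurable]: "\<tau> \<in> borel_measurable N"
  have "(\<lambda>\<omega>. if \<tau> \<omega> < top then exp (- \<delta> * enn2real (\<tau> \<omega>)) else 0) \<in> borel_measurable N" by measurable
  moreover have "(\<lambda>\<omega>. if \<tau> \<omega> < top then exp (- \<delta> * enn2real (\<tau> \<omega>)) else 0) = (\<lambda>\<omega>. discount \<delta> (\<tau> \<omega>))"
    by (auto simp: discount_def less_top)
  ultimately show ?thesis by (simp only:)
qed

lemma discount_split:
  assumes "t \<le> t'"
  shows "ennreal (discount \<delta> t) = (\<integral>\<^sup>+s\<in>{s. t < ennreal s \<and> ennreal s \<le> t'}. ennreal (decay (\<omega>, s)) \<partial>lborel) + ennreal (discount \<delta> t')"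
proof -
  define d where "d s = ennreal (decay (\<omega>, s))" for s
  have m[measurable]: "d \<in> borel_measurable borel" unfolding d_def decay_def snd_conv by measurable
  have "ennreal (discount \<delta> t) = (\<integral>\<^sup>+s. ennreal (decay (\<omega>, s)) * indicator {s. t < ennreal s \<and> ennreal s \<le> t'} s +
      ennreal (decay (\<omega>, s)) * indicator {s. t' < ennreal s} s \<partial>lborel)"
    unfolding decay_nn_integral[of \<omega> t, symmetric] using assms by (intro nn_integral_cong) (auto simp: indicator_def)
  also have "\<dots> = (\<integral>\<^sup>+s\<in>{s. t < ennreal s \<and> ennreal s \<le> t'}. ennreal (decay (\<omega>, s)) \<partial>lborel) + ennreal (discount \<delta> t')"
    unfolding decay_nn_integral[of \<omega> t', symmetric] unfolding d_def[symmetric] by (intro nn_integral_add) measurable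
  finally show ?thesis .
qed

lemma discount_set_finite: "(\<integral>\<^sup>+\<omega>\<in>A. ennreal (discount \<delta> (\<tau> \<omega>)) \<partial>M) < \<infinity>"
proof -
  have "discount \<delta> t \<le> 1" for t using delta_pos by (simp add: discount_def)
  then have "(\<integral>\<^sup>+\<omega>\<in>A. ennreal (discount \<delta> (\<tau> \<omega>)) \<partial>M) \<le> (\<integral>\<^sup>+\<omega>. 1 \<partial>M)"
    by (intro nn_integral_mono) (auto simp: indicator_def intro: ennreal_le_1[THEN iffD2])
  also have "\<dots> < \<infinity>" by (simp add: emeasure_space_1)
  finally show ?thesis .
qed

lemma set_integral_mono_nn:
  assumes "integrable Q f" "integrable Q g" "B \<in> sets Q" "\<And>p. p \<in> space Q \<Longrightarrow> 0 \<le> f p" "\<And>p. p \<in> space Q \<Longrightarrow> 0 \<le> g p"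
    and le: "(\<integral>\<^sup>+p\<in>B. ennreal (f p) \<partial>Q) \<le> (\<integral>\<^sup>+p\<in>B. ennreal (g p) \<partial>Q)"
  shows "(\<integral>p\<in>B. f p \<partial>Q) \<le> (\<integral>p\<in>B. g p \<partial>Q)"
proof -
  have eq: "(\<integral>\<^sup>+p\<in>B. ennreal (h p) \<partial>Q) = ennreal (\<integral>p\<in>B. h p \<partial>Q) \<and> 0 \<le> (\<integral>p\<in>B. h p \<partial>Q)"
    if "integrable Q h" "\<And>p. p \<in> space Q \<Longrightarrow> 0 \<le> h p" for h
  proof
    have i: "integrable Q (\<lambda>p. indicator B p *\<^sub>R h p)"
      using that(1) assms(3) by (intro integrable_mult_indicator)
    have "(\<integral>\<^sup>+p\<in>B. ennreal (h p) \<partial>Q) = (\<integral>\<^sup>+p. ennreal (indicator B p *\<^sub>R h p) \<partial>Q)"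
      by (intro nn_integral_cong) (auto simp: indicator_def)
    also have "\<dots> = ennreal (\<integral>p. indicator B p *\<^sub>R h p \<partial>Q)"
      using i that(2) by (intro nn_integral_eq_integral) auto
    finally show "(\<integral>\<^sup>+p\<in>B. ennreal (h p) \<partial>Q) = ennreal (\<integral>p\<in>B. h p \<partial>Q)" by (simp add: set_lebesgue_integral_def)
    show "0 \<le> (\<integral>p\<in>B. h p \<partial>Q)"
      unfolding set_lebesgue_integral_def using that(2) by (intro Bochner_Integration.integral_nonneg) auto
  qed
  show ?thesis using le eq[OF assms(1,4)] eq[OF assms(2,5)] by (simp add: ennreal_le_iff)
qed

lemma set_integral_gain:
  assumes "B \<in> sets Q"
  shows "(\<integral>p\<in>B. gain p \<partial>Q) = (\<integral>p\<in>B. flow p \<partial>Q) - (\<integral>p\<in>B. decay p \<partial>Q)"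
  unfolding gain_def
  using assms by (intro set_integral_diff; unfold set_integrable_def)
    (intro integrable_mult_indicator flow_integrable decay_integrable; assumption)+

lemma flow_eq_marginal_flow: "t < ennreal s \<Longrightarrow> flow (\<omega>, s) = marginal_flow s \<omega>"
  using positive_time[of t s] by (simp add: flow_def)

lemma inner_measurable:
  assumes f: "f \<in> borel_measurable Q" and [measurable]: "\<tau> \<in> borel_measurable M" "\<rho> \<in> borel_measurable M"
  shows "(\<lambda>\<omega>. \<integral>\<^sup>+s\<in>{s. \<tau> \<omega> < ennreal s \<and> ennreal s \<le> \<rho> \<omega>}. ennreal (f (\<omega>, s)) \<partial>lborel) \<in> borel_measurable M"
proof -
  have "{p \<in> space Q. \<tau> (fst p) < ennreal (snd p) \<and> ennreal (snd p) \<le> \<rho> (fst p)} \<in> sets Q" by measurable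
  then have "(\<lambda>p. ennreal (f p) * indicator {p \<in> space Q. \<tau> (fst p) < ennreal (snd p) \<and> ennreal (snd p) \<le> \<rho> (fst p)} p) \<in> borel_measurable Q"
    by (intro borel_measurable_times_ennreal measurable_compose[OF f measurable_ennreal] borel_measurable_indicator)
  from lborel.borel_measurable_nn_integral_fst[OF this]
  have "(\<lambda>\<omega>. \<integral>\<^sup>+s. ennreal (f (\<omega>, s)) * indicator {p \<in> space Q. \<tau> (fst p) < ennreal (snd p) \<and> ennreal (snd p) \<le> \<rho> (fst p)} (\<omega>, s) \<partial>lborel) \<in> borel_measurable M" .
  also have "?this \<longleftrightarrow> ?thesis"
    by (intro measurable_cong nn_integral_cong) (auto simp: indicator_def space_pair_measure)
  finally show ?thesis .
qed

text \<open>The base equation is used at \<tau> and at \<rho>. From \<tau> on the running supremum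
  dominates \<nu>, so the marginal profit of \<nu> between \<tau> and \<rho> is at least what the
  equation needs to cover the difference of the two discounts, which is the integral of
  \<open>decay\<close>.\<close>

lemma gain_nonneg_from_increase_time:
  assumes \<tau>: "increase_time \<tau>" and \<rho>: "stopping_time F \<rho>" and le: "\<And>\<omega>. \<omega> \<in> space M \<Longrightarrow> \<tau> \<omega> \<le> \<rho> \<omega>"
    and A: "A \<in> sets (pre_sigma \<tau>)"
  shows "0 \<le> (\<integral>p\<in>stochastic_ray A \<tau> - stochastic_ray A \<rho>. gain p \<partial>Q)"
proof -
  have \<tau>s: "stopping_time F \<tau>" using \<tau> by (simp add: increase_time_def)
  have A': "A \<in> sets (pre_sigma \<rho>)" using mono_pre_sigma[OF \<tau>s \<rho> le] A by blast
  have AM[measurable]: "A \<in> sets M" using pre_sigma_in_M[OF \<tau>s A] .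
  note m[measurable] = stopping_time_measurable[OF \<tau>s] stopping_time_measurable[OF \<rho>]
  let ?B = "stochastic_ray A \<tau> - stochastic_ray A \<rho>"
  let ?J = "\<lambda>\<omega>. {s. \<tau> \<omega> < ennreal s \<and> ennreal s \<le> \<rho> \<omega>}"
  let ?D = "\<integral>\<^sup>+\<omega>\<in>A. ennreal (discount \<delta> (\<rho> \<omega>)) \<partial>M"
  have "(\<integral>\<^sup>+p\<in>?B. ennreal (decay p) \<partial>Q) + ?D = (\<integral>\<^sup>+\<omega>\<in>A. (\<integral>\<^sup>+s\<in>?J \<omega>. ennreal (decay (\<omega>, s)) \<partial>lborel) \<partial>M) + ?D"
    by (subst nn_integral_set_Q) auto
  also have "\<dots> = (\<integral>\<^sup>+\<omega>. (\<integral>\<^sup>+s\<in>?J \<omega>. ennreal (decay (\<omega>, s)) \<partial>lborel) * indicator A \<omega> + ennreal (discount \<delta> (\<rho> \<omega>)) * indicator A \<omega> \<partial>M)"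
    by (intro nn_integral_add[symmetric] borel_measurable_times_ennreal borel_measurable_indicator inner_measurable
        decay_measurable m AM measurable_compose[OF discount_measurable measurable_ennreal])
  also have "\<dots> = (\<integral>\<^sup>+\<omega>\<in>A. ennreal (discount \<delta> (\<tau> \<omega>)) \<partial>M)"
  proof (rule nn_integral_cong)
    fix \<omega> assume "\<omega> \<in> space M"
    from discount_split[OF le[OF this], of \<omega>]
    show "(\<integral>\<^sup>+s\<in>?J \<omega>. ennreal (decay (\<omega>, s)) \<partial>lborel) * indicator A \<omega> + ennreal (discount \<delta> (\<rho> \<omega>)) * indicator A \<omega> =
        ennreal (discount \<delta> (\<tau> \<omega>)) * indicator A \<omega>"
      by (simp only: distrib_right)
  qed
  also have "\<dots> = (\<integral>\<^sup>+\<omega>\<in>A. base_value (\<tau> \<omega>) \<omega> \<partial>M)" by (rule base_value_equation(2)[OF \<tau>s A, symmetric])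
  also have "\<dots> \<le> (\<integral>\<^sup>+\<omega>. (\<integral>\<^sup>+s\<in>?J \<omega>. ennreal (flow (\<omega>, s)) \<partial>lborel) * indicator A \<omega> + base_value (\<rho> \<omega>) \<omega> * indicator A \<omega> \<partial>M)"
  proof (rule nn_integral_mono)
    fix \<omega> assume \<omega>: "\<omega> \<in> space M"
    have "base_value (\<tau> \<omega>) \<omega> \<le> (\<integral>\<^sup>+s\<in>?J \<omega>. ennreal (marginal_flow s \<omega>) \<partial>lborel) + base_value (\<rho> \<omega>) \<omega>"
      using \<tau> \<omega> by (intro base_value_le[OF \<omega> le[OF \<omega>]]) (auto simp: increase_time_def)
    also have "(\<integral>\<^sup>+s\<in>?J \<omega>. ennreal (marginal_flow s \<omega>) \<partial>lborel) = (\<integral>\<^sup>+s\<in>?J \<omega>. ennreal (flow (\<omega>, s)) \<partial>lborel)"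
      by (intro nn_integral_cong) (auto simp: indicator_def flow_eq_marginal_flow)
    finally show "base_value (\<tau> \<omega>) \<omega> * indicator A \<omega> \<le>
        (\<integral>\<^sup>+s\<in>?J \<omega>. ennreal (flow (\<omega>, s)) \<partial>lborel) * indicator A \<omega> + base_value (\<rho> \<omega>) \<omega> * indicator A \<omega>"
      by (auto simp: indicator_def)
  qed
  also have "\<dots> = (\<integral>\<^sup>+\<omega>\<in>A. (\<integral>\<^sup>+s\<in>?J \<omega>. ennreal (flow (\<omega>, s)) \<partial>lborel) \<partial>M) + (\<integral>\<^sup>+\<omega>\<in>A. base_value (\<rho> \<omega>) \<omega> \<partial>M)"
    by (intro nn_integral_add borel_measurable_times_ennreal borel_measurable_indicator inner_measurable
        flow_measurable m AM base_value_equation(1)[OF \<rho>])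
  also have "(\<integral>\<^sup>+\<omega>\<in>A. base_value (\<rho> \<omega>) \<omega> \<partial>M) = ?D" by (rule base_value_equation(2)[OF \<rho> A'])
  also have "(\<integral>\<^sup>+\<omega>\<in>A. (\<integral>\<^sup>+s\<in>?J \<omega>. ennreal (flow (\<omega>, s)) \<partial>lborel) \<partial>M) = (\<integral>\<^sup>+p\<in>?B. ennreal (flow p) \<partial>Q)"
    by (subst nn_integral_set_Q) auto
  \<comment> \<open>\<open>?D\<close> stands on both sides, once as discount at \<rho> and once
    through the base equation at \<rho>; it is finite and cancels.\<close>
  finally have "(\<integral>\<^sup>+p\<in>?B. ennreal (decay p) \<partial>Q) \<le> (\<integral>\<^sup>+p\<in>?B. ennreal (flow p) \<partial>Q)"
    using discount_set_finite[of \<rho> A] by (simp add: ennreal_add_left_cancel_le add.commute[of _ ?D] less_top[symmetric])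
  then have "(\<integral>p\<in>?B. decay p \<partial>Q) \<le> (\<integral>p\<in>?B. flow p \<partial>Q)"
    by (intro set_integral_mono_nn decay_integrable flow_integrable flow_nonneg decay_nonneg ray_difference_sets AM m)
  then show ?thesis unfolding set_integral_gain[OF ray_difference_sets[OF AM m]] by simp
qed

text \<open>The same two equations with the reverse comparison: before the next binding time \<nu>
  dominates the running supremum, and after it the supremum may be restarted there.\<close>

lemma gain_nonpos_before_next_binding:
  assumes \<tau>: "stopping_time F \<tau>" and A: "A \<in> sets (pre_sigma \<tau>)"
  shows "(\<integral>p\<in>stochastic_ray A \<tau> - stochastic_ray A (next_binding \<tau>). gain p \<partial>Q) \<le> 0"
proof -
  let ?\<rho> = "next_binding \<tau>"
  have \<rho>: "stopping_time F ?\<rho>" by (rule stopping_time_next_binding[OF \<tau>])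
  have le: "\<tau> \<omega> \<le> ?\<rho> \<omega>" for \<omega> by (rule next_entry_ge)
  have A': "A \<in> sets (pre_sigma ?\<rho>)" using mono_pre_sigma[OF \<tau> \<rho> le] A by blast
  have AM[measurable]: "A \<in> sets M" using pre_sigma_in_M[OF \<tau> A] .
  note m[measurable] = stopping_time_measurable[OF \<tau>] stopping_time_measurable[OF \<rho>]
  let ?B = "stochastic_ray A \<tau> - stochastic_ray A ?\<rho>"
  let ?J = "\<lambda>\<omega>. {s. \<tau> \<omega> < ennreal s \<and> ennreal s \<le> ?\<rho> \<omega>}"
  let ?D = "\<integral>\<^sup>+\<omega>\<in>A. ennreal (discount \<delta> (?\<rho> \<omega>)) \<partial>M"
  have "(\<integral>\<^sup>+p\<in>?B. ennreal (flow p) \<partial>Q) + ?D = (\<integral>\<^sup>+\<omega>\<in>A. (\<integral>\<^sup>+s\<in>?J \<omega>. ennreal (flow (\<omega>, s)) \<partial>lborel) \<partial>M) + (\<integral>\<^sup>+\<omega>\<in>A. base_value (?\<rho> \<omega>) \<omega> \<partial>M)"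
    unfolding base_value_equation(2)[OF \<rho> A'] by (subst nn_integral_set_Q) auto
  also have "\<dots> = (\<integral>\<^sup>+\<omega>. (\<integral>\<^sup>+s\<in>?J \<omega>. ennreal (flow (\<omega>, s)) \<partial>lborel) * indicator A \<omega> + base_value (?\<rho> \<omega>) \<omega> * indicator A \<omega> \<partial>M)"
    by (intro nn_integral_add[symmetric] borel_measurable_times_ennreal borel_measurable_indicator inner_measurable
        flow_measurable m AM base_value_equation(1)[OF \<rho>])
  also have "\<dots> \<le> (\<integral>\<^sup>+\<omega>\<in>A. base_value (\<tau> \<omega>) \<omega> \<partial>M)"
  proof (rule nn_integral_mono)
    fix \<omega> assume \<omega>: "\<omega> \<in> space M"
    have "(\<integral>\<^sup>+s\<in>?J \<omega>. ennreal (flow (\<omega>, s)) \<partial>lborel) = (\<integral>\<^sup>+s\<in>?J \<omega>. ennreal (marginal_flow s \<omega>) \<partial>lborel)"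
      by (intro nn_integral_cong) (auto simp: indicator_def flow_eq_marginal_flow)
    then have "(\<integral>\<^sup>+s\<in>?J \<omega>. ennreal (flow (\<omega>, s)) \<partial>lborel) + base_value (?\<rho> \<omega>) \<omega> \<le> base_value (\<tau> \<omega>) \<omega>"
      using base_value_ge[OF \<omega> le[of \<omega>] running_sup_le_nu[OF \<omega>, of \<tau>] running_sup_after_next_binding[OF \<omega>, of \<tau>]] by simp
    then show "(\<integral>\<^sup>+s\<in>?J \<omega>. ennreal (flow (\<omega>, s)) \<partial>lborel) * indicator A \<omega> + base_value (?\<rho> \<omega>) \<omega> * indicator A \<omega>
        \<le> base_value (\<tau> \<omega>) \<omega> * indicator A \<omega>"
      by (auto simp: indicator_def)
  qed
  also have "\<dots> = (\<integral>\<^sup>+\<omega>\<in>A. ennreal (discount \<delta> (\<tau> \<omega>)) \<partial>M)" by (rule base_value_equation(2)[OF \<tau> A])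
  also have "\<dots> = (\<integral>\<^sup>+\<omega>. (\<integral>\<^sup>+s\<in>?J \<omega>. ennreal (decay (\<omega>, s)) \<partial>lborel) * indicator A \<omega> + ennreal (discount \<delta> (?\<rho> \<omega>)) * indicator A \<omega> \<partial>M)"
  proof (rule nn_integral_cong)
    fix \<omega>
    from discount_split[OF le[of \<omega>], of \<omega>]
    show "ennreal (discount \<delta> (\<tau> \<omega>)) * indicator A \<omega> =
      (\<integral>\<^sup>+s\<in>?J \<omega>. ennreal (decay (\<omega>, s)) \<partial>lborel) * indicator A \<omega> + ennreal (discount \<delta> (?\<rho> \<omega>)) * indicator A \<omega>"
      by (simp only: distrib_right)
  qed
  also have "\<dots> = (\<integral>\<^sup>+\<omega>\<in>A. (\<integral>\<^sup>+s\<in>?J \<omega>. ennreal (decay (\<omega>, s)) \<partial>lborel) \<partial>M) + ?D"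
    by (intro nn_integral_add borel_measurable_times_ennreal borel_measurable_indicator inner_measurable
        decay_measurable m AM measurable_compose[OF discount_measurable measurable_ennreal])
  also have "(\<integral>\<^sup>+\<omega>\<in>A. (\<integral>\<^sup>+s\<in>?J \<omega>. ennreal (decay (\<omega>, s)) \<partial>lborel) \<partial>M) = (\<integral>\<^sup>+p\<in>?B. ennreal (decay p) \<partial>Q)"
    by (subst nn_integral_set_Q) auto
  finally have "(\<integral>\<^sup>+p\<in>?B. ennreal (flow p) \<partial>Q) \<le> (\<integral>\<^sup>+p\<in>?B. ennreal (decay p) \<partial>Q)"
    using discount_set_finite[of ?\<rho> A] by (simp add: ennreal_add_left_cancel_le add.commute[of _ ?D] less_top[symmetric])
  then have "(\<integral>p\<in>?B. flow p \<partial>Q) \<le> (\<integral>p\<in>?B. decay p \<partial>Q)"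
    by (intro set_integral_mono_nn decay_integrable flow_integrable flow_nonneg decay_nonneg ray_difference_sets AM m)
  then show ?thesis unfolding set_integral_gain[OF ray_difference_sets[OF AM m]] by simp
qed

subsection \<open>Transport to the last binding time\<close>

text \<open>Predictable sets live on positive times, so the measure is cut down to these before its
  sigma-algebra is coarsened. For a transported measure this discards the mass placed at time
  0.\<close>

definition on_predictable :: "('a \<times> real) measure \<Rightarrow> ('a \<times> real) measure" where
  "on_predictable N = restr_to_subalg (restrict_space N (space M \<times> {0<..})) (predictable M F)"

lemma space_times_positive_sets:
  assumes N: "sets N = sets Q"
  shows "space M \<times> {0<..} \<in> sets N"
  unfolding N by (intro pair_measureI) auto

lemma predictable_space_sets:
  assumes N: "sets N = sets Q"
  shows "(space M \<times> {0<..}) \<inter> space N \<in> sets N"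
  using space_times_positive_sets[OF N] by (rule sets.Int) (rule sets.top)

lemma finite_measure_density_Q:
  fixes f :: "'a \<times> real \<Rightarrow> real"
  assumes f: "integrable Q f" shows "finite_measure (density Q (\<lambda>p. ennreal (f p)))"
proof (rule finite_measureI)
  have "(\<integral>\<^sup>+p. ennreal (f p) \<partial>Q) \<le> (\<integral>\<^sup>+p. ennreal (norm (f p)) \<partial>Q)"
    by (intro nn_integral_mono ennreal_leI) simp
  also have "\<dots> < \<infinity>" using f unfolding integrable_iff_bounded by simp
  finally have fin: "(\<integral>\<^sup>+p. ennreal (f p) \<partial>Q) \<noteq> \<infinity>" by simp
  have "(\<lambda>p. ennreal (f p)) \<in> borel_measurable Q"
    using borel_measurable_integrable[OF f] by (rule measurable_compose[OF _ measurable_ennreal])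
  then have "emeasure (density Q (\<lambda>p. ennreal (f p))) (space Q) = (\<integral>\<^sup>+p. ennreal (f p) * indicator (space Q) p \<partial>Q)"
    by (rule emeasure_density) (rule sets.top)
  also have "\<dots> = (\<integral>\<^sup>+p. ennreal (f p) \<partial>Q)" by (intro nn_integral_cong) simp
  finally show "emeasure (density Q (\<lambda>p. ennreal (f p))) (space (density Q (\<lambda>p. ennreal (f p)))) \<noteq> \<infinity>"
    using fin by simp
qed

lemma subalgebra_predictable:
  assumes N: "sets N = sets Q"
  shows "subalgebra (restrict_space N (space M \<times> {0<..})) (predictable M F)"
  unfolding subalgebra_def
proof
  have space_N: "space N = space M \<times> UNIV" using sets_eq_imp_space_eq[OF N] by (simp add: space_pair_measure)
  show "space (predictable M F) = space (restrict_space N (space M \<times> {0<..}))"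
    using space_N by (auto simp: space_predictable space_restrict_space)
  show "sets (predictable M F) \<subseteq> sets (restrict_space N (space M \<times> {0<..}))"
  proof
    fix B assume B: "B \<in> sets (predictable M F)"
    then have "B \<in> sets N" using predictable_sets_M N sets_Q by simp
    moreover have "B \<subseteq> space M \<times> {0<..}" using sets.sets_into_space[OF B] by (simp add: space_predictable)
    ultimately show "B \<in> sets (restrict_space N (space M \<times> {0<..}))"
      using predictable_space_sets[OF N] by (simp add: sets_restrict_space_iff)
  qed
qed

lemma on_predictable:
  assumes N: "sets N = sets Q"
  shows sets_on_predictable: "sets (on_predictable N) = sets (predictable M F)"
    and emeasure_on_predictable: "B \<in> sets (predictable M F) \<Longrightarrow> emeasure (on_predictable N) B = emeasure N B"
    and finite_on_predictable: "finite_measure N \<Longrightarrow> finite_measure (on_predictable N)"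
proof -
  note \<Omega> = predictable_space_sets[OF N] and sub = subalgebra_predictable[OF N]
  show "sets (on_predictable N) = sets (predictable M F)"
    unfolding on_predictable_def by (rule sets_restr_to_subalg[OF sub])
  show "emeasure (on_predictable N) B = emeasure N B" if B: "B \<in> sets (predictable M F)" for B
    unfolding on_predictable_def emeasure_restr_to_subalg[OF sub B]
    by (rule emeasure_restrict_space[OF \<Omega>]) (use sets.sets_into_space[OF B] in \<open>simp add: space_predictable\<close>)
  show "finite_measure (on_predictable N)" if "finite_measure N"
  proof -
    interpret finite_measure N by fact
    have "finite_measure (restrict_space N (space M \<times> {0<..}))"
      by (rule finite_measure_restrict_space[OF finite_measure_axioms space_times_positive_sets[OF N]])
    then show ?thesis unfolding on_predictable_def by (rule finite_measure_restr_to_subalg[OF sub])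
  qed
qed

lemma nn_integral_on_predictable:
  assumes h: "h \<in> borel_measurable (predictable M F)"
  shows "(\<integral>\<^sup>+p. h p \<partial>on_predictable Q) = (\<integral>\<^sup>+p. h p * indicator (space M \<times> {0<..}) p \<partial>Q)"
proof -
  have \<Omega>: "(space M \<times> {0<..}) \<inter> space Q \<in> sets Q"
    by (rule predictable_space_sets[OF refl])
  have "(\<integral>\<^sup>+p. h p \<partial>on_predictable Q) = (\<integral>\<^sup>+p. h p \<partial>restrict_space Q (space M \<times> {0<..}))"
    unfolding on_predictable_def by (rule nn_integral_subalgebra2[OF subalgebra_predictable[OF refl] h])
  also have "\<dots> = (\<integral>\<^sup>+p. h p * indicator (space M \<times> {0<..}) p \<partial>Q)"
    by (rule nn_integral_restrict_space[OF \<Omega>])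
  finally show ?thesis .
qed

text \<open>The inserted 0 is a graveyard: mass that has no earlier positive binding time goes to
  time 0, outside the predictable space, and disappears.\<close>

definition last_binding :: "'a \<times> real \<Rightarrow> real" where
  "last_binding p = Sup (insert 0 {u. 0 < u \<and> u < snd p \<and> binding u (fst p)})"

text \<open>Next and last binding time are adjoint: both sides say that some binding time lies
  strictly between \<tau> and the time of \<open>p\<close>. Hence the preimage of a ray from \<tau>
  under the transport is the ray from the next binding time after \<tau>.\<close>

lemma less_last_binding_iff:
  "\<tau> (fst p) < ennreal (last_binding p) \<longleftrightarrow> next_binding \<tau> (fst p) < ennreal (snd p)"
proof -
  let ?S = "insert 0 {u. 0 < u \<and> u < snd p \<and> binding u (fst p)}"
  have bdd: "bdd_above ?S" by (intro bdd_aboveI[of _ "max 0 (snd p)"]) auto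
  show ?thesis
  proof
    assume t: "\<tau> (fst p) < ennreal (last_binding p)"
    then obtain r where r: "0 \<le> r" "\<tau> (fst p) = ennreal r" "r < last_binding p"
      by (cases "\<tau> (fst p)") (auto simp: top.extremum_strict ennreal_less_iff)
    then obtain u where u: "u \<in> ?S" "r < u"
      unfolding last_binding_def using less_cSup_iff[OF _ bdd] by auto
    then have "0 < u" "u < snd p" "binding u (fst p)" using r by auto
    then show "next_binding \<tau> (fst p) < ennreal (snd p)"
      unfolding next_entry_less_iff using r u by (intro exI[of _ u]) (auto intro: ennreal_lessI)
  next
    assume "next_binding \<tau> (fst p) < ennreal (snd p)"
    then obtain u where u: "0 \<le> u" "\<tau> (fst p) < ennreal u" "ennreal u < ennreal (snd p)" "binding u (fst p)"
      unfolding next_entry_less_iff by auto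
    have "0 < u" using positive_time[OF u(2)] .
    moreover have "u < snd p" using u by (simp add: ennreal_less_iff)
    ultimately have "u \<le> last_binding p" unfolding last_binding_def using u bdd by (intro cSup_upper) auto
    then show "\<tau> (fst p) < ennreal (last_binding p)" using u(2) by (auto intro: less_le_trans ennreal_leI)
  qed
qed

lemma last_binding_nonneg: "0 \<le> last_binding p"
  unfolding last_binding_def by (rule cSup_upper) (auto intro!: bdd_aboveI[of _ "max 0 (snd p)"])

text \<open>By adjointness with constant times \<tau> the superlevel sets are rays from stopping
  times.\<close>

lemma last_binding_measurable[measurable]: "last_binding \<in> borel_measurable Q"
proof (rule borel_measurableI_greater)
  fix c
  show "{p\<in>space Q. c < last_binding p} \<in> sets Q"
  proof (cases "0 \<le> c")
    case True
    have [measurable]: "next_binding (\<lambda>_. ennreal c) \<in> borel_measurable M"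
      by (intro stopping_time_measurable stopping_time_next_binding stopping_time_const)
    have "{p\<in>space Q. c < last_binding p} = {p\<in>space Q. next_binding (\<lambda>_. ennreal c) (fst p) < ennreal (snd p)}"
      using less_last_binding_iff[of "\<lambda>_. ennreal c"] True by (auto simp: ennreal_less_iff)
    moreover have "{p\<in>space Q. next_binding (\<lambda>_. ennreal c) (fst p) < ennreal (snd p)} \<in> sets Q" by measurable
    ultimately show ?thesis by (simp only:)
  next
    case False
    then have "c < last_binding p" for p using last_binding_nonneg[of p] by linarith
    then have "{p\<in>space Q. c < last_binding p} = space Q" by blast
    then show ?thesis by (simp only: sets.top)
  qed
qed

definition at_last_binding :: "'a \<times> real \<Rightarrow> 'a \<times> real" where
  "at_last_binding p = (fst p, last_binding p)"

lemma at_last_binding_measurable: "at_last_binding \<in> Q \<rightarrow>\<^sub>M M \<Otimes>\<^sub>M borel"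
  unfolding at_last_binding_def by measurable

lemma vimage_at_last_binding:
  "A \<subseteq> space M \<Longrightarrow> at_last_binding -` stochastic_ray A \<tau> \<inter> space Q = stochastic_ray A (next_binding \<tau>)"
  using less_last_binding_iff[of \<tau>] by (fastforce simp: at_last_binding_def stochastic_ray_def space_pair_measure)

definition transported :: "('a \<times> real \<Rightarrow> real) \<Rightarrow> ('a \<times> real) measure" where
  "transported f = on_predictable (distr (density Q (\<lambda>p. ennreal (f p))) (M \<Otimes>\<^sub>M borel) at_last_binding)"

lemma transported:
  assumes f: "integrable Q f"
  shows finite_transported: "finite_measure (transported f)"
    and sets_transported: "sets (transported f) = sets (predictable M F)"
    and emeasure_transported: "B \<in> sets (predictable M F) \<Longrightarrow>
      emeasure (transported f) B = (\<integral>\<^sup>+p\<in>at_last_binding -` B \<inter> space Q. ennreal (f p) \<partial>Q)"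
proof -
  have [measurable]: "f \<in> borel_measurable Q" using f by (rule borel_measurable_integrable)
  let ?N = "distr (density Q (\<lambda>p. ennreal (f p))) (M \<Otimes>\<^sub>M borel) at_last_binding"
  have sets_N: "sets ?N = sets Q" by (simp add: sets_Q)
  have m: "at_last_binding \<in> density Q (\<lambda>p. ennreal (f p)) \<rightarrow>\<^sub>M M \<Otimes>\<^sub>M borel"
    using at_last_binding_measurable by simp
  have "finite_measure (density Q (\<lambda>p. ennreal (f p)))" by (rule finite_measure_density_Q[OF f])
  then have "finite_measure ?N" using m by (rule finite_measure.finite_measure_distr)
  then show "finite_measure (transported f)"
    unfolding transported_def by (rule finite_on_predictable[OF sets_N])
  show "sets (transported f) = sets (predictable M F)"
    unfolding transported_def by (rule sets_on_predictable[OF sets_N])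
  assume B: "B \<in> sets (predictable M F)"
  then have BM: "B \<in> sets (M \<Otimes>\<^sub>M borel)" by (rule predictable_sets_M)
  have "emeasure (transported f) B = emeasure ?N B"
    unfolding transported_def by (rule emeasure_on_predictable[OF sets_N B])
  also have "\<dots> = emeasure (density Q (\<lambda>p. ennreal (f p))) (at_last_binding -` B \<inter> space Q)"
    using m BM by (subst emeasure_distr) simp_all
  also have "\<dots> = (\<integral>\<^sup>+p\<in>at_last_binding -` B \<inter> space Q. ennreal (f p) \<partial>Q)"
    using measurable_sets[OF at_last_binding_measurable BM] by (intro emeasure_density) auto
  finally show "emeasure (transported f) B = (\<integral>\<^sup>+p\<in>at_last_binding -` B \<inter> space Q. ennreal (f p) \<partial>Q)" .
qed

lemma set_integrable_Q: "integrable Q f \<Longrightarrow> B \<in> sets Q \<Longrightarrow> set_integrable Q B (f :: _ \<Rightarrow> real)"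
  unfolding set_integrable_def by (rule integrable_mult_indicator)

lemma set_nn_integral_pos_neg:
  assumes "B \<in> sets Q"
  shows "(\<integral>\<^sup>+p\<in>B. ennreal (max 0 (gain p)) \<partial>Q) = ennreal (\<integral>p\<in>B. max 0 (gain p) \<partial>Q)"
    and "(\<integral>\<^sup>+p\<in>B. ennreal (max 0 (- gain p)) \<partial>Q) = ennreal (\<integral>p\<in>B. max 0 (- gain p) \<partial>Q)"
    and "(\<integral>p\<in>B. max 0 (gain p) \<partial>Q) - (\<integral>p\<in>B. max 0 (- gain p) \<partial>Q) = (\<integral>p\<in>B. gain p \<partial>Q)"
    and "0 \<le> (\<integral>p\<in>B. max 0 (gain p) \<partial>Q)" "0 \<le> (\<integral>p\<in>B. max 0 (- gain p) \<partial>Q)"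
proof -
  have i: "integrable Q (\<lambda>p. max 0 (gain p))" "integrable Q (\<lambda>p. max 0 (- gain p))"
    using gain_integrable by (auto intro: integrable_max)
  have nn: "(\<integral>\<^sup>+p\<in>B. ennreal (h p) \<partial>Q) = ennreal (\<integral>p\<in>B. h p \<partial>Q)" if h: "integrable Q h" "\<And>p. 0 \<le> h p" for h
  proof -
    have "(\<integral>\<^sup>+p\<in>B. ennreal (h p) \<partial>Q) = (\<integral>\<^sup>+p. ennreal (indicator B p *\<^sub>R h p) \<partial>Q)"
      by (intro nn_integral_cong) (auto simp: indicator_def)
    also have "\<dots> = ennreal (\<integral>p\<in>B. h p \<partial>Q)"
      unfolding set_lebesgue_integral_def
      using set_integrable_Q[OF h(1) assms] h(2) unfolding set_integrable_def by (intro nn_integral_eq_integral) auto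
    finally show ?thesis .
  qed
  show "(\<integral>\<^sup>+p\<in>B. ennreal (max 0 (gain p)) \<partial>Q) = ennreal (\<integral>p\<in>B. max 0 (gain p) \<partial>Q)"
    "(\<integral>\<^sup>+p\<in>B. ennreal (max 0 (- gain p)) \<partial>Q) = ennreal (\<integral>p\<in>B. max 0 (- gain p) \<partial>Q)"
    using nn[OF i(1)] nn[OF i(2)] by simp_all
  have "(\<integral>p\<in>B. max 0 (gain p) \<partial>Q) - (\<integral>p\<in>B. max 0 (- gain p) \<partial>Q) = (\<integral>p\<in>B. max 0 (gain p) - max 0 (- gain p) \<partial>Q)"
    using i assms by (intro set_integral_diff(2)[symmetric] set_integrable_Q)
  also have "(\<lambda>p. max 0 (gain p) - max 0 (- gain p)) = gain" by (auto simp: max_def)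
  finally show "(\<integral>p\<in>B. max 0 (gain p) \<partial>Q) - (\<integral>p\<in>B. max 0 (- gain p) \<partial>Q) = (\<integral>p\<in>B. gain p \<partial>Q)" .
  show "0 \<le> (\<integral>p\<in>B. max 0 (gain p) \<partial>Q)" "0 \<le> (\<integral>p\<in>B. max 0 (- gain p) \<partial>Q)"
    unfolding set_lebesgue_integral_def by (auto intro!: Bochner_Integration.integral_nonneg)
qed

section \<open>Net transported mass of predictable rectangles and its density\<close>

lemma rectangle_eq_rays:
  "0 \<le> s \<Longrightarrow> s \<le> t \<Longrightarrow> A \<times> {s<..t} = stochastic_ray A (\<lambda>_. ennreal s) - stochastic_ray A (\<lambda>_. ennreal t)"
  by (auto simp: stochastic_ray_def ennreal_less_iff)

lemma const_stopping[simp]: "stopping_time F (\<lambda>_. t)"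
  by (rule stopping_time_const)

lemma next_binding_mono:
  assumes "\<And>\<omega>. \<tau> \<omega> \<le> \<rho> \<omega>" shows "next_binding \<tau> \<omega> \<le> next_binding \<rho> \<omega>"
  unfolding next_entry_def using assms[of \<omega>] by (intro INF_superset_mono) (auto intro: le_less_trans)

text \<open>This integral is the net mass that the transport puts on
  \<open>A \<times> {s<..t}\<close>. It is nonnegative because its lower end is a next binding time,
  from which \<open>l\<close> explains \<nu>.\<close>

lemma gain_rectangle_nonneg:
  assumes A: "A \<in> sets (F (ennreal s))" and s: "0 \<le> s" "s \<le> t"
  shows "0 \<le> (\<integral>p\<in>stochastic_ray A (next_binding (\<lambda>_. ennreal s)) - stochastic_ray A (next_binding (\<lambda>_. ennreal t)). gain p \<partial>Q)"
proof (rule gain_nonneg_from_increase_time)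
  show "increase_time (next_binding (\<lambda>_. ennreal s))" by (intro increase_time_next_binding) simp
  show "stopping_time F (next_binding (\<lambda>_. ennreal t))" by (intro stopping_time_next_binding) simp
  show "next_binding (\<lambda>_. ennreal s) \<omega> \<le> next_binding (\<lambda>_. ennreal t) \<omega>" for \<omega>
    using s by (intro next_binding_mono ennreal_leI)
  have "A \<in> sets (pre_sigma (\<lambda>_. ennreal s))" by (rule in_pre_sigma_const[OF A])
  then show "A \<in> sets (pre_sigma (next_binding (\<lambda>_. ennreal s)))"
    using mono_pre_sigma[OF const_stopping stopping_time_next_binding[OF const_stopping] next_entry_ge] by blast
qed

text \<open>Only the event \<open>A1\<close> of a binding time up to \<open>t\<close> contributes.
  It is known at \<open>t\<close>, so the stretch from \<open>t\<close> to the next binding time has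
  nonpositive integral; the rest lies within \<open>A \<times> {s<..t}\<close>, where
  \<open>gain\<close> is at most its positive part.\<close>

lemma gain_rectangle_le:
  assumes A: "A \<in> sets (F (ennreal s))" and s: "0 \<le> s" "s \<le> t"
  shows "(\<integral>p\<in>stochastic_ray A (next_binding (\<lambda>_. ennreal s)) - stochastic_ray A (next_binding (\<lambda>_. ennreal t)). gain p \<partial>Q)
    \<le> (\<integral>p\<in>A \<times> {s<..t}. max 0 (gain p) \<partial>Q)"
proof -
  let ?s = "\<lambda>_. ennreal s" and ?t = "\<lambda>_. ennreal t"
  let ?\<sigma> = "next_binding ?s" and ?\<rho> = "next_binding ?t"
  note \<sigma> = stopping_time_next_binding[OF const_stopping, of "ennreal s"]
  note \<rho> = stopping_time_next_binding[OF const_stopping, of "ennreal t"]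
  note m = stopping_time_measurable[OF \<sigma>] stopping_time_measurable[OF \<rho>]
  define A1 where "A1 = {\<omega>\<in>A. ?\<sigma> \<omega> \<le> ennreal t}"
  have "A \<in> sets (pre_sigma ?\<sigma>)"
    using in_pre_sigma_const[OF A] mono_pre_sigma[OF const_stopping \<sigma> next_entry_ge] by blast
  from sets_pre_sigmaD[OF \<sigma> this, of "ennreal t"]
  have A1: "A1 \<in> sets (F (ennreal t))" unfolding A1_def .
  then have A1M: "A1 \<in> sets M" by (rule F_in_M)
  have AM: "A \<in> sets M" using A by (rule F_in_M)
  have mono: "?\<sigma> \<omega> \<le> ?\<rho> \<omega>" for \<omega> using s by (intro next_binding_mono ennreal_leI)
  \<comment> \<open>Without a binding time in \<open>(s,t]\<close> the searches from
    \<open>s\<close> and from \<open>t\<close> find the same time, and the interval between them is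
    empty.\<close>
  have eq: "?\<sigma> \<omega> = ?\<rho> \<omega>" if "\<not> ?\<sigma> \<omega> \<le> ennreal t" for \<omega>
  proof -
    have "ennreal t < ennreal u" if "0 \<le> u" "ennreal s < ennreal u" "binding u \<omega>" for u
      using next_entry_le[of u ?s \<omega> binding] that \<open>\<not> ?\<sigma> \<omega> \<le> ennreal t\<close> by (meson linorder_not_le order_less_le_trans)
    then have "{u. 0 \<le> u \<and> ennreal s < ennreal u \<and> binding u \<omega>} = {u. 0 \<le> u \<and> ennreal t < ennreal u \<and> binding u \<omega>}"
      using ennreal_leI[OF s(2)] by (auto intro: le_less_trans)
    then show ?thesis unfolding next_entry_def by simp
  qed
  let ?B1 = "stochastic_ray A1 ?\<sigma> - stochastic_ray A1 ?t" and ?B2 = "stochastic_ray A1 ?t - stochastic_ray A1 ?\<rho>"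
  have B: "?B1 \<in> sets Q" "?B2 \<in> sets Q" by (intro ray_difference_sets A1M m; simp)+
  have "stochastic_ray A ?\<sigma> - stochastic_ray A ?\<rho> = ?B1 \<union> ?B2"
  proof (intro set_eqI iffI)
    fix p assume p: "p \<in> stochastic_ray A ?\<sigma> - stochastic_ray A ?\<rho>"
    then have "?\<sigma> (fst p) \<noteq> ?\<rho> (fst p)" "fst p \<in> A" by (auto simp: stochastic_ray_def)
    then have "fst p \<in> A1" using eq[of "fst p"] unfolding A1_def by auto
    then show "p \<in> ?B1 \<union> ?B2" using p by (auto simp: stochastic_ray_def not_less)
  next
    fix p assume p: "p \<in> ?B1 \<union> ?B2"
    then have "fst p \<in> A" "?\<sigma> (fst p) \<le> ennreal t" by (auto simp: stochastic_ray_def A1_def)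
    moreover have "ennreal t \<le> ?\<rho> (fst p)" by (rule next_entry_ge)
    ultimately show "p \<in> stochastic_ray A ?\<sigma> - stochastic_ray A ?\<rho>"
      using p by (auto simp: stochastic_ray_def not_less intro: order_trans le_less_trans)
  qed
  moreover have "?B1 \<inter> ?B2 = {}" by (auto simp: stochastic_ray_def)
  ultimately have "(\<integral>p\<in>stochastic_ray A ?\<sigma> - stochastic_ray A ?\<rho>. gain p \<partial>Q) = (\<integral>p\<in>?B1. gain p \<partial>Q) + (\<integral>p\<in>?B2. gain p \<partial>Q)"
    using B by (simp only:) (intro set_integral_Un set_integrable_Q gain_integrable)
  also have "(\<integral>p\<in>?B2. gain p \<partial>Q) \<le> 0"
    by (rule gain_nonpos_before_next_binding[OF const_stopping in_pre_sigma_const[OF A1]])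
  finally have "(\<integral>p\<in>stochastic_ray A ?\<sigma> - stochastic_ray A ?\<rho>. gain p \<partial>Q) \<le> (\<integral>p\<in>?B1. gain p \<partial>Q)" by simp
  also have "\<dots> \<le> (\<integral>p\<in>A \<times> {s<..t}. max 0 (gain p) \<partial>Q)"
    unfolding set_lebesgue_integral_def
  proof (rule integral_mono)
    have "A \<times> {s<..t} \<in> sets Q" using AM by (intro pair_measureI) auto
    then show "integrable Q (\<lambda>p. indicator (A \<times> {s<..t}) p *\<^sub>R max 0 (gain p))"
      using gain_integrable by (intro integrable_mult_indicator integrable_max) auto
    show "integrable Q (\<lambda>p. indicator ?B1 p *\<^sub>R gain p)" by (intro integrable_mult_indicator B gain_integrable)
    fix p
    have "p \<in> A \<times> {s<..t}" if "p \<in> ?B1"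
    proof -
      have "ennreal s \<le> ?\<sigma> (fst p)" by (rule next_entry_ge)
      then show ?thesis unfolding rectangle_eq_rays[OF s] using that by (auto simp: stochastic_ray_def A1_def intro: le_less_trans)
    qed
    then show "indicator ?B1 p *\<^sub>R gain p \<le> indicator (A \<times> {s<..t}) p *\<^sub>R max 0 (gain p)"
      by (auto simp: indicator_def)
  qed
  finally show ?thesis .
qed

lemma predictable_cover: "range (\<lambda>n. space M \<times> {0<..real n}) \<subseteq> predictable_rectangles M F"
  "(\<Union>n::nat. space M \<times> {0<..real n}) = space M \<times> {0<..}"
proof -
  show "range (\<lambda>n. space M \<times> {0<..real n}) \<subseteq> predictable_rectangles M F"
  proof
    fix B assume "B \<in> range (\<lambda>n. space M \<times> {0<..real n})"
    then obtain n where "B = space M \<times> {0<..real n}" by blast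
    moreover have "space M \<in> sets (F (ennreal 0))" using sets.top[of "F (ennreal 0)"] by (simp add: space_F)
    ultimately show "B \<in> predictable_rectangles M F" by (auto intro: predictable_rectanglesI)
  qed
  show "(\<Union>n::nat. space M \<times> {0<..real n}) = space M \<times> {0<..}"
    using real_arch_simple by fastforce
qed

text \<open>The image of the negative part is below that of the positive part on rectangles only,
  not path by path, so the difference exists as a measure on the predictable sets. Both its
  existence and its bound are lifted from the semiring.\<close>

lemma transported_difference:
  obtains N where "sets N = sets (predictable M F)"
    "\<And>B. B \<in> sets (predictable M F) \<Longrightarrow>
      emeasure (transported (\<lambda>p. max 0 (gain p))) B = emeasure (transported (\<lambda>p. max 0 (- gain p))) B + emeasure N B"
    "\<And>B. B \<in> sets (predictable M F) \<Longrightarrow> emeasure N B \<le> (\<integral>\<^sup>+p\<in>B. ennreal (max 0 (gain p)) \<partial>Q)"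
proof -
  let ?P = "\<lambda>p. max 0 (gain p)" and ?N = "\<lambda>p. max 0 (- gain p)"
  have i: "integrable Q ?P" "integrable Q ?N" using gain_integrable by (auto intro: integrable_max)
  have rect: "emeasure (transported ?P) B = ennreal (\<integral>p\<in>C. ?P p \<partial>Q)" "emeasure (transported ?N) B = ennreal (\<integral>p\<in>C. ?N p \<partial>Q)"
     "(\<integral>p\<in>C. ?P p \<partial>Q) - (\<integral>p\<in>C. ?N p \<partial>Q) = (\<integral>p\<in>C. gain p \<partial>Q)"
    if B: "B = A \<times> {s<..t}" "A \<in> sets (F (ennreal s))" "0 \<le> s" "s \<le> t"
      and C: "C = stochastic_ray A (next_binding (\<lambda>_. ennreal s)) - stochastic_ray A (next_binding (\<lambda>_. ennreal t))" for A s t B C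
  proof -
    have AM: "A \<in> sets M" using F_in_M B by blast
    then have "A \<subseteq> space M" by (rule sets.sets_into_space)
    then have eq: "at_last_binding -` B \<inter> space Q = C"
      unfolding B(1) C rectangle_eq_rays[OF B(3,4)] vimage_Diff Diff_Int_distrib2 by (simp only: vimage_at_last_binding)
    have "C \<in> sets Q" unfolding C
      by (intro ray_difference_sets AM stopping_time_measurable stopping_time_next_binding const_stopping)
    moreover have "B \<in> sets (predictable M F)" unfolding sets_predictable
      using predictable_rectanglesI[OF B(2-4)] B(1) by auto
    ultimately show "emeasure (transported ?P) B = ennreal (\<integral>p\<in>C. ?P p \<partial>Q)" "emeasure (transported ?N) B = ennreal (\<integral>p\<in>C. ?N p \<partial>Q)"
     "(\<integral>p\<in>C. ?P p \<partial>Q) - (\<integral>p\<in>C. ?N p \<partial>Q) = (\<integral>p\<in>C. gain p \<partial>Q)"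
      using emeasure_transported[OF i(1)] emeasure_transported[OF i(2)] eq set_nn_integral_pos_neg by auto
  qed
  have le: "emeasure (transported ?N) B \<le> emeasure (transported ?P) B" if BP: "B \<in> predictable_rectangles M F" for B
  proof -
    obtain A s t where B: "B = A \<times> {s<..t}" "A \<in> sets (F (ennreal s))" "0 \<le> s" "s \<le> t"
      using BP unfolding predictable_rectangles_def by blast
    show ?thesis using rect[OF B refl] gain_rectangle_nonneg[OF B(2-4)] by (auto intro!: ennreal_leI)
  qed
  obtain N where N: "sets N = sigma_sets (space M \<times> {0<..}) (predictable_rectangles M F)"
    "\<And>B. B \<in> sigma_sets (space M \<times> {0<..}) (predictable_rectangles M F) \<Longrightarrow>
      emeasure (transported ?P) B = emeasure (transported ?N) B + emeasure N B"
    using finite_measure_difference[OF semiring_predictable_rectangles finite_transported[OF i(2)] _ finite_transported[OF i(1)] _ le predictable_cover]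
    unfolding sets_transported[OF i(1)] sets_transported[OF i(2)] sets_predictable by blast
  have dens: "sets (density Q (\<lambda>p. ennreal (?P p))) = sets Q" by simp
  have fin: "finite_measure (density Q (\<lambda>p. ennreal (?P p)))" by (rule finite_measure_density_Q[OF i(1)])
  have emd: "emeasure (on_predictable (density Q (\<lambda>p. ennreal (?P p)))) B = (\<integral>\<^sup>+p\<in>B. ennreal (?P p) \<partial>Q)"
    if "B \<in> sets (predictable M F)" for B
  proof -
    have "B \<in> sets Q" using predictable_sets_M[OF that] sets_Q by simp
    then show ?thesis unfolding emeasure_on_predictable[OF dens that] by (intro emeasure_density) auto
  qed
  have finN: "finite_measure N"
  proof (rule finite_measureI)
    have sp: "space N = space M \<times> {0<..}" using N(1) sets_eq_imp_space_eq[of N "predictable M F"] sets_predictable space_predictable by simp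
    have "space M \<times> {0<..} \<in> sigma_sets (space M \<times> {0<..}) (predictable_rectangles M F)" by (rule sigma_sets_top)
    from N(2)[OF this] have "emeasure N (space N) \<le> emeasure (transported ?P) (space M \<times> {0<..})" unfolding sp by simp
    then show "emeasure N (space N) \<noteq> \<infinity>"
      using finite_measure.emeasure_finite[OF finite_transported[OF i(1)]] by (auto simp: top_unique)
  qed
  \<comment> \<open>On a rectangle the common finite mass of the negative part cancels, and
    \<open>N\<close> becomes exactly the integral bounded by
    \<open>gain_rectangle_le\<close>.\<close>
  have le2: "emeasure N B \<le> emeasure (on_predictable (density Q (\<lambda>p. ennreal (?P p)))) B" if BP: "B \<in> predictable_rectangles M F" for B
  proof -
    obtain A s t where B: "B = A \<times> {s<..t}" "A \<in> sets (F (ennreal s))" "0 \<le> s" "s \<le> t"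
      using BP unfolding predictable_rectangles_def by blast
    let ?C = "stochastic_ray A (next_binding (\<lambda>_. ennreal s)) - stochastic_ray A (next_binding (\<lambda>_. ennreal t))"
    have CM: "?C \<in> sets Q" using F_in_M[OF B(2)]
      by (intro ray_difference_sets stopping_time_measurable stopping_time_next_binding const_stopping)
    have BQ: "B \<in> sets Q" using F_in_M[OF B(2)] unfolding B(1) by (intro pair_measureI) auto
    have Bp: "B \<in> sets (predictable M F)" unfolding sets_predictable using BP by auto
    have "ennreal (\<integral>p\<in>?C. ?P p \<partial>Q) = ennreal (\<integral>p\<in>?C. ?N p \<partial>Q) + emeasure N B"
      using N(2)[of B] BP rect[OF B refl] by auto
    moreover have "ennreal (\<integral>p\<in>?C. ?P p \<partial>Q) = ennreal (\<integral>p\<in>?C. ?N p \<partial>Q) + ennreal (\<integral>p\<in>?C. gain p \<partial>Q)"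
      using rect(3)[OF B refl] gain_rectangle_nonneg[OF B(2-4)] set_nn_integral_pos_neg(5)[OF CM] by (simp flip: ennreal_plus)
    ultimately have "ennreal (\<integral>p\<in>?C. ?N p \<partial>Q) + emeasure N B = ennreal (\<integral>p\<in>?C. ?N p \<partial>Q) + ennreal (\<integral>p\<in>?C. gain p \<partial>Q)"
      by (rule trans[OF sym])
    then have "emeasure N B = ennreal (\<integral>p\<in>?C. gain p \<partial>Q)"
      by (simp only: ennreal_add_left_cancel) simp
    also have "\<dots> \<le> ennreal (\<integral>p\<in>B. ?P p \<partial>Q)"
      using gain_rectangle_le[OF B(2-4)] unfolding B(1) by (rule ennreal_leI)
    also have "\<dots> = emeasure (on_predictable (density Q (\<lambda>p. ennreal (?P p)))) B"
      unfolding emd[OF Bp] set_nn_integral_pos_neg(1)[OF BQ] ..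
    finally show ?thesis .
  qed
  have "emeasure N B \<le> (\<integral>\<^sup>+p\<in>B. ennreal (?P p) \<partial>Q)" if B: "B \<in> sets (predictable M F)" for B
    unfolding emd[OF B, symmetric]
    using finite_measure_mono_semiring[OF semiring_predictable_rectangles finN N(1) finite_on_predictable[OF dens fin] _ le2 predictable_cover] B
    unfolding sets_on_predictable[OF dens] sets_predictable by blast
  then show ?thesis using that[of N] N unfolding sets_predictable by blast
qed

lemma emeasure_transported_ray:
  assumes f: "integrable Q f" and \<tau>: "stopping_time F \<tau>" and A: "A \<in> sets (pre_sigma \<tau>)"
  shows "emeasure (transported f) (stochastic_ray A \<tau>) = (\<integral>\<^sup>+p\<in>stochastic_ray A (next_binding \<tau>). ennreal (f p) \<partial>Q)"
proof -
  have "stochastic_ray A \<tau> \<in> sets (predictable M F)"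
    unfolding stochastic_ray_def using stochastic_ray_predictable[OF \<tau> A] .
  moreover have "A \<subseteq> space M" using pre_sigma_in_M[OF \<tau> A] by (rule sets.sets_into_space)
  ultimately show ?thesis using emeasure_transported[OF f] vimage_at_last_binding by simp
qed

text \<open>Radon-Nikodym on the predictable sigma-algebra makes the density predictable at once.
  Its integral over the ray from \<tau> is the net transported mass there, that is, the integral of
  \<open>gain\<close> beyond the next binding time.\<close>

theorem multiplier_density:
  obtains k :: "'a \<times> real \<Rightarrow> real" where "k \<in> borel_measurable (predictable M F)" "integrable Q k"
    "\<And>p. 0 \<le> k p" "\<And>p. snd p \<le> 0 \<Longrightarrow> k p = 0"
    "\<And>\<omega>. \<omega> \<in> space M \<Longrightarrow> (\<integral>\<^sup>+s. ennreal (k (\<omega>, s)) \<partial>lborel) < \<infinity>"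
    "\<And>\<tau> A. stopping_time F \<tau> \<Longrightarrow> A \<in> sets (pre_sigma \<tau>) \<Longrightarrow>
       (\<integral>p\<in>stochastic_ray A \<tau>. k p \<partial>Q) = (\<integral>p\<in>stochastic_ray A (next_binding \<tau>). gain p \<partial>Q)"
proof -
  let ?P = "\<lambda>p. max 0 (gain p)" and ?N = "\<lambda>p. max 0 (- gain p)"
  have i: "integrable Q ?P" "integrable Q ?N" using gain_integrable by (auto intro: integrable_max)
  obtain N where N: "sets N = sets (predictable M F)"
    "\<And>B. B \<in> sets (predictable M F) \<Longrightarrow> emeasure (transported ?P) B = emeasure (transported ?N) B + emeasure N B"
    "\<And>B. B \<in> sets (predictable M F) \<Longrightarrow> emeasure N B \<le> (\<integral>\<^sup>+p\<in>B. ennreal (?P p) \<partial>Q)"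
    using transported_difference by blast
  let ?\<beta> = "on_predictable Q"
  have sets_\<beta>: "sets ?\<beta> = sets (predictable M F)" by (rule sets_on_predictable[OF refl])
  have space_\<beta>: "space ?\<beta> = space M \<times> {0<..}" using sets_eq_imp_space_eq[OF sets_\<beta>] by (simp add: space_predictable)
  have em_\<beta>: "emeasure ?\<beta> B = emeasure Q B" if "B \<in> sets (predictable M F)" for B
    using that by (rule emeasure_on_predictable[OF refl])
  interpret \<beta>: sigma_finite_measure ?\<beta>
  proof
    let ?A = "range (\<lambda>n. space M \<times> {0<..real n})"
    have "?A \<subseteq> sets ?\<beta>" unfolding sets_\<beta> sets_predictable using predictable_cover(1) by blast
    moreover have "emeasure ?\<beta> a \<noteq> \<infinity>" if a: "a \<in> ?A" for a
    proof -
      obtain n where n: "a = space M \<times> {0<..real n}" using a by blast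
      have "emeasure ?\<beta> a = emeasure Q (space M \<times> {0<..real n})"
      proof -
        have "a \<in> sets (predictable M F)" using \<open>?A \<subseteq> sets ?\<beta>\<close> a sets_\<beta> by blast
        from em_\<beta>[OF this] show ?thesis unfolding n .
      qed
      also have "\<dots> = emeasure M (space M) * emeasure lborel {0<..real n}" by (rule lborel.emeasure_pair_measure_Times) auto
      finally show ?thesis by (simp add: emeasure_space_1)
    qed
    moreover have "countable ?A" by simp
    moreover have "\<Union>?A = space ?\<beta>" unfolding space_\<beta> by (rule predictable_cover(2))
    ultimately show "\<exists>A. countable A \<and> A \<subseteq> sets ?\<beta> \<and> \<Union>A = space ?\<beta> \<and> (\<forall>a\<in>A. emeasure ?\<beta> a \<noteq> \<infinity>)"
      by (intro exI[of _ ?A] conjI ballI)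
  qed
  \<comment> \<open>The bound of \<open>N\<close> by the positive part of \<open>gain\<close> is
    used here: a null set of the product measure carries no mass.\<close>
  have "absolutely_continuous ?\<beta> N"
    unfolding absolutely_continuous_def
  proof
    fix B assume "B \<in> null_sets ?\<beta>"
    then have B: "B \<in> sets (predictable M F)" "emeasure Q B = 0" using em_\<beta> sets_\<beta> by (auto simp: null_sets_def)
    then have "B \<in> null_sets Q" using predictable_sets_M sets_Q by (auto simp: null_sets_def)
    then have "(\<integral>\<^sup>+p\<in>B. ennreal (?P p) \<partial>Q) = 0" by (rule nn_integral_null_set)
    then show "B \<in> null_sets N" using N(1) N(3)[OF B(1)] B(1) by (auto simp: null_sets_def)
  qed
  from \<beta>.Radon_Nikodym[OF this] N(1) sets_\<beta>
  obtain f where f: "f \<in> borel_measurable ?\<beta>" "density ?\<beta> f = N" by auto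
  define f0 where "f0 p = (if 0 < snd p then f p else 0)" for p :: "'a \<times> real"
  have f_pred: "f \<in> borel_measurable (predictable M F)" using f(1) measurable_cong_sets[OF sets_\<beta> refl] by blast
  \<comment> \<open>Predictable functions are controlled on positive times only; the value 0
    elsewhere makes them measurable on the whole product space.\<close>
  have extend: "(\<lambda>p. if 0 < snd p then h p else 0) \<in> borel_measurable Q"
    if h: "h \<in> borel_measurable (predictable M F)" for h :: "'a \<times> real \<Rightarrow> 'b::{second_countable_topology, t2_space, zero}"
  proof (rule measurableI)
    fix B :: "'b set" assume B: "B \<in> sets borel"
    have 1: "h -` B \<inter> space (predictable M F) \<in> sets Q"
      using predictable_sets_M[OF measurable_sets[OF h B]] sets_Q by (simp only:)
    have 2: "(if 0 \<in> B then space M \<times> {..0} else {}) \<in> sets Q"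
      by (cases "0 \<in> B") (auto intro!: pair_measureI)
    have "(\<lambda>p. if 0 < snd p then h p else 0) -` B \<inter> space Q =
        (h -` B \<inter> space (predictable M F)) \<union> (if 0 \<in> B then space M \<times> {..0} else {})"
      by (auto simp: space_predictable space_pair_measure split: if_splits)
    then show "(\<lambda>p. if 0 < snd p then h p else 0) -` B \<inter> space Q \<in> sets Q"
      using sets.Un[OF 1 2] by (simp only:)
  qed simp
  have f0_m: "f0 \<in> borel_measurable Q" unfolding f0_def by (rule extend[OF f_pred])
  have nn: "emeasure N B = (\<integral>\<^sup>+p\<in>B. f0 p \<partial>Q)" if B: "B \<in> sets (predictable M F)" for B
  proof -
    have "emeasure N B = (\<integral>\<^sup>+p. f p * indicator B p \<partial>?\<beta>)"
      unfolding f(2)[symmetric] using f(1) B sets_\<beta> by (intro emeasure_density) auto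
    also have "\<dots> = (\<integral>\<^sup>+p. f p * indicator B p * indicator (space M \<times> {0<..}) p \<partial>Q)"
      using f_pred B by (intro nn_integral_on_predictable) auto
    also have "\<dots> = (\<integral>\<^sup>+p\<in>B. f0 p \<partial>Q)"
      by (intro nn_integral_cong) (auto simp: f0_def indicator_def space_pair_measure)
    finally show ?thesis .
  qed
  have total: "(\<integral>\<^sup>+p. f0 p \<partial>Q) < \<infinity>"
  proof -
    have top: "space M \<times> {0<..} \<in> sets (predictable M F)"
      using sets.top[of "predictable M F"] by (simp add: space_predictable)
    have "(\<integral>\<^sup>+p. f0 p \<partial>Q) = emeasure N (space M \<times> {0<..})"
      unfolding nn[OF top] by (intro nn_integral_cong) (auto simp: f0_def indicator_def space_pair_measure)
    also have "\<dots> \<le> emeasure (transported ?P) (space M \<times> {0<..})"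
      unfolding N(2)[OF top] by simp
    also have "\<dots> < \<infinity>"
      using finite_measure.emeasure_finite[OF finite_transported[OF i(1)]] by (simp add: less_top)
    finally show ?thesis .
  qed
  \<comment> \<open>The density is set to 0 on the null event of infinite total mass, so that every
    path gives a finite measure. Null events belong to \<open>F 0\<close>, hence predictability
    survives.\<close>
  define Z where "Z = {\<omega>\<in>space M. (\<integral>\<^sup>+s. f0 (\<omega>, s) \<partial>lborel) = \<infinity>}"
  have inner: "(\<lambda>\<omega>. \<integral>\<^sup>+s. f0 (\<omega>, s) \<partial>lborel) \<in> borel_measurable M"
    using f0_m by (rule lborel.borel_measurable_nn_integral_fst)
  have "(\<integral>\<^sup>+\<omega>. \<integral>\<^sup>+s. f0 (\<omega>, s) \<partial>lborel \<partial>M) \<noteq> \<infinity>"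
    using total unfolding lborel.nn_integral_fst[OF f0_m] by simp
  then have ZN: "Z \<in> null_sets M"
    unfolding Z_def using nn_integral_PInf[OF inner] inner by (auto simp: null_sets_def vimage_def Int_def conj_commute)
  have ZF: "Z \<times> {0<..} \<in> sets (predictable M F)"
    using null_in_F[OF ZN] by (intro predictable_rectangle_sets) auto
  define k where "k p = (if 0 < snd p \<and> fst p \<notin> Z then enn2real (f p) else 0)" for p
  have k_pred: "k \<in> borel_measurable (predictable M F)"
    unfolding k_def
  proof (rule measurable_If)
    have "{p \<in> space (predictable M F). 0 < snd p \<and> fst p \<notin> Z} = space (predictable M F) - Z \<times> {0<..}"
      by (auto simp: space_predictable)
    then show "{p \<in> space (predictable M F). 0 < snd p \<and> fst p \<notin> Z} \<in> sets (predictable M F)" using ZF by simp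
    show "(\<lambda>p. enn2real (f p)) \<in> borel_measurable (predictable M F)" using f_pred by measurable
  qed simp
  have k_Q: "k \<in> borel_measurable Q"
  proof -
    have "(\<lambda>p. if 0 < snd p then k p else 0) = k" by (auto simp: k_def)
    then show ?thesis using extend[OF k_pred] by simp
  qed
  have "Z \<times> UNIV \<in> null_sets Q"
    using ZN by (auto simp: null_sets_def lborel.emeasure_pair_measure_Times)
  then have "AE p in Q. p \<notin> Z \<times> UNIV" by (rule AE_not_in)
  moreover have "AE p in Q. f0 p \<noteq> \<infinity>" using f0_m total by (intro nn_integral_PInf_AE) auto
  ultimately have k_f0: "AE p in Q. ennreal (k p) = f0 p"
    by eventually_elim (auto simp: k_def f0_def less_top[symmetric] mem_Times_iff)
  have k_nn: "0 \<le> k p" for p by (simp add: k_def)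
  have k_int: "integrable Q k"
  proof (rule integrableI_nonneg[OF k_Q])
    show "(\<integral>\<^sup>+p. ennreal (k p) \<partial>Q) < \<infinity>" using total nn_integral_cong_AE[OF k_f0] by simp
  qed (simp add: k_nn)
  have k_path: "(\<integral>\<^sup>+s. ennreal (k (\<omega>, s)) \<partial>lborel) < \<infinity>" if \<omega>: "\<omega> \<in> space M" for \<omega>
  proof (cases "\<omega> \<in> Z")
    case True
    then show ?thesis by (simp add: k_def)
  next
    case False
    have "ennreal (k (\<omega>, s)) \<le> f0 (\<omega>, s)" for s
      by (cases "f (\<omega>, s)") (auto simp: k_def f0_def)
    then have "(\<integral>\<^sup>+s. ennreal (k (\<omega>, s)) \<partial>lborel) \<le> (\<integral>\<^sup>+s. f0 (\<omega>, s) \<partial>lborel)" by (intro nn_integral_mono)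
    also have "\<dots> < \<infinity>" using False \<omega> by (simp add: Z_def less_top)
    finally show ?thesis .
  qed
  have k_ray: "(\<integral>p\<in>stochastic_ray A \<tau>. k p \<partial>Q) = (\<integral>p\<in>stochastic_ray A (next_binding \<tau>). gain p \<partial>Q)"
    if \<tau>: "stopping_time F \<tau>" and A: "A \<in> sets (pre_sigma \<tau>)" for \<tau> A
  proof -
    let ?r = "stochastic_ray A \<tau>" and ?r' = "stochastic_ray A (next_binding \<tau>)"
    have AM: "A \<in> sets M" by (rule pre_sigma_in_M[OF \<tau> A])
    have r: "?r \<in> sets (predictable M F)" unfolding stochastic_ray_def by (rule stochastic_ray_predictable[OF \<tau> A])
    have rQ: "?r \<in> sets Q" "?r' \<in> sets Q"
      by (intro stochastic_ray_sets AM stopping_time_measurable stopping_time_next_binding \<tau>)+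
    have "(\<integral>\<^sup>+p\<in>?r. f0 p \<partial>Q) = (\<integral>\<^sup>+p. ennreal (indicator ?r p *\<^sub>R k p) \<partial>Q)"
      using k_f0 by (intro nn_integral_cong_AE) (auto simp: indicator_def)
    also have "\<dots> = ennreal (\<integral>p\<in>?r. k p \<partial>Q)"
      unfolding set_lebesgue_integral_def using k_nn set_integrable_Q[OF k_int rQ(1)] unfolding set_integrable_def
      by (intro nn_integral_eq_integral) auto
    finally have kr: "emeasure N ?r = ennreal (\<integral>p\<in>?r. k p \<partial>Q)" using nn[OF r] by simp
    have knn: "0 \<le> (\<integral>p\<in>?r. k p \<partial>Q)"
      unfolding set_lebesgue_integral_def using k_nn by (intro Bochner_Integration.integral_nonneg) auto
    \<comment> \<open>The identity is kept additive as long as it lives in \<open>ennreal\<close>,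
      where subtraction truncates; the difference is taken between real numbers.\<close>
    have "ennreal (\<integral>p\<in>?r'. ?P p \<partial>Q) = ennreal (\<integral>p\<in>?r'. ?N p \<partial>Q) + ennreal (\<integral>p\<in>?r. k p \<partial>Q)"
      using N(2)[OF r] kr unfolding emeasure_transported_ray[OF i(1) \<tau> A] emeasure_transported_ray[OF i(2) \<tau> A]
        set_nn_integral_pos_neg(1,2)[OF rQ(2)] by simp
    then have "(\<integral>p\<in>?r'. ?P p \<partial>Q) = (\<integral>p\<in>?r'. ?N p \<partial>Q) + (\<integral>p\<in>?r. k p \<partial>Q)"
      using knn set_nn_integral_pos_neg(4,5)[OF rQ(2)] by (simp flip: ennreal_plus)
    then show ?thesis using set_nn_integral_pos_neg(3)[OF rQ(2)] by simp
  qed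
  show ?thesis
    by (rule that[OF k_pred k_int k_nn _ k_path k_ray]) (auto simp: k_def)
qed

end

subsection \<open>The multiplier\<close>

locale investment_multiplier = investment +
  fixes k :: "'a \<times> real \<Rightarrow> real"
  assumes k_predictable: "k \<in> borel_measurable (predictable M F)" and k_integrable: "integrable Q k"
    and k_nonneg: "0 \<le> k p" and k_zero: "snd p \<le> 0 \<Longrightarrow> k p = 0"
    and k_path_finite: "\<omega> \<in> space M \<Longrightarrow> (\<integral>\<^sup>+s. ennreal (k (\<omega>, s)) \<partial>lborel) < \<infinity>"
    and k_ray: "stopping_time F \<tau> \<Longrightarrow> A \<in> sets (pre_sigma \<tau>) \<Longrightarrow>
       (\<integral>p\<in>stochastic_ray A \<tau>. k p \<partial>Q) = (\<integral>p\<in>stochastic_ray A (next_binding \<tau>). gain p \<partial>Q)"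
begin

section \<open>Comparison of the density with the marginal gain, and its support\<close>

lemma k_measurable[measurable]: "k \<in> borel_measurable Q"
  using k_integrable by (rule borel_measurable_integrable)

lemma ray_integral_split:
  fixes f :: "'a \<times> real \<Rightarrow> real"
  assumes f: "integrable Q f" and A: "A \<in> sets M" and m: "\<tau> \<in> borel_measurable M" "\<rho> \<in> borel_measurable M"
    and le: "\<And>\<omega>. \<omega> \<in> space M \<Longrightarrow> \<tau> \<omega> \<le> \<rho> \<omega>"
  shows "(\<integral>p\<in>stochastic_ray A \<tau>. f p \<partial>Q) =
    (\<integral>p\<in>stochastic_ray A \<tau> - stochastic_ray A \<rho>. f p \<partial>Q) + (\<integral>p\<in>stochastic_ray A \<rho>. f p \<partial>Q)"
proof -
  have "stochastic_ray A \<rho> \<subseteq> stochastic_ray A \<tau>"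
    using le sets.sets_into_space[OF A] by (auto simp: stochastic_ray_def intro: le_less_trans)
  then have "stochastic_ray A \<tau> = (stochastic_ray A \<tau> - stochastic_ray A \<rho>) \<union> stochastic_ray A \<rho>" by blast
  moreover have "(\<integral>p\<in>(stochastic_ray A \<tau> - stochastic_ray A \<rho>) \<union> stochastic_ray A \<rho>. f p \<partial>Q) =
      (\<integral>p\<in>stochastic_ray A \<tau> - stochastic_ray A \<rho>. f p \<partial>Q) + (\<integral>p\<in>stochastic_ray A \<rho>. f p \<partial>Q)"
    by (intro set_integral_Un set_integrable_Q f ray_difference_sets stochastic_ray_sets A m) auto
  ultimately show ?thesis by simp
qed

text \<open>The ray splits at the next binding time: beyond it the integral of \<open>gain\<close>
  is that of \<open>k\<close> over the whole ray, before it the integral is nonpositive.\<close>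

lemma gain_ray_le:
  assumes \<tau>: "stopping_time F \<tau>" and A: "A \<in> sets (pre_sigma \<tau>)"
  shows "(\<integral>p\<in>stochastic_ray A \<tau>. gain p \<partial>Q) \<le> (\<integral>p\<in>stochastic_ray A \<tau>. k p \<partial>Q)"
  unfolding k_ray[OF assms]
    ray_integral_split[OF gain_integrable pre_sigma_in_M[OF assms] stopping_time_measurable[OF \<tau>]
      stopping_time_measurable[OF stopping_time_next_binding[OF \<tau>]] next_entry_ge]
  using gain_nonpos_before_next_binding[OF assms] by simp

text \<open>From a time of this kind the first stretch also has nonnegative integral, hence
  none.\<close>

lemma gain_ray_eq:
  assumes \<tau>: "increase_time \<tau>" and A: "A \<in> sets (pre_sigma \<tau>)"
  shows "(\<integral>p\<in>stochastic_ray A \<tau>. gain p \<partial>Q) = (\<integral>p\<in>stochastic_ray A \<tau>. k p \<partial>Q)"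
proof (rule antisym)
  have s: "stopping_time F \<tau>" using \<tau> by (simp add: increase_time_def)
  show "(\<integral>p\<in>stochastic_ray A \<tau>. gain p \<partial>Q) \<le> (\<integral>p\<in>stochastic_ray A \<tau>. k p \<partial>Q)" by (rule gain_ray_le[OF s A])
  show "(\<integral>p\<in>stochastic_ray A \<tau>. k p \<partial>Q) \<le> (\<integral>p\<in>stochastic_ray A \<tau>. gain p \<partial>Q)"
    unfolding k_ray[OF s A]
      ray_integral_split[OF gain_integrable pre_sigma_in_M[OF s A] stopping_time_measurable[OF s]
        stopping_time_measurable[OF stopping_time_next_binding[OF s]] next_entry_ge]
    using gain_nonneg_from_increase_time[OF \<tau> stopping_time_next_binding[OF s] next_entry_ge A] by simp
qed

text \<open>The mass of \<open>k\<close> between \<open>q\<close> and the next binding time \<sigma>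
  is the integral of \<open>gain\<close> from \<sigma> to the binding time after \<sigma>. That
  integral is nonpositive, while \<open>k\<close> is nonnegative.\<close>

lemma k_zero_before_binding:
  assumes q: "0 \<le> q"
  shows "AE p in Q. p \<in> stochastic_ray (space M) (\<lambda>_. ennreal q) - stochastic_ray (space M) (next_binding (\<lambda>_. ennreal q)) \<longrightarrow> k p = 0"
proof -
  let ?q = "\<lambda>_. ennreal q" and ?\<Omega> = "space M"
  let ?\<sigma> = "next_binding ?q"
  note \<sigma> = stopping_time_next_binding[OF const_stopping, of "ennreal q"]
  let ?B = "stochastic_ray ?\<Omega> ?q - stochastic_ray ?\<Omega> ?\<sigma>"
  have top: "?\<Omega> \<in> sets (pre_sigma \<tau>)" for \<tau> using sets.top[of "pre_sigma \<tau>"] by (simp add: space_pre_sigma)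
  note m = stopping_time_measurable[OF const_stopping, of "ennreal q"] stopping_time_measurable[OF \<sigma>]
    stopping_time_measurable[OF stopping_time_next_binding[OF \<sigma>]]
  have B: "?B \<in> sets Q" by (intro ray_difference_sets m sets.top)
  have "(\<integral>p\<in>?B. k p \<partial>Q) = (\<integral>p\<in>stochastic_ray ?\<Omega> ?q. k p \<partial>Q) - (\<integral>p\<in>stochastic_ray ?\<Omega> ?\<sigma>. k p \<partial>Q)"
    using ray_integral_split[OF k_integrable sets.top m(1,2) next_entry_ge] by simp
  also have "\<dots> = (\<integral>p\<in>stochastic_ray ?\<Omega> ?\<sigma>. gain p \<partial>Q) - (\<integral>p\<in>stochastic_ray ?\<Omega> (next_binding ?\<sigma>). gain p \<partial>Q)"
    unfolding k_ray[OF const_stopping top] k_ray[OF \<sigma> top] ..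
  also have "\<dots> = (\<integral>p\<in>stochastic_ray ?\<Omega> ?\<sigma> - stochastic_ray ?\<Omega> (next_binding ?\<sigma>). gain p \<partial>Q)"
    using ray_integral_split[OF gain_integrable sets.top m(2,3) next_entry_ge] by simp
  also have "\<dots> \<le> 0" by (rule gain_nonpos_before_next_binding[OF \<sigma> top])
  finally have "(\<integral>p\<in>?B. k p \<partial>Q) \<le> 0" .
  moreover have i: "integrable Q (\<lambda>p. indicator ?B p *\<^sub>R k p)" by (intro integrable_mult_indicator B k_integrable)
  moreover have "0 \<le> (\<integral>p\<in>?B. k p \<partial>Q)"
    unfolding set_lebesgue_integral_def by (intro Bochner_Integration.integral_nonneg) (simp add: k_nonneg)
  ultimately have "(\<integral>p. indicator ?B p *\<^sub>R k p \<partial>Q) = 0" unfolding set_lebesgue_integral_def by simp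
  then have "AE p in Q. indicator ?B p *\<^sub>R k p = 0"
    using integral_nonneg_eq_0_iff_AE[OF i] by (simp add: k_nonneg)
  then show ?thesis by eventually_elim (auto simp: indicator_def)
qed

text \<open>If \<open>\<nu> s < \<theta> s\<close>, left-continuity of \<theta> gives a rational
  \<open>q < s\<close> with \<open>\<nu> s < \<theta> q\<close>. A binding time \<open>v\<close> in
  \<open>(q,s)\<close> would force \<open>\<nu> s \<ge> \<theta> v \<ge> \<theta> q\<close>, so
  \<open>s\<close> lies before the next binding time after \<open>q\<close>. Countably many
  \<open>q\<close> suffice.\<close>

lemma k_complementary: "AE p in Q. 0 < snd p \<longrightarrow> \<nu> (snd p) (fst p) < \<theta> (snd p) (fst p) \<longrightarrow> k p = 0"
proof -
  have "AE p in Q. \<forall>q\<in>{q\<in>\<rat>. 0 \<le> q}.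
      p \<in> stochastic_ray (space M) (\<lambda>_. ennreal q) - stochastic_ray (space M) (next_binding (\<lambda>_. ennreal q)) \<longrightarrow> k p = 0"
    using k_zero_before_binding by (subst AE_ball_countable) (auto intro: countable_subset[OF _ countable_rat])
  then show ?thesis
    using AE_space
  proof eventually_elim
    case (elim p)
    show ?case
    proof (intro impI)
      assume u: "0 < snd p" and less: "\<nu> (snd p) (fst p) < \<theta> (snd p) (fst p)"
      have \<omega>: "fst p \<in> space M" using elim(2) by (auto simp: space_pair_measure)
      obtain q where q: "q \<in> \<rat>" "0 \<le> q" "q < snd p" "\<nu> (snd p) (fst p) < \<theta> q (fst p)"
        using left_continuous_greater_eq[OF theta_left_cont[OF \<omega>] u] less by auto
      have "\<not> next_binding (\<lambda>_. ennreal q) (fst p) < ennreal (snd p)"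
      proof
        assume "next_binding (\<lambda>_. ennreal q) (fst p) < ennreal (snd p)"
        then obtain v where v: "0 \<le> v" "ennreal q < ennreal v" "ennreal v < ennreal (snd p)" "binding v (fst p)"
          unfolding next_entry_less_iff by auto
        have "q < v" "v < snd p" using v q by (auto simp: ennreal_less_iff)
        then have "min (l v (fst p)) (\<theta> v (fst p)) \<le> \<nu> (snd p) (fst p)" "\<theta> q (fst p) \<le> \<theta> v (fst p)"
          using v q by (auto intro!: min_le_nu[OF \<omega>] theta_mono[OF \<omega>])
        then show False using v(4) q(4) by (simp add: binding_def)
      qed
      moreover have "ennreal q < ennreal (snd p)" using q by (simp add: ennreal_lessI)
      ultimately have "p \<in> stochastic_ray (space M) (\<lambda>_. ennreal q) - stochastic_ray (space M) (next_binding (\<lambda>_. ennreal q))"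
        using \<omega> by (simp add: stochastic_ray_def case_prod_beta mem_Times_iff)
      then show "k p = 0" using elim(1) q by auto
    qed
  qed
qed

section \<open>Conditional tails and the first-order conditions\<close>

definition tail_integral :: "('a \<times> real \<Rightarrow> real) \<Rightarrow> ('a \<Rightarrow> ennreal) \<Rightarrow> 'a \<Rightarrow> real" where
  "tail_integral f \<tau> \<omega> = (\<integral>s. indicator {s. \<tau> \<omega> < ennreal s} s * f (\<omega>, s) \<partial>lborel)"

lemma tail_integral:
  assumes f: "integrable Q f" and m: "\<tau> \<in> borel_measurable M"
  shows tail_integral_integrable: "integrable M (tail_integral f \<tau>)"
    and tail_integral_set: "A \<in> sets M \<Longrightarrow> (\<integral>\<omega>\<in>A. tail_integral f \<tau> \<omega> \<partial>M) = (\<integral>p\<in>stochastic_ray A \<tau>. f p \<partial>Q)"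
proof -
  interpret P: pair_sigma_finite M "lborel :: real measure" ..
  have key: "integrable M (\<lambda>\<omega>. indicator A \<omega> * tail_integral f \<tau> \<omega>) \<and>
      (\<integral>\<omega>. indicator A \<omega> * tail_integral f \<tau> \<omega> \<partial>M) = (\<integral>p\<in>stochastic_ray A \<tau>. f p \<partial>Q)" if A: "A \<in> sets M" for A
  proof -
    have i: "integrable Q (\<lambda>p. indicator (stochastic_ray A \<tau>) p *\<^sub>R f p)"
      by (intro integrable_mult_indicator f stochastic_ray_sets A m)
    have "(\<integral>s. indicator (stochastic_ray A \<tau>) (\<omega>, s) *\<^sub>R f (\<omega>, s) \<partial>lborel) = indicator A \<omega> * tail_integral f \<tau> \<omega>" for \<omega>
    proof -
      have "(\<lambda>s. indicator (stochastic_ray A \<tau>) (\<omega>, s) *\<^sub>R f (\<omega>, s)) = (\<lambda>s. indicator A \<omega> * (indicator {s. \<tau> \<omega> < ennreal s} s * f (\<omega>, s)))"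
        by (auto simp: indicator_def stochastic_ray_def)
      then show ?thesis unfolding tail_integral_def by simp
    qed
    then show ?thesis using P.integrable_fst'[OF i] P.integral_fst'[OF i] by (simp add: set_lebesgue_integral_def)
  qed
  show "A \<in> sets M \<Longrightarrow> (\<integral>\<omega>\<in>A. tail_integral f \<tau> \<omega> \<partial>M) = (\<integral>p\<in>stochastic_ray A \<tau>. f p \<partial>Q)"
    using key[of A] by (simp add: set_lebesgue_integral_def)
  have "integrable M (\<lambda>\<omega>. indicator (space M) \<omega> * tail_integral f \<tau> \<omega>)" using key[OF sets.top] by simp
  also have "?this \<longleftrightarrow> integrable M (tail_integral f \<tau>)" by (rule Bochner_Integration.integrable_cong) auto
  finally show "integrable M (tail_integral f \<tau>)" .
qed

lemma decay_tail: "tail_integral decay \<tau> \<omega> = discount \<delta> (\<tau> \<omega>)"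
proof -
  have m: "(\<lambda>s. indicator {s. \<tau> \<omega> < ennreal s} s * decay (\<omega>, s)) \<in> borel_measurable lborel"
    unfolding decay_def snd_conv by measurable
  have "tail_integral decay \<tau> \<omega> = enn2real (\<integral>\<^sup>+s. ennreal (indicator {s. \<tau> \<omega> < ennreal s} s * decay (\<omega>, s)) \<partial>lborel)"
    unfolding tail_integral_def using m decay_nonneg by (intro integral_eq_nn_integral) auto
  also have "(\<integral>\<^sup>+s. ennreal (indicator {s. \<tau> \<omega> < ennreal s} s * decay (\<omega>, s)) \<partial>lborel) =
      (\<integral>\<^sup>+s. ennreal (decay (\<omega>, s)) * indicator {s. \<tau> \<omega> < ennreal s} s \<partial>lborel)"
    by (intro nn_integral_cong) (auto simp: indicator_def)
  also have "\<dots> = ennreal (discount \<delta> (\<tau> \<omega>))" by (rule decay_nn_integral)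
  finally show ?thesis by (simp add: discount_def)
qed

definition multiplier :: "'a \<Rightarrow> real measure" where
  "multiplier \<omega> = density lborel (\<lambda>s. ennreal (k (\<omega>, s)))"

lemma k_path_measurable: "\<omega> \<in> space M \<Longrightarrow> (\<lambda>s. k (\<omega>, s)) \<in> borel_measurable borel"
  using measurable_Pair2[OF k_measurable, of \<omega>] by simp

lemma emeasure_multiplier:
  assumes "\<omega> \<in> space M" "B \<in> sets borel"
  shows "emeasure (multiplier \<omega>) B = (\<integral>\<^sup>+s\<in>B. ennreal (k (\<omega>, s)) \<partial>lborel)"
  unfolding multiplier_def using k_path_measurable[OF assms(1)] assms(2) by (intro emeasure_density) auto

lemma times_from_borel: "times_from t \<in> sets borel"
proof -
  have "{s \<in> space borel. 0 \<le> s \<and> t \<le> ennreal s} \<in> sets borel" by measurable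
  then show ?thesis by (simp add: times_from_def)
qed

lemma measure_multiplier_tail:
  assumes \<omega>: "\<omega> \<in> space M"
  shows "measure (multiplier \<omega>) (times_from (\<tau> \<omega>)) = tail_integral k \<tau> \<omega>"
proof -
  have m: "(\<lambda>s. indicator {s. \<tau> \<omega> < ennreal s} s * k (\<omega>, s)) \<in> borel_measurable lborel"
    using k_path_measurable[OF \<omega>] by measurable
  have "emeasure (multiplier \<omega>) (times_from (\<tau> \<omega>)) = (\<integral>\<^sup>+s\<in>times_from (\<tau> \<omega>). ennreal (k (\<omega>, s)) \<partial>lborel)"
    by (rule emeasure_multiplier[OF \<omega> times_from_borel])
  also have "\<dots> = (\<integral>\<^sup>+s. ennreal (indicator {s. \<tau> \<omega> < ennreal s} s * k (\<omega>, s)) \<partial>lborel)"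
    using times_from_AE[of "\<tau> \<omega>"] by (intro nn_integral_cong_AE, eventually_elim) (auto simp: indicator_def)
  finally show ?thesis
    unfolding tail_integral_def measure_def using m k_nonneg by (subst integral_eq_nn_integral) auto
qed

lemma marginal_tail:
  assumes \<omega>: "\<omega> \<in> space M"
  shows "(LINT s:times_from (\<tau> \<omega>)|lborel. exp (- \<delta> * s) * deriv (R (X s \<omega>)) (\<nu> s \<omega>)) = tail_integral flow \<tau> \<omega>"
  unfolding set_lebesgue_integral_def tail_integral_def
proof (rule integral_cong_AE)
  let ?f = "\<lambda>s. (X (max 0 s) \<omega>, \<nu> (max 0 s) \<omega>)"
  have \<nu>m: "(\<lambda>s. \<nu> (max 0 s) \<omega>) \<in> borel_measurable borel"
    using measurable_Pair2[OF progressive_measurable[OF nu_progressive], of \<omega>] \<omega> by simp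
  have "?f \<in> borel \<rightarrow>\<^sub>M borel \<Otimes>\<^sub>M borel" by (intro measurable_Pair X_path_measurable[OF \<omega>] \<nu>m)
  from measurable_compose[OF this measurable_marginal]
  have "(\<lambda>s. if 0 < snd (?f s) then deriv (R (fst (?f s))) (snd (?f s)) else 0) \<in> borel_measurable borel" .
  moreover have "(\<lambda>s. if 0 < snd (?f s) then deriv (R (fst (?f s))) (snd (?f s)) else 0) =
      (\<lambda>s. deriv (R (X (max 0 s) \<omega>)) (\<nu> (max 0 s) \<omega>))"
    using nu_pos[OF \<omega>] by auto
  ultimately have dm: "(\<lambda>s. deriv (R (X (max 0 s) \<omega>)) (\<nu> (max 0 s) \<omega>)) \<in> borel_measurable borel" by simp
  have "(\<lambda>s. indicator (times_from (\<tau> \<omega>)) s * (exp (- \<delta> * s) * deriv (R (X (max 0 s) \<omega>)) (\<nu> (max 0 s) \<omega>))) \<in> borel_measurable borel"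
    using times_from_borel dm by measurable
  moreover have "(\<lambda>s. indicator (times_from (\<tau> \<omega>)) s * (exp (- \<delta> * s) * deriv (R (X (max 0 s) \<omega>)) (\<nu> (max 0 s) \<omega>))) =
      (\<lambda>s. indicator (times_from (\<tau> \<omega>)) s *\<^sub>R (exp (- \<delta> * s) * deriv (R (X s \<omega>)) (\<nu> s \<omega>)))"
    by (auto simp: indicator_def times_from_def)
  ultimately show "(\<lambda>s. indicator (times_from (\<tau> \<omega>)) s *\<^sub>R (exp (- \<delta> * s) * deriv (R (X s \<omega>)) (\<nu> s \<omega>))) \<in> borel_measurable lborel"
    by simp
  have "(\<lambda>s. flow (\<omega>, s)) \<in> borel_measurable borel" using measurable_Pair2[OF flow_measurable, of \<omega>] \<omega> by simp
  then show "(\<lambda>s. indicator {s. \<tau> \<omega> < ennreal s} s * flow (\<omega>, s)) \<in> borel_measurable lborel" by measurable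
  show "AE s in lborel. indicator (times_from (\<tau> \<omega>)) s *\<^sub>R (exp (- \<delta> * s) * deriv (R (X s \<omega>)) (\<nu> s \<omega>)) =
      indicator {s. \<tau> \<omega> < ennreal s} s * flow (\<omega>, s)"
    using times_from_AE[of "\<tau> \<omega>"]
    by eventually_elim (auto simp: indicator_def flow_eq_marginal_flow[of "\<tau> \<omega>"] marginal_flow_def)
qed

lemma supergradient_eq:
  assumes \<tau>: "stopping_time F \<tau>"
  shows "AE \<omega> in M. supergradient_at M F \<delta> R X \<nu> \<tau> \<omega> = real_cond_exp M (pre_sigma \<tau>) (tail_integral flow \<tau>) \<omega> - discount \<delta> (\<tau> \<omega>)"
proof -
  interpret finite_measure_subalgebra M "pre_sigma \<tau>" using subalgebra_pre_sigma[OF \<tau>] by unfold_locales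
  let ?h = "\<lambda>\<omega>. LINT s:times_from (\<tau> \<omega>)|lborel. exp (- \<delta> * s) * deriv (R (X s \<omega>)) (\<nu> s \<omega>)"
  have i: "tail_integral flow \<tau> \<in> borel_measurable M"
    using tail_integral_integrable[OF flow_integrable stopping_time_measurable[OF \<tau>]] by (rule borel_measurable_integrable)
  moreover have "?h \<in> borel_measurable M \<longleftrightarrow> tail_integral flow \<tau> \<in> borel_measurable M"
    by (rule measurable_cong) (rule marginal_tail)
  ultimately have "AE \<omega> in M. real_cond_exp M (pre_sigma \<tau>) ?h \<omega> = real_cond_exp M (pre_sigma \<tau>) (tail_integral flow \<tau>) \<omega>"
    by (intro real_cond_exp_cong AE_I2 marginal_tail) auto
  then show ?thesis by eventually_elim (simp add: supergradient_at_def)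
qed

lemma set_integral_sum:
  fixes f g :: "'a \<Rightarrow> real"
  assumes "integrable M f" "integrable M g" "A \<in> sets M"
  shows "(\<integral>\<omega>\<in>A. f \<omega> + g \<omega> \<partial>M) = (\<integral>\<omega>\<in>A. f \<omega> \<partial>M) + (\<integral>\<omega>\<in>A. g \<omega> \<partial>M)"
  using assms by (intro set_integral_add(2); unfold set_integrable_def) (intro integrable_mult_indicator; assumption)+

lemma expected_tail_eq:
  assumes \<tau>: "stopping_time F \<tau>"
  shows "AE \<omega> in M. expected_tail_at M F multiplier \<tau> \<omega> = real_cond_exp M (pre_sigma \<tau>) (tail_integral k \<tau>) \<omega>"
proof -
  interpret finite_measure_subalgebra M "pre_sigma \<tau>" using subalgebra_pre_sigma[OF \<tau>] by unfold_locales
  have i: "tail_integral k \<tau> \<in> borel_measurable M"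
    using tail_integral_integrable[OF k_integrable stopping_time_measurable[OF \<tau>]] by (rule borel_measurable_integrable)
  moreover have "(\<lambda>\<omega>. measure (multiplier \<omega>) (times_from (\<tau> \<omega>))) \<in> borel_measurable M \<longleftrightarrow> tail_integral k \<tau> \<in> borel_measurable M"
    by (rule measurable_cong) (rule measure_multiplier_tail)
  ultimately show ?thesis
    unfolding expected_tail_at_def by (intro real_cond_exp_cong AE_I2 measure_multiplier_tail) auto
qed

text \<open>The tail of \<open>decay\<close> is the discount at \<tau>, which is known at \<tau> and
  therefore passes through the conditional expectation.\<close>

lemma discount_cond_exp:
  assumes \<tau>: "stopping_time F \<tau>" and f: "integrable M f"
  shows "AE \<omega> in M. real_cond_exp M (pre_sigma \<tau>) (\<lambda>\<omega>. f \<omega> + tail_integral decay \<tau> \<omega>) \<omega> =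
    real_cond_exp M (pre_sigma \<tau>) f \<omega> + discount \<delta> (\<tau> \<omega>)"
proof -
  interpret finite_measure_subalgebra M "pre_sigma \<tau>" using subalgebra_pre_sigma[OF \<tau>] by unfold_locales
  have i: "integrable M (tail_integral decay \<tau>)"
    by (rule tail_integral_integrable[OF decay_integrable stopping_time_measurable[OF \<tau>]])
  have "tail_integral decay \<tau> \<in> borel_measurable (pre_sigma \<tau>)"
    unfolding decay_tail[abs_def] by (rule discount_measurable[OF measurable_stopping_time_pre_sigma[OF \<tau>]])
  from real_cond_exp_F_meas[OF i this] real_cond_exp_add[OF f i]
  show ?thesis by eventually_elim (simp add: decay_tail)
qed

text \<open>The inequality for rays, tested on all events known at \<tau>. The discount is moved to
  the side of \<open>k\<close>, so that one conditional expectation is compared with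
  another.\<close>

lemma supergradient_le:
  assumes \<tau>: "stopping_time F \<tau>"
  shows "AE \<omega> in M. supergradient_at M F \<delta> R X \<nu> \<tau> \<omega> \<le> expected_tail_at M F multiplier \<tau> \<omega>"
proof -
  note sub = subalgebra_pre_sigma[OF \<tau>] and m = stopping_time_measurable[OF \<tau>]
  note i = tail_integral_integrable[OF flow_integrable m] tail_integral_integrable[OF k_integrable m] tail_integral_integrable[OF decay_integrable m]
  have "AE \<omega> in M. real_cond_exp M (pre_sigma \<tau>) (tail_integral flow \<tau>) \<omega> \<le>
      real_cond_exp M (pre_sigma \<tau>) (\<lambda>\<omega>. tail_integral k \<tau> \<omega> + tail_integral decay \<tau> \<omega>) \<omega>"
  proof (rule real_cond_exp_leI[OF prob_space_axioms sub i(1) Bochner_Integration.integrable_add[OF i(2,3)]])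
    fix A assume A: "A \<in> sets (pre_sigma \<tau>)"
    then have AM: "A \<in> sets M" by (rule pre_sigma_in_M[OF \<tau>])
    have "(\<integral>p\<in>stochastic_ray A \<tau>. flow p \<partial>Q) \<le> (\<integral>p\<in>stochastic_ray A \<tau>. k p \<partial>Q) + (\<integral>p\<in>stochastic_ray A \<tau>. decay p \<partial>Q)"
      using gain_ray_le[OF \<tau> A] set_integral_gain[OF stochastic_ray_sets[OF AM m]] by simp
    then show "(\<integral>\<omega>\<in>A. tail_integral flow \<tau> \<omega> \<partial>M) \<le> (\<integral>\<omega>\<in>A. tail_integral k \<tau> \<omega> + tail_integral decay \<tau> \<omega> \<partial>M)"
      using i AM tail_integral_set[OF flow_integrable m AM] tail_integral_set[OF k_integrable m AM] tail_integral_set[OF decay_integrable m AM]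
      by (subst set_integral_sum) simp_all
  qed
  with expected_tail_eq[OF \<tau>] discount_cond_exp[OF \<tau> i(2)] supergradient_eq[OF \<tau>]
  show ?thesis by eventually_elim simp
qed

text \<open>Equality of the ray integrals gives the reverse inequality of conditional
  expectations.\<close>

lemma supergradient_at_increase_time:
  assumes \<tau>: "increase_time \<tau>"
  shows "AE \<omega> in M. expected_tail_at M F multiplier \<tau> \<omega> = supergradient_at M F \<delta> R X \<nu> \<tau> \<omega>"
proof -
  have s: "stopping_time F \<tau>" using \<tau> by (simp add: increase_time_def)
  note sub = subalgebra_pre_sigma[OF s] and m = stopping_time_measurable[OF s]
  note i = tail_integral_integrable[OF flow_integrable m] tail_integral_integrable[OF k_integrable m] tail_integral_integrable[OF decay_integrable m]
  have "AE \<omega> in M. real_cond_exp M (pre_sigma \<tau>) (\<lambda>\<omega>. tail_integral k \<tau> \<omega> + tail_integral decay \<tau> \<omega>) \<omega>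
      \<le> real_cond_exp M (pre_sigma \<tau>) (tail_integral flow \<tau>) \<omega>"
  proof (rule real_cond_exp_leI[OF prob_space_axioms sub Bochner_Integration.integrable_add[OF i(2,3)] i(1)])
    fix A assume A: "A \<in> sets (pre_sigma \<tau>)"
    then have AM: "A \<in> sets M" by (rule pre_sigma_in_M[OF s])
    have "(\<integral>p\<in>stochastic_ray A \<tau>. k p \<partial>Q) + (\<integral>p\<in>stochastic_ray A \<tau>. decay p \<partial>Q) \<le> (\<integral>p\<in>stochastic_ray A \<tau>. flow p \<partial>Q)"
      using gain_ray_eq[OF \<tau> A] set_integral_gain[OF stochastic_ray_sets[OF AM m]] by simp
    then show "(\<integral>\<omega>\<in>A. tail_integral k \<tau> \<omega> + tail_integral decay \<tau> \<omega> \<partial>M) \<le> (\<integral>\<omega>\<in>A. tail_integral flow \<tau> \<omega> \<partial>M)"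
      using i AM tail_integral_set[OF flow_integrable m AM] tail_integral_set[OF k_integrable m AM] tail_integral_set[OF decay_integrable m AM]
      by (subst set_integral_sum) simp_all
  qed
  with expected_tail_eq[OF s] discount_cond_exp[OF s i(2)] supergradient_le[OF s] supergradient_eq[OF s]
  show ?thesis by eventually_elim simp
qed

text \<open>Predictability of \<open>k\<close> makes it measurable for \<open>F t\<close> on the
  window \<open>[0,t]\<close>, and integrating out time keeps the mass of \<open>[0,t]\<close>
  measurable for \<open>F t\<close>.\<close>

lemma multiplier_random_measure: "optional_random_measure M F multiplier"
  unfolding optional_random_measure_def
proof (intro conjI ballI allI impI)
  fix \<omega> assume \<omega>: "\<omega> \<in> space M"
  show "sets (multiplier \<omega>) = sets borel" by (simp add: multiplier_def)
  have "emeasure (multiplier \<omega>) {..<0} = (\<integral>\<^sup>+s. 0 \<partial>(lborel :: real measure))"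
    unfolding emeasure_multiplier[OF \<omega> borel_open[OF open_lessThan]]
    by (intro nn_integral_cong) (auto simp: indicator_def k_zero)
  then show "emeasure (multiplier \<omega>) {..<0} = 0" by simp
  fix t :: real assume "0 \<le> t"
  have "emeasure (multiplier \<omega>) {0..t} \<le> (\<integral>\<^sup>+s. ennreal (k (\<omega>, s)) \<partial>lborel)"
    unfolding emeasure_multiplier[OF \<omega> borel_closed[OF closed_atLeastAtMost]]
    by (intro nn_integral_mono) (auto simp: indicator_def)
  then show "emeasure (multiplier \<omega>) {0..t} < \<infinity>" using k_path_finite[OF \<omega>] by (rule le_less_trans)
next
  fix t :: real assume t: "0 \<le> t"
  let ?L = "restrict_space lborel {0..t} :: real measure"
  let ?N = "F (ennreal t) \<Otimes>\<^sub>M restrict_space borel {0..t}"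
  interpret L: sigma_finite_measure ?L
    by (intro sigma_finite_measure_restrict_space sigma_finite_lborel) auto
  have "k \<in> borel_measurable ?N"
  proof (rule measurableI)
    fix B :: "real set" assume B: "B \<in> sets borel"
    have 1: "(k -` B \<inter> space (predictable M F)) \<inter> (space M \<times> {0..t}) \<in> sets ?N"
      by (rule predictable_sets_F[OF measurable_sets[OF k_predictable B] t])
    have "space M \<times> ({0..t} \<inter> {..0}) \<in> sets ?N"
      using sets.top[of "F (ennreal t)"] by (intro pair_measureI) (auto simp: sets_restrict_space space_F)
    \<comment> \<open>Predictable sets do not see time 0. There \<open>k\<close> vanishes, so the
      slice at 0 is added exactly if 0 belongs to \<open>B\<close>.\<close>
    then have 2: "(if 0 \<in> B then space M \<times> ({0..t} \<inter> {..0}) else {}) \<in> sets ?N" by auto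
    have "k -` B \<inter> space ?N = ((k -` B \<inter> space (predictable M F)) \<inter> (space M \<times> {0..t})) \<union>
        (if 0 \<in> B then space M \<times> ({0..t} \<inter> {..0}) else {})"
    proof (intro set_eqI)
      fix p :: "'a \<times> real"
      show "p \<in> k -` B \<inter> space ?N \<longleftrightarrow> p \<in> ((k -` B \<inter> space (predictable M F)) \<inter> (space M \<times> {0..t})) \<union>
          (if 0 \<in> B then space M \<times> ({0..t} \<inter> {..0}) else {})"
        using k_zero[of p] by (cases p; cases "snd p \<le> 0")
          (auto simp: space_predictable space_pair_measure space_F space_restrict_space)
    qed
    then show "k -` B \<inter> space ?N \<in> sets ?N" using sets.Un[OF 1 2] by (simp only:)
  qed simp
  moreover have "sets ?N = sets (F (ennreal t) \<Otimes>\<^sub>M ?L)"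
    by (intro sets_pair_measure_cong sets_restrict_space_cong) simp_all
  ultimately have "(\<lambda>p. ennreal (k p)) \<in> borel_measurable (F (ennreal t) \<Otimes>\<^sub>M ?L)"
    using measurable_cong_sets by (intro measurable_compose[OF _ measurable_ennreal]) blast
  from L.borel_measurable_nn_integral_fst[OF this]
  have "(\<lambda>\<omega>. \<integral>\<^sup>+s. ennreal (k (\<omega>, s)) \<partial>?L) \<in> borel_measurable (F (ennreal t))" .
  also have "?this \<longleftrightarrow> (\<lambda>\<omega>. emeasure (multiplier \<omega>) {0..t}) \<in> borel_measurable (F (ennreal t))"
  proof (rule measurable_cong)
    fix \<omega> assume "\<omega> \<in> space (F (ennreal t))"
    then have \<omega>: "\<omega> \<in> space M" by (simp add: space_F)
    show "(\<integral>\<^sup>+s. ennreal (k (\<omega>, s)) \<partial>?L) = emeasure (multiplier \<omega>) {0..t}"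
      unfolding emeasure_multiplier[OF \<omega> borel_closed[OF closed_atLeastAtMost]]
      by (rule nn_integral_restrict_space) simp
  qed
  finally show "(\<lambda>\<omega>. emeasure (multiplier \<omega>) {0..t}) \<in> borel_measurable (F (ennreal t))" .
qed

lemma multiplier_finite: "(\<integral>\<^sup>+\<omega>. emeasure (multiplier \<omega>) {0..} \<partial>M) < \<infinity>"
proof -
  have "(\<integral>\<^sup>+\<omega>. emeasure (multiplier \<omega>) {0..} \<partial>M) \<le> (\<integral>\<^sup>+\<omega>. \<integral>\<^sup>+s. ennreal (k (\<omega>, s)) \<partial>lborel \<partial>M)"
  proof (rule nn_integral_mono)
    fix \<omega> assume \<omega>: "\<omega> \<in> space M"
    show "emeasure (multiplier \<omega>) {0..} \<le> (\<integral>\<^sup>+s. ennreal (k (\<omega>, s)) \<partial>lborel)"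
      unfolding emeasure_multiplier[OF \<omega> borel_closed[OF closed_atLeast]]
      by (intro nn_integral_mono) (auto simp: indicator_def)
  qed
  also have "\<dots> = (\<integral>\<^sup>+p. ennreal (k p) \<partial>Q)" by (rule lborel.nn_integral_fst) measurable
  also have "\<dots> = (\<integral>\<^sup>+p. ennreal (norm (k p)) \<partial>Q)" by (simp add: k_nonneg)
  also have "\<dots> < \<infinity>" using k_integrable unfolding integrable_iff_bounded by simp
  finally show ?thesis .
qed

lemma multiplier_absolutely_continuous: "AE \<omega> in M. absolutely_continuous lborel (multiplier \<omega>)"
proof (rule AE_I2)
  fix \<omega> assume "\<omega> \<in> space M"
  then show "absolutely_continuous lborel (multiplier \<omega>)"
    unfolding multiplier_def using k_path_measurable by (intro absolutely_continuousI_density) simp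
qed

lemma multiplier_complementary:
  "(\<integral>\<^sup>+\<omega>. (\<integral>\<^sup>+t\<in>{0..}. ennreal (\<theta> t \<omega> - \<nu> t \<omega>) \<partial>multiplier \<omega>) \<partial>M) = 0"
proof -
  let ?g = "\<lambda>p. \<theta> (max 0 (snd p)) (fst p) - \<nu> (max 0 (snd p)) (fst p)"
  have g: "?g \<in> borel_measurable Q"
    by (intro borel_measurable_diff progressive_measurable_Q theta_progressive nu_progressive)
  have "(\<integral>\<^sup>+\<omega>. (\<integral>\<^sup>+t\<in>{0..}. ennreal (\<theta> t \<omega> - \<nu> t \<omega>) \<partial>multiplier \<omega>) \<partial>M) =
      (\<integral>\<^sup>+\<omega>. \<integral>\<^sup>+s. ennreal (k (\<omega>, s)) * ennreal (?g (\<omega>, s)) \<partial>lborel \<partial>M)"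
  proof (rule nn_integral_cong)
    fix \<omega> assume \<omega>: "\<omega> \<in> space M"
    have gm: "(\<lambda>s. ?g (\<omega>, s)) \<in> borel_measurable borel" using measurable_Pair2[OF g, of \<omega>] \<omega> by simp
    have "(\<integral>\<^sup>+t\<in>{0..}. ennreal (\<theta> t \<omega> - \<nu> t \<omega>) \<partial>multiplier \<omega>) = (\<integral>\<^sup>+t\<in>{0..}. ennreal (?g (\<omega>, t)) \<partial>multiplier \<omega>)"
      by (intro nn_integral_cong) (auto simp: indicator_def)
    also have "\<dots> = (\<integral>\<^sup>+s. ennreal (k (\<omega>, s)) * (ennreal (?g (\<omega>, s)) * indicator {0..} s) \<partial>lborel)"
      unfolding multiplier_def using k_path_measurable[OF \<omega>] measurable_compose[OF gm measurable_ennreal]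
      by (intro nn_integral_density) auto
    also have "\<dots> = (\<integral>\<^sup>+s. ennreal (k (\<omega>, s)) * ennreal (?g (\<omega>, s)) \<partial>lborel)"
      by (intro nn_integral_cong) (auto simp: indicator_def k_zero)
    finally show "(\<integral>\<^sup>+t\<in>{0..}. ennreal (\<theta> t \<omega> - \<nu> t \<omega>) \<partial>multiplier \<omega>) =
      (\<integral>\<^sup>+s. ennreal (k (\<omega>, s)) * ennreal (?g (\<omega>, s)) \<partial>lborel)" .
  qed
  also have "\<dots> = (\<integral>\<^sup>+p. ennreal (k p) * ennreal (?g p) \<partial>Q)"
    by (intro lborel.nn_integral_fst borel_measurable_times_ennreal measurable_compose[OF k_measurable measurable_ennreal]
        measurable_compose[OF g measurable_ennreal])
  also have "\<dots> = (\<integral>\<^sup>+p. 0 \<partial>Q)"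
  proof (rule nn_integral_cong_AE)
    show "AE p in Q. ennreal (k p) * ennreal (?g p) = 0"
      using k_complementary
    proof eventually_elim
      case (elim p)
      then show ?case using k_zero[of p] by (cases "0 < snd p") (auto simp: ennreal_neg not_less)
    qed
  qed
  finally show ?thesis by simp
qed

subsection \<open>Complementary slackness\<close>

lemma optional_path_measurable:
  assumes "optional_process M F G" "\<omega> \<in> space M"
  shows "(\<lambda>t. G (max 0 t) \<omega>) \<in> borel_measurable borel"
  using measurable_Pair2[OF progressive_measurable[OF progressive_optional[OF assms(1)]], of \<omega>] assms(2) by simp

lemma level_time_measurable_pair:
  "(\<lambda>p. level_time (\<lambda>t. \<nu> t (fst p)) (snd p)) \<in> borel_measurable Q"
proof (rule measurable_level_time)
  show "x \<in> space Q \<Longrightarrow> nondecreasing_left_cont (\<lambda>t. \<nu> t (fst x))" for x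
    by (rule nu_left_cont) (auto simp: space_pair_measure)
  fix t :: real assume t: "0 \<le> t"
  then have "\<nu> t \<in> borel_measurable M"
    using nu_adapted measurable_from_subalg[OF subalgebra_F] unfolding adapted_def by blast
  then show "(\<lambda>x. \<nu> t (fst x)) \<in> borel_measurable Q" by measurable
qed measurable

text \<open>Changing variables along the levels of \<open>\<nu>\<close> replaces an optional section theorem: the level times are
  stopping times from which \<open>\<nu>\<close> increases.\<close>
lemma slackness:
  assumes G: "optional_version M F (supergradient_at M F \<delta> R X \<nu>) G"
    and \<Lambda>: "optional_version M F (expected_tail_at M F multiplier) \<Lambda>"
  shows "AE \<omega> in M. set_integrable (left_stieltjes (\<lambda>t. \<nu> t \<omega>)) {0..} (\<lambda>t. G t \<omega> - \<Lambda> t \<omega>) \<and>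
    (LINT t:{0..}|left_stieltjes (\<lambda>t. \<nu> t \<omega>). G t \<omega> - \<Lambda> t \<omega>) = 0"
proof -
  interpret P: pair_sigma_finite M "lborel :: real measure" ..
  have opt: "optional_process M F G" "optional_process M F \<Lambda>" using G \<Lambda> unfolding optional_version_def by auto
  let ?H = "\<lambda>t \<omega>. G (max 0 t) \<omega> - \<Lambda> (max 0 t) \<omega>"
  let ?lt = "\<lambda>\<omega> c. level_time (\<lambda>t. \<nu> t \<omega>) c"
  let ?good = "\<lambda>\<omega> c. y \<le> c \<and> ?lt \<omega> c < top \<longrightarrow> ?H (enn2real (?lt \<omega> c)) \<omega> = 0"
  have H: "(\<lambda>p. ?H (snd p) (fst p)) \<in> borel_measurable Q"
    by (intro borel_measurable_diff progressive_measurable_Q progressive_optional opt)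
  have lt[measurable]: "(\<lambda>p. ?lt (fst p) (snd p)) \<in> borel_measurable Q" by (rule level_time_measurable_pair)
  have "(\<lambda>p. (fst p, enn2real (?lt (fst p) (snd p)))) \<in> Q \<rightarrow>\<^sub>M Q" by measurable
  from measurable_compose[OF this H]
  have [measurable]: "(\<lambda>p. ?H (enn2real (?lt (fst p) (snd p))) (fst p)) \<in> borel_measurable Q" by simp
  have good_m: "{p\<in>space Q. ?good (fst p) (snd p)} \<in> sets Q" by measurable
  have "AE \<omega> in M. ?good \<omega> c" for c
  proof (cases "y \<le> c")
    case True
    let ?\<tau> = "\<lambda>\<omega>. ?lt \<omega> c"
    have inc: "increase_time ?\<tau>" by (rule increase_time_level[OF True])
    then have s: "stopping_time F ?\<tau>" by (simp add: increase_time_def)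
    have "AE \<omega> in M. ?\<tau> \<omega> < \<infinity> \<longrightarrow> G (enn2real (?\<tau> \<omega>)) \<omega> = supergradient_at M F \<delta> R X \<nu> ?\<tau> \<omega>"
      "AE \<omega> in M. ?\<tau> \<omega> < \<infinity> \<longrightarrow> \<Lambda> (enn2real (?\<tau> \<omega>)) \<omega> = expected_tail_at M F multiplier ?\<tau> \<omega>"
      using G \<Lambda> s unfolding optional_version_def by auto
    with supergradient_at_increase_time[OF inc] show ?thesis by eventually_elim auto
  qed simp
  then have "AE c in lborel. AE \<omega> in M. ?good \<omega> c" by simp
  \<comment> \<open>For each level the exceptional event may be different; the joint measurability
    \<open>good_m\<close> allows Fubini to exchange the two quantifiers.\<close>
  then have "AE \<omega> in M. AE c in lborel. ?good \<omega> c" using P.AE_commute[OF good_m] by simp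
  then show ?thesis
    using AE_space
  proof eventually_elim
    case (elim \<omega>)
    then have \<omega>: "\<omega> \<in> space M" and ae: "AE c in lborel. ?good \<omega> c" by auto
    let ?f = "\<lambda>t. \<nu> t \<omega>"
    let ?S = "left_stieltjes ?f"
    have sets_S: "sets ?S = sets borel" unfolding left_stieltjes_def by simp
    have Hm: "(\<lambda>t. ?H t \<omega>) \<in> borel_measurable borel"
      by (intro borel_measurable_diff optional_path_measurable opt \<omega>)
    \<comment> \<open>The indicator of the times where the integrand is nonzero replaces the
      integrand: nothing need be known about its integrability, which then follows together with the
      value 0.\<close>
    let ?g = "\<lambda>t. indicator {t. ?H t \<omega> \<noteq> 0} t :: ennreal"
    have set_m: "{t. ?H t \<omega> \<noteq> 0} \<in> sets borel"
    proof -
      have "{t\<in>space borel. ?H t \<omega> \<noteq> 0} \<in> sets borel" using Hm by measurable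
      then show ?thesis by simp
    qed
    then have gm: "?g \<in> borel_measurable borel" by (rule borel_measurable_indicator)
    have "(\<integral>\<^sup>+t\<in>{0..}. ?g t \<partial>?S) = (\<integral>\<^sup>+c. ?g (enn2real (?lt \<omega> c)) * indicator {c. \<nu> 0 \<omega> \<le> c \<and> ?lt \<omega> c < \<infinity>} c \<partial>lborel)"
      by (rule nn_integral_left_stieltjes[OF nu_left_cont[OF \<omega>] gm])
    also have "\<dots> = (\<integral>\<^sup>+c. 0 \<partial>(lborel :: real measure))"
      using ae by (intro nn_integral_cong_AE, eventually_elim) (auto simp: indicator_def nu_zero[OF \<omega>])
    finally have "(\<integral>\<^sup>+t\<in>{0..}. ?g t \<partial>?S) = 0" by simp
    moreover have "(\<lambda>t. ?g t * indicator {0..} t) \<in> borel_measurable ?S"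
      unfolding measurable_cong_sets[OF sets_S refl] using gm by measurable
    ultimately have "AE t in ?S. ?g t * indicator {0..} t = 0" by (simp add: nn_integral_0_iff_AE)
    then have zero: "AE t in ?S. indicator {0..} t *\<^sub>R (G t \<omega> - \<Lambda> t \<omega>) = (0::real)"
      by eventually_elim (auto simp: indicator_def split: if_splits)
    have "(\<lambda>t. indicator {0..} t *\<^sub>R (G t \<omega> - \<Lambda> t \<omega>)) = (\<lambda>t. indicator {0..} t *\<^sub>R ?H t \<omega>)"
      by (auto simp: indicator_def)
    then have m: "(\<lambda>t. indicator {0..} t *\<^sub>R (G t \<omega> - \<Lambda> t \<omega>)) \<in> borel_measurable ?S"
      unfolding measurable_cong_sets[OF sets_S refl] using Hm by simp
    show ?case
      unfolding set_integrable_def set_lebesgue_integral_def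
      using integrable_cong_AE[OF m borel_measurable_const zero] integral_cong_AE[OF m borel_measurable_const zero]
      by simp
  qed
qed

subsection \<open>Optimality\<close>

text \<open>Investment cost appears as a rent \<delta> per unit of capacity, so that the derivative
  with respect to capacity, taken at \<nu>, is \<open>gain\<close>.\<close>

abbreviation payoff :: "(real \<Rightarrow> 'a \<Rightarrow> real) \<Rightarrow> 'a \<times> real \<Rightarrow> real" where
  "payoff \<mu> p \<equiv> (if 0 < snd p then exp (- \<delta> * snd p) * (R (X (snd p) (fst p)) (\<mu> (snd p) (fst p)) - \<delta> * \<mu> (snd p) (fst p)) else 0)"

abbreviation "discounted_theta \<equiv> (\<lambda>p. if 0 < snd p then exp (- \<delta> * snd p) * \<theta> (snd p) (fst p) else 0)"

lemma theta_sup_measurable: "(\<lambda>\<omega>. SUP t\<in>{0..}. ennreal (\<theta> t \<omega>)) \<in> borel_measurable M"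
proof -
  let ?s = "\<lambda>\<omega>. SUP t\<in>{0..}. ennreal (\<theta> t \<omega>)"
  have eq: "?s \<omega> = (SUP n::nat. ennreal (\<theta> (real n) \<omega>))" if \<omega>: "\<omega> \<in> space M" for \<omega>
  proof (rule antisym)
    show "?s \<omega> \<le> (SUP n::nat. ennreal (\<theta> (real n) \<omega>))"
    proof (rule SUP_least)
      fix t :: real assume t: "t \<in> {0..}"
      obtain n where "t \<le> real n" using real_arch_simple by blast
      then have "ennreal (\<theta> t \<omega>) \<le> ennreal (\<theta> (real n) \<omega>)" using t by (intro ennreal_leI theta_mono[OF \<omega>]) auto
      then show "ennreal (\<theta> t \<omega>) \<le> (SUP n::nat. ennreal (\<theta> (real n) \<omega>))" by (rule SUP_upper2[OF UNIV_I])
    qed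
    show "(SUP n::nat. ennreal (\<theta> (real n) \<omega>)) \<le> ?s \<omega>"
      by (intro SUP_least SUP_upper) simp
  qed
  have "\<theta> (real n) \<in> borel_measurable M" for n
  proof (rule measurable_from_subalg[OF subalgebra_F])
    show "\<theta> (real n) \<in> borel_measurable (F (ennreal (real n)))" using theta_adapted unfolding adapted_def by simp
  qed
  then have "(\<lambda>\<omega>. SUP n::nat. ennreal (\<theta> (real n) \<omega>)) \<in> borel_measurable M" by measurable
  also have "?this \<longleftrightarrow> ?s \<in> borel_measurable M" by (intro measurable_cong eq[symmetric])
  finally show ?thesis .
qed

lemma theta_bounded: "AE \<omega> in M. (SUP t\<in>{0..}. ennreal (\<theta> t \<omega>)) \<noteq> \<infinity>"
  using theta_sup by (intro nn_integral_PInf_AE theta_sup_measurable) auto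

lemma discounted_theta_measurable: "discounted_theta \<in> borel_measurable Q"
proof -
  have "(\<lambda>p. if 0 < snd p then exp (- \<delta> * snd p) * \<theta> (max 0 (snd p)) (fst p) else 0) \<in> borel_measurable Q"
    using progressive_measurable_Q[OF theta_progressive] by measurable
  moreover have "(\<lambda>p. if 0 < snd p then exp (- \<delta> * snd p) * \<theta> (max 0 (snd p)) (fst p) else 0) = discounted_theta" by auto
  ultimately show ?thesis by simp
qed

text \<open>Each path is at most its supremum, the discount factor is \<open>decay\<close> divided
  by \<delta>, and \<open>decay\<close> has total mass 1 on every path: the bound is
  \<open>E[\<theta>(\<infinity>)] / \<delta>\<close>.\<close>

lemma discounted_theta_integrable: "integrable Q discounted_theta"
proof (rule integrableI_bounded[OF discounted_theta_measurable])
  let ?s = "\<lambda>\<omega>. SUP t\<in>{0..}. ennreal (\<theta> t \<omega>)"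
  have "(\<integral>\<^sup>+p. ennreal (norm (discounted_theta p)) \<partial>Q) = (\<integral>\<^sup>+\<omega>. \<integral>\<^sup>+s. ennreal (norm (discounted_theta (\<omega>, s))) \<partial>lborel \<partial>M)"
    by (rule lborel.nn_integral_fst[symmetric, OF measurable_compose[OF measurable_compose[OF discounted_theta_measurable borel_measurable_norm] measurable_ennreal]])
  also have "\<dots> \<le> (\<integral>\<^sup>+\<omega>. ennreal (1 / \<delta>) * ?s \<omega> \<partial>M)"
  proof (rule nn_integral_mono)
    fix \<omega> assume \<omega>: "\<omega> \<in> space M"
    have "ennreal (norm (discounted_theta (\<omega>, s))) \<le> ennreal (1 / \<delta>) * ?s \<omega> * (ennreal (decay (\<omega>, s)) * indicator {s. 0 < ennreal s} s)" for s
    proof (cases "0 < s")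
      case True
      have "ennreal (norm (discounted_theta (\<omega>, s))) = ennreal (1 / \<delta>) * (ennreal (decay (\<omega>, s)) * ennreal (\<theta> s \<omega>))"
        using True delta_pos theta_pos[OF \<omega>, of s] by (simp add: decay_def abs_mult ennreal_mult[symmetric])
      also have "\<dots> \<le> ennreal (1 / \<delta>) * (ennreal (decay (\<omega>, s)) * ?s \<omega>)"
        using True by (intro mult_left_mono SUP_upper) auto
      finally show ?thesis using True by (simp add: mult_ac)
    qed simp
    then have "(\<integral>\<^sup>+s. ennreal (norm (discounted_theta (\<omega>, s))) \<partial>lborel) \<le>
        (\<integral>\<^sup>+s. ennreal (1 / \<delta>) * ?s \<omega> * (ennreal (decay (\<omega>, s)) * indicator {s. 0 < ennreal s} s) \<partial>lborel)"
      by (intro nn_integral_mono)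
    also have "\<dots> = ennreal (1 / \<delta>) * ?s \<omega> * (\<integral>\<^sup>+s. ennreal (decay (\<omega>, s)) * indicator {s. 0 < ennreal s} s \<partial>lborel)"
    proof (rule nn_integral_cmult)
      show "(\<lambda>s. ennreal (decay (\<omega>, s)) * indicator {s. 0 < ennreal s} s) \<in> borel_measurable lborel"
        unfolding decay_def snd_conv by measurable
    qed
    also have "\<dots> = ennreal (1 / \<delta>) * ?s \<omega>" unfolding decay_nn_integral by (simp add: discount_def)
    finally show "(\<integral>\<^sup>+s. ennreal (norm (discounted_theta (\<omega>, s))) \<partial>lborel) \<le> ennreal (1 / \<delta>) * ?s \<omega>" .
  qed
  also have "\<dots> = ennreal (1 / \<delta>) * (\<integral>\<^sup>+\<omega>. ?s \<omega> \<partial>M)"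
    by (rule nn_integral_cmult[OF theta_sup_measurable])
  also have "\<dots> < \<infinity>" using theta_sup by (simp add: ennreal_mult_less_top)
  finally show "(\<integral>\<^sup>+p. ennreal (norm (discounted_theta p)) \<partial>Q) < \<infinity>" .
qed

lemma AE_fst_Q:
  assumes "AE \<omega> in M. P \<omega>" shows "AE p in Q. P (fst p)"
proof -
  obtain N where N: "{\<omega>\<in>space M. \<not> P \<omega>} \<subseteq> N" "emeasure M N = 0" "N \<in> sets M" using assms by (rule AE_E)
  then have "N \<times> UNIV \<in> null_sets Q" by (auto simp: null_sets_def lborel.emeasure_pair_measure_Times)
  then have "AE p in Q. p \<notin> N \<times> UNIV" by (rule AE_not_in)
  then show ?thesis using AE_space
    by eventually_elim (use N(1) in \<open>auto simp: space_pair_measure\<close>)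
qed

lemma payoff_integrable:
  assumes \<mu>: "progressive F \<mu>" "\<And>\<omega> t. \<omega> \<in> space M \<Longrightarrow> 0 \<le> t \<Longrightarrow> 0 \<le> \<mu> t \<omega>"
    and le: "AE \<omega> in M. \<forall>t\<ge>0. \<mu> t \<omega> \<le> \<theta> t \<omega>"
  shows "integrable Q (payoff \<mu>)"
proof -
  let ?r = "\<lambda>p. if 0 < snd p then exp (- \<delta> * snd p) * R (X (snd p) (fst p)) (\<mu> (snd p) (fst p)) else 0"
  let ?m = "\<lambda>p. if 0 < snd p then exp (- \<delta> * snd p) * \<mu> (snd p) (fst p) else 0"
  have sp: "fst p \<in> space M" if "p \<in> space Q" for p using that by (auto simp: space_pair_measure)
  have rm: "?r \<in> borel_measurable Q"
  proof -
    have "(\<lambda>p. exp (- \<delta> * snd p) * (if 0 < snd p \<and> 0 < \<mu> (snd p) (fst p) then R (X (snd p) (fst p)) (\<mu> (snd p) (fst p)) else 0)) \<in> borel_measurable Q"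
      using measurable_R_process[OF \<mu>(1)] by measurable
    also have "?this \<longleftrightarrow> ?thesis"
    proof (rule measurable_cong)
      fix p assume "p \<in> space Q"
      then have "0 < snd p \<Longrightarrow> \<mu> (snd p) (fst p) = 0 \<or> 0 < \<mu> (snd p) (fst p)" using \<mu>(2)[OF sp, of p "snd p"] by auto
      then show "exp (- \<delta> * snd p) * (if 0 < snd p \<and> 0 < \<mu> (snd p) (fst p) then R (X (snd p) (fst p)) (\<mu> (snd p) (fst p)) else 0) = ?r p"
        using R_zero by auto
    qed
    finally show ?thesis .
  qed
  have mm: "?m \<in> borel_measurable Q"
  proof -
    have "(\<lambda>p. if 0 < snd p then exp (- \<delta> * snd p) * \<mu> (max 0 (snd p)) (fst p) else 0) \<in> borel_measurable Q"
      using progressive_measurable_Q[OF \<mu>(1)] by measurable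
    moreover have "(\<lambda>p. if 0 < snd p then exp (- \<delta> * snd p) * \<mu> (max 0 (snd p)) (fst p) else 0) = ?m" by auto
    ultimately show ?thesis by simp
  qed
  have le_Q: "AE p in Q. \<forall>t\<ge>0. \<mu> t (fst p) \<le> \<theta> t (fst p)"
    using le by (rule AE_fst_Q)
  have "integrable Q ?r"
  proof (rule Bochner_Integration.integrable_bound[OF profit_bound_integrable rm])
    show "AE p in Q. norm (?r p) \<le> norm (profit_bound p)"
      using le_Q AE_space
    proof eventually_elim
      case (elim p)
      show ?case
      proof (cases "0 < snd p")
        case True
        have "0 \<le> \<mu> (snd p) (fst p)" using \<mu>(2)[OF sp[OF elim(2)], of "snd p"] True by simp
        moreover have "\<mu> (snd p) (fst p) \<le> \<theta> (snd p) (fst p)" using elim(1) True by simp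
        ultimately have "0 \<le> R (X (snd p) (fst p)) (\<mu> (snd p) (fst p))"
          "R (X (snd p) (fst p)) (\<mu> (snd p) (fst p)) \<le> R (X (snd p) (fst p)) (\<theta> (snd p) (fst p))"
          by (auto intro: R_nonneg R_mono)
        then show ?thesis using True by (auto simp: profit_bound_def abs_mult)
      qed simp
    qed
  qed
  moreover have "integrable Q ?m"
  proof (rule Bochner_Integration.integrable_bound[OF discounted_theta_integrable mm])
    show "AE p in Q. norm (?m p) \<le> norm (discounted_theta p)"
      using le_Q AE_space
    proof eventually_elim
      case (elim p)
      show ?case
      proof (cases "0 < snd p")
        case True
        then have "0 \<le> \<mu> (snd p) (fst p)" "\<mu> (snd p) (fst p) \<le> \<theta> (snd p) (fst p)"
          using elim(1) \<mu>(2)[OF sp[OF elim(2)], of "snd p"] by simp_all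
        then have "\<bar>\<mu> (snd p) (fst p)\<bar> \<le> \<bar>\<theta> (snd p) (fst p)\<bar>" by linarith
        then show ?thesis using True by (simp add: abs_mult)
      qed simp
    qed
  qed
  ultimately have "integrable Q (\<lambda>p. ?r p - \<delta> * ?m p)" by simp
  moreover have "(\<lambda>p. ?r p - \<delta> * ?m p) = payoff \<mu>" by (auto simp: algebra_simps)
  ultimately show ?thesis by simp
qed

text \<open>Integration by parts turns the cost of investment into a running cost at rate \<open>\<delta>\<close>.\<close>
lemma net_profit_eq:
  assumes \<mu>: "\<mu> \<in> admissible M F \<theta> y"
  shows "net_profit M \<delta> R X \<mu> = (\<integral>p. payoff \<mu> p \<partial>Q) + y"
proof -
  interpret P: pair_sigma_finite M "lborel :: real measure" ..
  have ad: "adapted F \<mu>" and lc: "\<And>\<omega>. \<omega> \<in> space M \<Longrightarrow> nondecreasing_left_cont (\<lambda>t. \<mu> t \<omega>)"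
    and nn: "\<And>\<omega> t. \<omega> \<in> space M \<Longrightarrow> 0 \<le> t \<Longrightarrow> 0 \<le> \<mu> t \<omega>" and zero: "AE \<omega> in M. \<mu> 0 \<omega> = y"
    and le: "AE \<omega> in M. \<forall>t\<ge>0. \<mu> t \<omega> \<le> \<theta> t \<omega>"
    using \<mu> unfolding admissible_def by auto
  have pr: "progressive F \<mu>" using progressive_left_continuous[OF ad lc] .
  have int: "integrable Q (payoff \<mu>)" by (rule payoff_integrable[OF pr nn le])
  let ?r = "\<lambda>\<omega> s. indicator {0..} s *\<^sub>R (exp (- \<delta> * s) * R (X s \<omega>) (\<mu> s \<omega>))"
  let ?c = "\<lambda>\<omega> s. indicator {0..} s * (\<delta> * exp (- \<delta> * s) * (\<mu> s \<omega> - \<mu> 0 \<omega>))"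
  have AE_eq: "AE \<omega> in M. (LINT t:{0..}|lborel. exp (- \<delta> * t) * R (X t \<omega>) (\<mu> t \<omega>))
              - (LINT t:{0..}|left_stieltjes (\<lambda>t. \<mu> t \<omega>). exp (- \<delta> * t)) = (\<integral>s. payoff \<mu> (\<omega>, s) \<partial>lborel) + y"
    using zero le theta_bounded P.AE_integrable_fst'[OF int] AE_space
  proof eventually_elim
    case (elim \<omega>)
    then have \<omega>: "\<omega> \<in> space M" by simp
    let ?f = "\<lambda>t. \<mu> t \<omega>"
    let ?S = "left_stieltjes ?f"
    have f: "nondecreasing_left_cont ?f" by (rule lc[OF \<omega>])
    have f_mono: "\<mu> 0 \<omega> \<le> \<mu> t \<omega>" if "0 \<le> t" for t
      using f that unfolding nondecreasing_left_cont_def by (auto intro: mono_onD)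
    have sets_S: "sets ?S = sets borel" unfolding left_stieltjes_def by simp
    have \<mu>m: "(\<lambda>s. \<mu> (max 0 s) \<omega>) \<in> borel_measurable borel"
      using measurable_Pair2[OF progressive_measurable[OF pr], of \<omega>] \<omega> by simp
    obtain b where b: "(SUP t\<in>{0..}. ennreal (\<theta> t \<omega>)) = ennreal b" "0 \<le> b"
      using elim(3) by (cases "SUP t\<in>{0..}. ennreal (\<theta> t \<omega>)") auto
    have bound: "\<mu> t \<omega> \<le> b" if "0 \<le> t" for t
    proof -
      have "ennreal (\<theta> t \<omega>) \<le> ennreal b" unfolding b(1)[symmetric] using that by (intro SUP_upper) simp
      then show ?thesis using elim(2) that b(2) by (auto simp: ennreal_le_iff intro: order_trans)
    qed
    have c_eq: "?c \<omega> = (\<lambda>s. indicator {0..} s * (\<delta> * exp (- \<delta> * s) * (\<mu> (max 0 s) \<omega> - \<mu> 0 \<omega>)))"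
      by (auto simp: indicator_def)
    have cm: "?c \<omega> \<in> borel_measurable lborel" unfolding c_eq using \<mu>m by measurable
    have c_nn: "0 \<le> ?c \<omega> s" for s using f_mono delta_pos by (auto simp: indicator_def intro!: mult_nonneg_nonneg)
    have e_nn: "(\<integral>\<^sup>+s. ennreal (?c \<omega> s) \<partial>lborel) = (\<integral>\<^sup>+t. ennreal (indicator {0..} t *\<^sub>R exp (- \<delta> * t)) \<partial>?S)"
    proof -
      have "(\<integral>\<^sup>+s. ennreal (?c \<omega> s) \<partial>lborel) = (\<integral>\<^sup>+s\<in>{0..}. ennreal (\<delta> * exp (- \<delta> * s) * (?f s - ?f 0)) \<partial>lborel)"
        by (intro nn_integral_cong) (auto simp: indicator_def)
      also have "\<dots> = (\<integral>\<^sup>+t\<in>{0..}. ennreal (exp (- \<delta> * t)) \<partial>?S)"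
        by (rule nn_integral_exp_left_stieltjes[OF f delta_pos, symmetric])
      also have "\<dots> = (\<integral>\<^sup>+t. ennreal (indicator {0..} t *\<^sub>R exp (- \<delta> * t)) \<partial>?S)"
        by (intro nn_integral_cong) (auto simp: indicator_def)
      finally show ?thesis .
    qed
    have cost: "(LINT t:{0..}|?S. exp (- \<delta> * t)) = (\<integral>s. ?c \<omega> s \<partial>lborel)"
      unfolding set_lebesgue_integral_def using cm c_nn e_nn
      by (subst (1 2) integral_eq_nn_integral) (auto simp: measurable_cong_sets[OF sets_S refl])
    have c_int: "integrable lborel (?c \<omega>)"
    proof (rule integrableI_nonneg[OF cm])
      have "(\<integral>\<^sup>+s. ennreal (?c \<omega> s) \<partial>lborel) \<le> (\<integral>\<^sup>+s. ennreal b * (ennreal (decay (\<omega>, s)) * indicator {s. 0 < ennreal s} s) \<partial>lborel)"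
      proof (rule nn_integral_mono)
        fix s :: real
        show "ennreal (?c \<omega> s) \<le> ennreal b * (ennreal (decay (\<omega>, s)) * indicator {s. 0 < ennreal s} s)"
        proof (cases "0 < s")
          case True
          have "\<mu> s \<omega> - \<mu> 0 \<omega> \<le> b" using bound[of s] nn[OF \<omega>, of 0] True by simp
          then have "?c \<omega> s \<le> b * (\<delta> * exp (- \<delta> * s))" using True delta_pos by (simp add: mult.commute)
          then show ?thesis using True b(2) delta_pos by (simp add: decay_def ennreal_mult[symmetric] ennreal_leI)
        next
          case False
          then show ?thesis by (cases "s = 0") (auto simp: indicator_def)
        qed
      qed
      also have "\<dots> = ennreal b * (\<integral>\<^sup>+s. ennreal (decay (\<omega>, s)) * indicator {s. 0 < ennreal s} s \<partial>lborel)"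
      proof (rule nn_integral_cmult)
        show "(\<lambda>s. ennreal (decay (\<omega>, s)) * indicator {s. 0 < ennreal s} s) \<in> borel_measurable lborel"
          unfolding decay_def snd_conv by measurable
      qed
      also have "\<dots> < \<infinity>" unfolding decay_nn_integral by (simp add: ennreal_mult_less_top)
      finally show "(\<integral>\<^sup>+s. ennreal (?c \<omega> s) \<partial>lborel) < \<infinity>" .
    qed (use c_nn in simp)
    have p_int: "integrable lborel (\<lambda>s. payoff \<mu> (\<omega>, s))" using elim(4) by simp
    have d_int: "integrable lborel (\<lambda>s. decay (\<omega>, s))" and d_val: "(\<integral>s. decay (\<omega>, s) \<partial>lborel) = 1"
    proof -
      have dm: "(\<lambda>s. decay (\<omega>, s)) \<in> borel_measurable lborel" unfolding decay_def snd_conv by measurable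
      have "(\<integral>\<^sup>+s. ennreal (decay (\<omega>, s)) \<partial>lborel) = (\<integral>\<^sup>+s. ennreal (decay (\<omega>, s)) * indicator {s. 0 < ennreal s} s \<partial>lborel)"
        by (intro nn_integral_cong) (auto simp: decay_def indicator_def)
      also have "\<dots> = 1" unfolding decay_nn_integral by (simp add: discount_def)
      finally have v: "(\<integral>\<^sup>+s. ennreal (decay (\<omega>, s)) \<partial>lborel) = 1" .
      show "integrable lborel (\<lambda>s. decay (\<omega>, s))" using dm decay_nonneg v by (intro integrableI_nonneg) auto
      show "(\<integral>s. decay (\<omega>, s) \<partial>lborel) = 1" using dm decay_nonneg v by (subst integral_eq_nn_integral) auto
    qed
    \<comment> \<open>The rent \<delta> times \<mu> splits into \<delta> times the increase since
      time 0, which is the cost after integration by parts, and \<delta> times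
      \<open>\<mu> 0 = y\<close>. The latter integrates to the additive constant
      \<open>y\<close>.\<close>
    have r_AE: "AE s in lborel. ?r \<omega> s = payoff \<mu> (\<omega>, s) + ?c \<omega> s + y * decay (\<omega>, s)"
    proof -
      have "AE s in lborel. s \<noteq> (0::real)" by (rule AE_lborel_singleton)
      then show ?thesis by eventually_elim (auto simp: indicator_def decay_def elim(1) algebra_simps)
    qed
    have rm: "?r \<omega> \<in> borel_measurable lborel"
    proof -
      have "payoff \<mu> \<in> borel_measurable Q" using int by (rule borel_measurable_integrable)
      let ?g = "\<lambda>s. (X (max 0 s) \<omega>, \<mu> (max 0 s) \<omega>)"
      have "?g \<in> borel \<rightarrow>\<^sub>M borel \<Otimes>\<^sub>M borel" by (intro measurable_Pair X_path_measurable[OF \<omega>] \<mu>m)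
      from measurable_compose[OF this measurable_R]
      have "(\<lambda>s. if 0 < snd (?g s) then R (fst (?g s)) (snd (?g s)) else 0) \<in> borel_measurable borel" .
      then have "(\<lambda>s. indicator {0..} s *\<^sub>R (exp (- \<delta> * s) * (if 0 < snd (?g s) then R (fst (?g s)) (snd (?g s)) else 0))) \<in> borel_measurable borel"
        by measurable
      moreover have "(\<lambda>s. indicator {0..} s *\<^sub>R (exp (- \<delta> * s) * (if 0 < snd (?g s) then R (fst (?g s)) (snd (?g s)) else 0))) = ?r \<omega>"
      proof
        fix s
        have "0 \<le> s \<Longrightarrow> \<mu> s \<omega> = 0 \<or> 0 < \<mu> s \<omega>" using nn[OF \<omega>, of s] by auto
        then show "indicator {0..} s *\<^sub>R (exp (- \<delta> * s) * (if 0 < snd (?g s) then R (fst (?g s)) (snd (?g s)) else 0)) = ?r \<omega> s"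
          using R_zero by (auto simp: indicator_def)
      qed
      ultimately show ?thesis by simp
    qed
    have s_int: "integrable lborel (\<lambda>s. payoff \<mu> (\<omega>, s) + ?c \<omega> s + y * decay (\<omega>, s))"
      by (rule Bochner_Integration.integrable_add[OF Bochner_Integration.integrable_add[OF p_int c_int] integrable_mult_right[OF d_int]])
    have "(LINT t:{0..}|lborel. exp (- \<delta> * t) * R (X t \<omega>) (\<mu> t \<omega>)) = (\<integral>s. payoff \<mu> (\<omega>, s) + ?c \<omega> s + y * decay (\<omega>, s) \<partial>lborel)"
      unfolding set_lebesgue_integral_def by (rule integral_cong_AE[OF rm borel_measurable_integrable[OF s_int] r_AE])
    also have "\<dots> = (\<integral>s. payoff \<mu> (\<omega>, s) + ?c \<omega> s \<partial>lborel) + (\<integral>s. y * decay (\<omega>, s) \<partial>lborel)"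
      by (rule Bochner_Integration.integral_add[OF Bochner_Integration.integrable_add[OF p_int c_int] integrable_mult_right[OF d_int]])
    also have "(\<integral>s. payoff \<mu> (\<omega>, s) + ?c \<omega> s \<partial>lborel) = (\<integral>s. payoff \<mu> (\<omega>, s) \<partial>lborel) + (\<integral>s. ?c \<omega> s \<partial>lborel)"
      by (rule Bochner_Integration.integral_add[OF p_int c_int])
    also have "(\<integral>s. y * decay (\<omega>, s) \<partial>lborel) = y" by (simp add: d_val)
    finally show ?case unfolding cost by simp
  qed
  have meas: "(\<lambda>\<omega>. (\<integral>s. payoff \<mu> (\<omega>, s) \<partial>lborel) + y) \<in> borel_measurable M"
    using P.integrable_fst'[OF int] by (intro borel_measurable_add borel_measurable_const) (rule borel_measurable_integrable)
  \<comment> \<open>Measurability of the pathwise net profit comes from its almost sure equality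
    with a measurable function on a complete space.\<close>
  have "net_profit M \<delta> R X \<mu> = (\<integral>\<omega>. (\<integral>s. payoff \<mu> (\<omega>, s) \<partial>lborel) + y \<partial>M)"
    unfolding net_profit_def by (rule integral_cong_AE[OF measurable_AE_eq[OF meas AE_eq] meas AE_eq])
  also have "\<dots> = (\<integral>\<omega>. (\<integral>s. payoff \<mu> (\<omega>, s) \<partial>lborel) \<partial>M) + y"
    using P.integrable_fst'[OF int] by (subst Bochner_Integration.integral_add) (auto simp: prob_space)
  also have "\<dots> = (\<integral>p. payoff \<mu> p \<partial>Q) + y" by (simp only: P.integral_fst'[OF int])
  finally show ?thesis .
qed

section \<open>Decomposition of capacities into levels\<close>

lemma stopping_level_time:
  assumes ad: "adapted F \<mu>" and lc: "\<And>\<omega>. \<omega> \<in> space M \<Longrightarrow> nondecreasing_left_cont (\<lambda>t. \<mu> t \<omega>)"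
  shows "stopping_time F (\<lambda>\<omega>. level_time (\<lambda>t. \<mu> t \<omega>) c)"
proof (rule stopping_timeI_less)
  fix t :: real assume t: "0 < t"
  have "{\<omega>\<in>space M. level_time (\<lambda>t. \<mu> t \<omega>) c < ennreal t} = {\<omega>\<in>space (F (ennreal t)). c < \<mu> t \<omega>}"
    using level_time_less_iff[OF lc] t by (auto simp: space_F)
  moreover have "\<mu> t \<in> borel_measurable (F (ennreal t))" using ad t unfolding adapted_def by auto
  ultimately show "{\<omega>\<in>space M. level_time (\<lambda>t. \<mu> t \<omega>) c < ennreal t} \<in> sets (F (ennreal t))" by simp
qed

text \<open>The length of the set of levels in \<open>[y,n]\<close> below \<mu>. The cut at
  \<open>n\<close> keeps products with \<open>gain\<close> and \<open>k\<close> integrable.\<close>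

definition layers :: "(real \<Rightarrow> 'a \<Rightarrow> real) \<Rightarrow> nat \<Rightarrow> 'a \<times> real \<Rightarrow> real" where
  "layers \<mu> n p = (if 0 < snd p then max 0 (min (\<mu> (snd p) (fst p)) (real n) - y) else 0)"

lemma layers_measurable:
  assumes "progressive F \<mu>" shows "layers \<mu> n \<in> borel_measurable Q"
proof -
  have "(\<lambda>p. if 0 < snd p then max 0 (min (\<mu> (max 0 (snd p)) (fst p)) (real n) - y) else 0) \<in> borel_measurable Q"
    using progressive_measurable_Q[OF assms] by measurable
  moreover have "(\<lambda>p. if 0 < snd p then max 0 (min (\<mu> (max 0 (snd p)) (fst p)) (real n) - y) else 0) = layers \<mu> n"
    by (auto simp: layers_def)
  ultimately show ?thesis by simp
qed

lemma layers_bounds: "0 \<le> layers \<mu> n p" "y \<le> real n \<Longrightarrow> layers \<mu> n p \<le> real n - y"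
  unfolding layers_def by auto

lemma layers_integrable:
  fixes D :: "'a \<times> real \<Rightarrow> real"
  assumes "progressive F \<mu>" "integrable Q D" "y \<le> real n"
  shows "integrable Q (\<lambda>p. D p * layers \<mu> n p)"
proof (rule Bochner_Integration.integrable_bound)
  show "integrable Q (\<lambda>p. D p * (real n - y))" using assms(2) by simp
  show "(\<lambda>p. D p * layers \<mu> n p) \<in> borel_measurable Q"
    by (intro borel_measurable_times borel_measurable_integrable[OF assms(2)] layers_measurable[OF assms(1)])
  show "AE p in Q. norm (D p * layers \<mu> n p) \<le> norm (D p * (real n - y))"
    using layers_bounds[where \<mu>=\<mu> and n=n] assms(3) by (intro AE_I2) (auto simp: abs_mult intro!: mult_left_mono)
qed

text \<open>Layer cake and Fubini: a level \<open>c\<close> lies below \<mu> at time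
  \<open>s\<close> exactly if its level time precedes \<open>s\<close>, so each level contributes
  the integral of \<open>D\<close> over the ray from its level time.\<close>

lemma layer_integral:
  fixes D :: "'a \<times> real \<Rightarrow> real"
  assumes ad: "adapted F \<mu>" and lc: "\<And>\<omega>. \<omega> \<in> space M \<Longrightarrow> nondecreasing_left_cont (\<lambda>t. \<mu> t \<omega>)"
    and D: "integrable Q D" and n: "y \<le> real n"
  shows "(\<integral>p. D p * layers \<mu> n p \<partial>Q) =
    (\<integral>c. indicator {y..real n} c * (\<integral>p\<in>stochastic_ray (space M) (\<lambda>\<omega>. level_time (\<lambda>t. \<mu> t \<omega>) c). D p \<partial>Q) \<partial>lborel)"
proof -
  interpret P: pair_sigma_finite M "lborel :: real measure" ..
  interpret QS: sigma_finite_measure Q ..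
  interpret PQ: pair_sigma_finite Q "lborel :: real measure" ..
  note Dm[measurable] = borel_measurable_integrable[OF D]
  have pr: "progressive F \<mu>" by (rule progressive_left_continuous[OF ad lc])
  let ?lt = "\<lambda>p c. level_time (\<lambda>t. \<mu> t (fst p)) c"
  let ?I = "\<lambda>p c. if c \<in> {y..real n} \<and> ?lt p c < ennreal (snd p) then 1 else 0 :: real"
  have lt[measurable]: "(\<lambda>x. ?lt (fst x) (snd x)) \<in> borel_measurable (Q \<Otimes>\<^sub>M lborel)"
  proof (rule measurable_level_time)
    show "x \<in> space (Q \<Otimes>\<^sub>M lborel) \<Longrightarrow> nondecreasing_left_cont (\<lambda>t. \<mu> t (fst (fst x)))" for x :: "('a \<times> real) \<times> real"
      by (rule lc) (auto simp: space_pair_measure)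
    fix t :: real assume t: "0 \<le> t"
    have [measurable]: "\<mu> t \<in> borel_measurable M"
    proof (rule measurable_from_subalg[OF subalgebra_F])
      show "\<mu> t \<in> borel_measurable (F (ennreal t))" using ad t unfolding adapted_def by simp
    qed
    show "(\<lambda>x. \<mu> t (fst (fst x))) \<in> borel_measurable (Q \<Otimes>\<^sub>M (lborel :: real measure))" by measurable
  qed measurable
  have Im[measurable]: "(\<lambda>x. ?I (fst x) (snd x)) \<in> borel_measurable (Q \<Otimes>\<^sub>M lborel)"
    by measurable
  have I_set: "?I p = indicator (if 0 < snd p then {y..real n} \<inter> {..<\<mu> (snd p) (fst p)} else {})" if p: "p \<in> space Q" for p
  proof
    fix c
    have \<omega>: "fst p \<in> space M" using p by (auto simp: space_pair_measure)
    show "?I p c = indicator (if 0 < snd p then {y..real n} \<inter> {..<\<mu> (snd p) (fst p)} else {}) c"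
      using level_time_less_iff[OF lc[OF \<omega>], of "snd p" c] positive_time[of "?lt p c" "snd p"]
      by (auto simp: indicator_def)
  qed
  have meas: "emeasure lborel (if 0 < snd p then {y..real n} \<inter> {..<\<mu> (snd p) (fst p)} else {}) = ennreal (layers \<mu> n p)" for p
  proof (cases "0 < snd p")
    case True
    show ?thesis
    proof (cases "real n < \<mu> (snd p) (fst p)")
      case True
      then have "{y..real n} \<inter> {..<\<mu> (snd p) (fst p)} = {y..real n}" by auto
      then show ?thesis using True n \<open>0 < snd p\<close> by (simp add: layers_def)
    next
      case False
      then have "{y..real n} \<inter> {..<\<mu> (snd p) (fst p)} = {y..<\<mu> (snd p) (fst p)}" by auto
      then show ?thesis using False \<open>0 < snd p\<close>
        by (cases "y \<le> \<mu> (snd p) (fst p)") (auto simp: layers_def min_def max_def)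
    qed
  qed (simp add: layers_def)
  have I_int: "integrable lborel (?I p)" "(\<integral>c. ?I p c \<partial>lborel) = layers \<mu> n p" if p: "p \<in> space Q" for p
    unfolding I_set[OF p] using meas[of p] layers_bounds(1)[of \<mu> n p]
    by (auto simp: measure_def less_top[symmetric] intro!: integrable_real_indicator)
  have f: "integrable (Q \<Otimes>\<^sub>M lborel) (\<lambda>(p, c). D p * ?I p c)"
  proof (rule PQ.Fubini_integrable)
    show m: "(\<lambda>(p, c). D p * ?I p c) \<in> borel_measurable (Q \<Otimes>\<^sub>M lborel)"
      unfolding case_prod_beta by (intro borel_measurable_times Im) measurable
    have "(\<integral>c. norm (case (p, c) of (p, c) \<Rightarrow> D p * ?I p c) \<partial>lborel) = \<bar>D p\<bar> * layers \<mu> n p" if "p \<in> space Q" for p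
    proof -
      have "(\<integral>c. norm (case (p, c) of (p, c) \<Rightarrow> D p * ?I p c) \<partial>lborel) = (\<integral>c. \<bar>D p\<bar> * ?I p c \<partial>lborel)"
        by (intro Bochner_Integration.integral_cong) (auto simp: abs_mult)
      then show ?thesis using I_int[OF that] by simp
    qed
    then have "integrable Q (\<lambda>p. \<integral>c. norm (case (p, c) of (p, c) \<Rightarrow> D p * ?I p c) \<partial>lborel) \<longleftrightarrow> integrable Q (\<lambda>p. \<bar>D p\<bar> * layers \<mu> n p)"
      by (intro Bochner_Integration.integrable_cong) auto
    then show "integrable Q (\<lambda>p. \<integral>c. norm (case (p, c) of (p, c) \<Rightarrow> D p * ?I p c) \<partial>lborel)"
      using layers_integrable[OF pr integrable_abs[OF D] n] by simp
    show "AE p in Q. integrable lborel (\<lambda>c. case (p, c) of (p, c) \<Rightarrow> D p * ?I p c)"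
      using I_int(1) by (intro AE_I2) simp
  qed
  have "(\<integral>p. D p * layers \<mu> n p \<partial>Q) = (\<integral>p. \<integral>c. D p * ?I p c \<partial>lborel \<partial>Q)"
    using I_int(2) by (intro Bochner_Integration.integral_cong) auto
  also have "\<dots> = (\<integral>c. \<integral>p. D p * ?I p c \<partial>Q \<partial>lborel)"
    by (rule PQ.Fubini_integral[OF f, symmetric])
  also have "\<dots> = (\<integral>c. indicator {y..real n} c * (\<integral>p\<in>stochastic_ray (space M) (\<lambda>\<omega>. level_time (\<lambda>t. \<mu> t \<omega>) c). D p \<partial>Q) \<partial>lborel)"
  proof (rule Bochner_Integration.integral_cong[OF refl])
    fix c
    have "(\<integral>p. D p * ?I p c \<partial>Q) = (\<integral>p. indicator {y..real n} c * (indicator (stochastic_ray (space M) (\<lambda>\<omega>. level_time (\<lambda>t. \<mu> t \<omega>) c)) p *\<^sub>R D p) \<partial>Q)"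
      by (intro Bochner_Integration.integral_cong) (auto simp: indicator_def stochastic_ray_def space_pair_measure)
    then show "(\<integral>p. D p * ?I p c \<partial>Q) = indicator {y..real n} c * (\<integral>p\<in>stochastic_ray (space M) (\<lambda>\<omega>. level_time (\<lambda>t. \<mu> t \<omega>) c). D p \<partial>Q)"
      by (simp add: set_lebesgue_integral_def)
  qed
  finally show ?thesis .
qed

lemma space_in_pre_sigma: "space M \<in> sets (pre_sigma \<tau>)"
  using sets.top[of "pre_sigma \<tau>"] by (simp add: space_pre_sigma)

lemma ray_difference:
  assumes \<tau>: "stopping_time F \<tau>"
  shows "(\<integral>p\<in>stochastic_ray (space M) \<tau>. gain p - k p \<partial>Q) =
    (\<integral>p\<in>stochastic_ray (space M) \<tau>. gain p \<partial>Q) - (\<integral>p\<in>stochastic_ray (space M) \<tau>. k p \<partial>Q)"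
  using stochastic_ray_sets[OF sets.top stopping_time_measurable[OF \<tau>]]
  by (intro set_integral_diff(2) set_integrable_Q gain_integrable k_integrable)

text \<open>Each level time of \<mu> is a stopping time, and on the ray from it the integral of
  \<open>gain\<close> is at most that of \<open>k\<close>.\<close>

lemma surplus_layers_le:
  assumes ad: "adapted F \<mu>" and lc: "\<And>\<omega>. \<omega> \<in> space M \<Longrightarrow> nondecreasing_left_cont (\<lambda>t. \<mu> t \<omega>)" and n: "y \<le> real n"
  shows "(\<integral>p. (gain p - k p) * layers \<mu> n p \<partial>Q) \<le> 0"
proof -
  have i: "integrable Q (\<lambda>p. gain p - k p)" using gain_integrable k_integrable by (rule Bochner_Integration.integrable_diff)
  have "(\<integral>p\<in>stochastic_ray (space M) (\<lambda>\<omega>. level_time (\<lambda>t. \<mu> t \<omega>) c). gain p - k p \<partial>Q) \<le> 0" for c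
    using ray_difference[OF stopping_level_time[OF ad lc]] gain_ray_le[OF stopping_level_time[OF ad lc] space_in_pre_sigma] by simp
  then have "0 \<le> (\<integral>c. - (indicator {y..real n} c * (\<integral>p\<in>stochastic_ray (space M) (\<lambda>\<omega>. level_time (\<lambda>t. \<mu> t \<omega>) c). gain p - k p \<partial>Q)) \<partial>lborel)"
    by (intro Bochner_Integration.integral_nonneg) (auto simp: indicator_def)
  then show ?thesis by (subst layer_integral[OF ad lc i n]) simp_all
qed

text \<open>The level times of \<nu> itself satisfy \<open>increase_time\<close>, so every level
  contributes 0.\<close>

lemma surplus_layers_nu:
  assumes n: "y \<le> real n"
  shows "(\<integral>p. (gain p - k p) * layers \<nu> n p \<partial>Q) = 0"
proof -
  have i: "integrable Q (\<lambda>p. gain p - k p)" using gain_integrable k_integrable by (rule Bochner_Integration.integrable_diff)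
  have "(\<integral>p\<in>stochastic_ray (space M) (\<lambda>\<omega>. level_time (\<lambda>t. \<nu> t \<omega>) c). gain p - k p \<partial>Q) = 0" if "y \<le> c" for c
    using ray_difference[OF stopping_level_time[OF nu_adapted nu_left_cont]] gain_ray_eq[OF increase_time_level[OF that] space_in_pre_sigma] by simp
  then have "(\<integral>c. indicator {y..real n} c * (\<integral>p\<in>stochastic_ray (space M) (\<lambda>\<omega>. level_time (\<lambda>t. \<nu> t \<omega>) c). gain p - k p \<partial>Q) \<partial>lborel) = (\<integral>c. 0 \<partial>(lborel :: real measure))"
    by (intro Bochner_Integration.integral_cong) (auto simp: indicator_def)
  then show ?thesis by (subst layer_integral[OF nu_adapted nu_left_cont i n]) simp_all
qed

lemma gain_eq: "0 < snd p \<Longrightarrow> gain p = exp (- \<delta> * snd p) * (deriv (R (X (snd p) (fst p))) (\<nu> (snd p) (fst p)) - \<delta>)"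
  by (simp add: gain_def flow_def decay_def marginal_flow_def algebra_simps)

text \<open>Concavity reduces the claim to the integral of \<open>gain\<close> against \<mu> minus
  \<nu>. With all capacities cut into layers up to \<open>n\<close>, the chain is:
  \<open>gain\<close> against \<mu> is at most \<open>k\<close> against \<mu>, which is at most
  \<open>k\<close> against \<nu>, which equals \<open>gain\<close> against \<nu>. Then
  \<open>n\<close> tends to infinity.\<close>

lemma optimality:
  assumes \<mu>: "\<mu> \<in> admissible M F \<theta> y"
  shows "net_profit M \<delta> R X \<mu> \<le> net_profit M \<delta> R X \<nu>"
proof -
  have ad: "adapted F \<mu>" and lc: "\<And>\<omega>. \<omega> \<in> space M \<Longrightarrow> nondecreasing_left_cont (\<lambda>t. \<mu> t \<omega>)"
    and nn: "\<And>\<omega> t. \<omega> \<in> space M \<Longrightarrow> 0 \<le> t \<Longrightarrow> 0 \<le> \<mu> t \<omega>" and zero: "AE \<omega> in M. \<mu> 0 \<omega> = y"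
    and le: "AE \<omega> in M. \<forall>t\<ge>0. \<mu> t \<omega> \<le> \<theta> t \<omega>"
    using \<mu> unfolding admissible_def by auto
  have pr: "progressive F \<mu>" using progressive_left_continuous[OF ad lc] .
  have int_nu: "integrable Q (payoff \<nu>)"
    by (rule payoff_integrable[OF nu_progressive less_imp_le[OF nu_pos]]) (auto intro: nu_le_theta)
  have int_mu: "integrable Q (payoff \<mu>)" by (rule payoff_integrable[OF pr nn le])
  define \<mu>n where "\<mu>n n = (\<lambda>t \<omega>. min (\<mu> t \<omega>) (real n))" for n :: nat
  have pr_n: "progressive F (\<mu>n n)" for n
    using pr unfolding progressive_def \<mu>n_def case_prod_beta by (intro allI impI borel_measurable_min) auto
  have le_n: "AE \<omega> in M. \<forall>t\<ge>0. \<mu>n n t \<omega> \<le> \<theta> t \<omega>" for n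
    using le by eventually_elim (auto simp: \<mu>n_def min_le_iff_disj)
  have int_n: "integrable Q (payoff (\<mu>n n))" for n
    by (rule payoff_integrable[OF pr_n _ le_n]) (use nn in \<open>auto simp: \<mu>n_def\<close>)
  \<comment> \<open>The payoff of \<nu> is not cut at \<open>n\<close>; this term pays for its
    levels above \<open>n\<close>. It is dominated by \<open>?bound\<close>, because the marginal
    profit times \<nu> is, and it tends to 0.\<close>
  define excess where "excess n p = \<bar>gain p\<bar> * (if 0 < snd p then max 0 (\<nu> (snd p) (fst p) - real n) else 0)" for n :: nat and p
  let ?bound = "\<lambda>p. profit_bound p + \<delta> * discounted_theta p"
  have bound_int: "integrable Q ?bound"
    by (intro Bochner_Integration.integrable_add profit_bound_integrable integrable_mult_right discounted_theta_integrable)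
  have sp: "fst p \<in> space M" if "p \<in> space Q" for p using that by (auto simp: space_pair_measure)
  have excess_m: "excess n \<in> borel_measurable Q" for n
  proof -
    have "(\<lambda>p. \<bar>gain p\<bar> * (if 0 < snd p then max 0 (\<nu> (max 0 (snd p)) (fst p) - real n) else 0)) \<in> borel_measurable Q"
      using progressive_measurable_Q[OF nu_progressive] by measurable
    moreover have "(\<lambda>p. \<bar>gain p\<bar> * (if 0 < snd p then max 0 (\<nu> (max 0 (snd p)) (fst p) - real n) else 0)) = excess n"
      by (auto simp: excess_def)
    ultimately show ?thesis by simp
  qed
  have excess_bound: "norm (excess n p) \<le> ?bound p" if p: "p \<in> space Q" for n p
  proof (cases "0 < snd p")
    case True
    have \<nu>p: "0 < \<nu> (snd p) (fst p)" using True sp[OF p] by (intro nu_pos) auto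
    have "norm (excess n p) \<le> \<bar>gain p\<bar> * \<nu> (snd p) (fst p)"
      unfolding excess_def using True \<nu>p by (auto simp: abs_mult intro!: mult_left_mono)
    also have "\<dots> \<le> (flow p + decay p) * \<nu> (snd p) (fst p)"
      using flow_nonneg[OF p] decay_nonneg[of p] \<nu>p unfolding gain_def by (intro mult_right_mono) auto
    also have "\<dots> \<le> profit_bound p + decay p * \<theta> (snd p) (fst p)"
      unfolding distrib_right
    proof (rule add_mono)
      show "flow p * \<nu> (snd p) (fst p) \<le> profit_bound p" using flow_le[OF p] True by simp
      show "decay p * \<nu> (snd p) (fst p) \<le> decay p * \<theta> (snd p) (fst p)"
        using True sp[OF p] by (intro mult_left_mono decay_nonneg nu_le_theta) auto
    qed
    also have "\<dots> = ?bound p" using True by (simp add: decay_def)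
    finally show ?thesis .
  next
    case False
    then show ?thesis using profit_bound_nonneg[OF p] by (simp add: excess_def)
  qed
  have excess_int: "integrable Q (excess n)" for n
  proof (rule Bochner_Integration.integrable_bound[OF bound_int excess_m])
    show "AE p in Q. norm (excess n p) \<le> norm (?bound p)"
      unfolding real_norm_def[of "?bound _"] by (rule AE_I2) (rule order_trans[OF excess_bound abs_ge_self])
  qed
  have excess_lim: "(\<lambda>n. \<integral>p. excess n p \<partial>Q) \<longlonglongrightarrow> (\<integral>p. 0 \<partial>Q)"
  proof (rule integral_dominated_convergence[where w = ?bound])
    show "AE p in Q. (\<lambda>n. excess n p) \<longlonglongrightarrow> 0"
    proof (rule AE_I2)
      fix p assume "p \<in> space Q"
      obtain N where N: "\<nu> (snd p) (fst p) \<le> real N" using real_arch_simple by blast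
      then have "eventually (\<lambda>n. excess n p = 0) sequentially"
        by (intro eventually_sequentiallyI[of N]) (auto simp: excess_def max_def)
      then show "(\<lambda>n. excess n p) \<longlonglongrightarrow> 0" by (rule tendsto_eventually)
    qed
  qed (use excess_m excess_bound bound_int in auto)
  have lim_n: "(\<lambda>n. \<integral>p. payoff (\<mu>n n) p \<partial>Q) \<longlonglongrightarrow> (\<integral>p. payoff \<mu> p \<partial>Q)"
  proof (rule integral_dominated_convergence[where w = ?bound])
    show "AE p in Q. (\<lambda>n. payoff (\<mu>n n) p) \<longlonglongrightarrow> payoff \<mu> p"
    proof (rule AE_I2)
      fix p assume "p \<in> space Q"
      obtain N where N: "\<mu> (snd p) (fst p) \<le> real N" using real_arch_simple by blast
      have "eventually (\<lambda>n. payoff (\<mu>n n) p = payoff \<mu> p) sequentially"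
      proof (rule eventually_sequentiallyI[of N])
        fix n assume "N \<le> n"
        then have "\<mu>n n (snd p) (fst p) = \<mu> (snd p) (fst p)" using N by (simp add: \<mu>n_def min_absorb1)
        then show "payoff (\<mu>n n) p = payoff \<mu> p" by simp
      qed
      then show "(\<lambda>n. payoff (\<mu>n n) p) \<longlonglongrightarrow> payoff \<mu> p" by (rule tendsto_eventually)
    qed
    fix n
    show "AE p in Q. norm (payoff (\<mu>n n) p) \<le> ?bound p"
      using AE_fst_Q[OF le_n[of n]] AE_space
    proof eventually_elim
      case (elim p)
      show ?case
      proof (cases "0 < snd p")
        case True
        let ?z = "\<mu>n n (snd p) (fst p)" and ?x = "X (snd p) (fst p)" and ?t = "\<theta> (snd p) (fst p)"
        have z: "0 \<le> ?z" "?z \<le> ?t"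
          using True nn[OF sp[OF elim(2)], of "snd p"] elim(1) by (auto simp: \<mu>n_def)
        have "\<bar>R ?x ?z - \<delta> * ?z\<bar> \<le> R ?x ?z + \<delta> * ?z" using z delta_pos R_nonneg[of ?z ?x] by (auto simp: abs_le_iff)
        also have "\<dots> \<le> R ?x ?t + \<delta> * ?t" using z delta_pos by (intro add_mono R_mono mult_left_mono) auto
        finally have "exp (- \<delta> * snd p) * \<bar>R ?x ?z - \<delta> * ?z\<bar> \<le> exp (- \<delta> * snd p) * (R ?x ?t + \<delta> * ?t)"
          by (intro mult_left_mono) auto
        moreover have "payoff (\<mu>n n) p = exp (- \<delta> * snd p) * (R ?x ?z - \<delta> * ?z)"
          using True by (simp add: right_diff_distrib)
        ultimately show ?thesis using True by (simp add: profit_bound_def abs_mult distrib_left mult.left_commute)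
      next
        case False
        then show ?thesis using profit_bound_nonneg[OF elim(2)] by simp
      qed
    qed
  qed (use int_mu int_n bound_int in \<open>auto dest: borel_measurable_integrable\<close>)
  have step: "(\<integral>p. payoff (\<mu>n n) p \<partial>Q) \<le> (\<integral>p. payoff \<nu> p \<partial>Q) + (\<integral>p. excess n p \<partial>Q)" if n: "y \<le> real n" for n
  proof -
    have iL: "integrable Q (\<lambda>p. gain p * layers \<mu> n p)" "integrable Q (\<lambda>p. gain p * layers \<nu> n p)"
      "integrable Q (\<lambda>p. k p * layers \<mu> n p)" "integrable Q (\<lambda>p. k p * layers \<nu> n p)"
      by (intro layers_integrable pr nu_progressive gain_integrable k_integrable n)+
    have "(\<integral>p. gain p * layers \<mu> n p \<partial>Q) - (\<integral>p. k p * layers \<mu> n p \<partial>Q) \<le> 0"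
      using surplus_layers_le[OF ad lc n] iL by (simp add: left_diff_distrib)
    moreover have "(\<integral>p. gain p * layers \<nu> n p \<partial>Q) - (\<integral>p. k p * layers \<nu> n p \<partial>Q) = 0"
      using surplus_layers_nu[OF n] iL by (simp add: left_diff_distrib)
    \<comment> \<open>Where \<open>k\<close> does not vanish, \<nu> has reached \<theta>, and \<mu>
      is below \<theta>.\<close>
    moreover have "(\<integral>p. k p * layers \<mu> n p \<partial>Q) \<le> (\<integral>p. k p * layers \<nu> n p \<partial>Q)"
    proof (rule integral_mono_AE[OF iL(3,4)])
      show "AE p in Q. k p * layers \<mu> n p \<le> k p * layers \<nu> n p"
        using k_complementary AE_fst_Q[OF le] AE_space
      proof eventually_elim
        case (elim p)
        show ?case
        proof (cases "0 < snd p \<and> k p \<noteq> 0")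
          case True
          then have "\<theta> (snd p) (fst p) \<le> \<nu> (snd p) (fst p)" using elim(1) by auto
          moreover have "\<mu> (snd p) (fst p) \<le> \<theta> (snd p) (fst p)" using elim(2) True by auto
          ultimately have "layers \<mu> n p \<le> layers \<nu> n p" unfolding layers_def by auto
          then show ?thesis using k_nonneg by (rule mult_left_mono)
        qed (auto simp: layers_def)
      qed
    qed
    ultimately have key: "(\<integral>p. gain p * layers \<mu> n p \<partial>Q) - (\<integral>p. gain p * layers \<nu> n p \<partial>Q) \<le> 0" by linarith
    have iR: "integrable Q (\<lambda>p. payoff \<nu> p + (gain p * layers \<mu> n p - gain p * layers \<nu> n p) + excess n p)"
      by (intro Bochner_Integration.integrable_add Bochner_Integration.integrable_diff int_nu iL excess_int)
    have "(\<integral>p. payoff (\<mu>n n) p \<partial>Q) \<le> (\<integral>p. payoff \<nu> p + (gain p * layers \<mu> n p - gain p * layers \<nu> n p) + excess n p \<partial>Q)"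
    proof (rule integral_mono_AE[OF int_n iR])
      show "AE p in Q. payoff (\<mu>n n) p \<le> payoff \<nu> p + (gain p * layers \<mu> n p - gain p * layers \<nu> n p) + excess n p"
        using AE_fst_Q[OF zero] AE_space
      proof eventually_elim
        case (elim p)
        show ?case
        proof (cases "0 < snd p")
          case True
          note \<omega> = sp[OF elim(2)]
          let ?e = "exp (- \<delta> * snd p)" and ?x = "X (snd p) (fst p)"
          let ?a = "\<nu> (snd p) (fst p)" and ?b = "\<mu>n n (snd p) (fst p)" and ?m = "\<mu> (snd p) (fst p)"
          have a: "y \<le> ?a" "0 < ?a" using True y_le_nu[OF \<omega>, of "snd p"] nu_pos[OF \<omega>, of "snd p"] by auto
          have m: "y \<le> ?m"
            using elim(1) lc[OF \<omega>] True mono_onD[of "{0..}" "\<lambda>t. \<mu> t (fst p)" 0 "snd p"]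
            unfolding nondecreasing_left_cont_def by auto
          have b: "0 \<le> ?b" using m n y_pos by (auto simp: \<mu>n_def)
          have "R ?x ?b \<le> R ?x ?a + deriv (R ?x) ?a * (?b - ?a)" by (rule R_tangent[OF a(2) b])
          then have "?e * (R ?x ?b - \<delta> * ?b) \<le> ?e * (R ?x ?a - \<delta> * ?a + (deriv (R ?x) ?a - \<delta>) * (?b - ?a))"
            by (intro mult_left_mono) (auto simp: algebra_simps)
          then have 1: "payoff (\<mu>n n) p \<le> payoff \<nu> p + gain p * (?b - ?a)"
            unfolding gain_eq[OF True] using True by (simp add: algebra_simps)
          \<comment> \<open>As \<mu>, \<nu> and \<open>n\<close> are all at least \<open>y\<close>,
            each capacity cut at \<open>n\<close> is \<open>y\<close> plus its layers, and the
            constant drops out.\<close>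
          have eq: "?b - ?a = layers \<mu> n p - layers \<nu> n p - max 0 (?a - real n)"
            using a m n True unfolding layers_def \<mu>n_def by (auto simp: min_def max_def)
          have "gain p * (?b - ?a) = (gain p * layers \<mu> n p - gain p * layers \<nu> n p) - gain p * max 0 (?a - real n)"
            unfolding eq by (simp add: algebra_simps)
          also have "- gain p * max 0 (?a - real n) \<le> \<bar>gain p\<bar> * max 0 (?a - real n)"
            by (intro mult_right_mono) auto
          then have "(gain p * layers \<mu> n p - gain p * layers \<nu> n p) - gain p * max 0 (?a - real n) \<le>
              (gain p * layers \<mu> n p - gain p * layers \<nu> n p) + excess n p"
            using True by (simp add: excess_def)
          finally show ?thesis using 1 by linarith
        qed (simp add: layers_def excess_def)
      qed
    qed
    also have "\<dots> = (\<integral>p. payoff \<nu> p \<partial>Q) + ((\<integral>p. gain p * layers \<mu> n p \<partial>Q) - (\<integral>p. gain p * layers \<nu> n p \<partial>Q)) + (\<integral>p. excess n p \<partial>Q)"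
      unfolding Bochner_Integration.integral_add[OF Bochner_Integration.integrable_add[OF int_nu Bochner_Integration.integrable_diff[OF iL(1,2)]] excess_int]
        Bochner_Integration.integral_add[OF int_nu Bochner_Integration.integrable_diff[OF iL(1,2)]]
        Bochner_Integration.integral_diff[OF iL(1,2)] ..
    finally show ?thesis using key by linarith
  qed
  obtain N where N: "y \<le> real N" using real_arch_simple by blast
  have "(\<integral>p. payoff \<mu> p \<partial>Q) \<le> (\<integral>p. payoff \<nu> p \<partial>Q) + (\<integral>p. 0 \<partial>Q)"
  proof (rule LIMSEQ_le[OF lim_n tendsto_add[OF tendsto_const excess_lim]])
    show "\<exists>N. \<forall>n\<ge>N. (\<integral>p. payoff (\<mu>n n) p \<partial>Q) \<le> (\<integral>p. payoff \<nu> p \<partial>Q) + (\<integral>p. excess n p \<partial>Q)"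
      using step N by (intro exI[of _ N] allI impI) (auto intro: order_trans)
  qed
  then show ?thesis unfolding net_profit_eq[OF \<mu>] net_profit_eq[OF nu_admissible] by simp
qed

end

theorem theorem4p2:
  fixes M :: "'a measure" and F :: "ennreal \<Rightarrow> 'a measure"
    and \<delta> y \<theta>\<^sub>o :: real
    and \<theta> X l :: "real \<Rightarrow> 'a \<Rightarrow> real"
    and R :: "real \<Rightarrow> real \<Rightarrow> real"
  assumes "prob_space M" and "complete_measure M" and "usual_conditions M F"
    and "\<delta> > 0" and "y > 0"
    and "resource_process M F \<theta> \<theta>\<^sub>o"
    and "progressive F X"
    and "profit_function R"
    and "integrable (M \<Otimes>\<^sub>M restrict_space lborel {0..})
           (\<lambda>(\<omega>, t). exp (- \<delta> * t) * R (X t \<omega>) (\<theta> t \<omega>))"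
    and "admissible M F \<theta> y \<noteq> {}"
    and "base_capacity M F \<delta> R X l"
  shows "optimal M F \<delta> R X \<theta> y (nu_star l \<theta> y) \<and>
    (\<exists>\<kappa>. optional_random_measure M F \<kappa> \<and>
       (\<integral>\<^sup>+\<omega>. emeasure (\<kappa> \<omega>) {0..} \<partial>M) < \<infinity> \<and>
       (AE \<omega> in M. absolutely_continuous lborel (\<kappa> \<omega>)) \<and>
       (\<forall>\<tau>. stopping_time F \<tau> \<longrightarrow>
          (AE \<omega> in M. supergradient_at M F \<delta> R X (nu_star l \<theta> y) \<tau> \<omega> \<le> expected_tail_at M F \<kappa> \<tau> \<omega>)) \<and>
       (\<forall>G \<Lambda>. optional_version M F (supergradient_at M F \<delta> R X (nu_star l \<theta> y)) G \<longrightarrow>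
          optional_version M F (expected_tail_at M F \<kappa>) \<Lambda> \<longrightarrow>
          (AE \<omega> in M. set_integrable (left_stieltjes (\<lambda>t. nu_star l \<theta> y t \<omega>)) {0..} (\<lambda>t. G t \<omega> - \<Lambda> t \<omega>) \<and>
             (LINT t:{0..}|left_stieltjes (\<lambda>t. nu_star l \<theta> y t \<omega>). G t \<omega> - \<Lambda> t \<omega>) = 0)) \<and>
       (AE \<omega> in M. \<forall>t\<ge>0. nu_star l \<theta> y t \<omega> \<le> \<theta> t \<omega>) \<and>
       (\<integral>\<^sup>+\<omega>. (\<integral>\<^sup>+t\<in>{0..}. ennreal (\<theta> t \<omega> - nu_star l \<theta> y t \<omega>) \<partial>\<kappa> \<omega>) \<partial>M) = 0)"
proof -
  interpret prob_space M by fact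
  interpret complete_measure M by fact
  interpret investment M F R \<delta> y \<theta>\<^sub>o \<theta> X l
    by unfold_locales (use assms in auto)
  obtain k :: "'a \<times> real \<Rightarrow> real" where k: "k \<in> borel_measurable (predictable M F)" "integrable Q k"
    "\<And>p. 0 \<le> k p" "\<And>p. snd p \<le> 0 \<Longrightarrow> k p = 0"
    "\<And>\<omega>. \<omega> \<in> space M \<Longrightarrow> (\<integral>\<^sup>+s. ennreal (k (\<omega>, s)) \<partial>lborel) < \<infinity>"
    "\<And>\<tau> A. stopping_time F \<tau> \<Longrightarrow> A \<in> sets (pre_sigma \<tau>) \<Longrightarrow>
       (\<integral>p\<in>stochastic_ray A \<tau>. k p \<partial>Q) = (\<integral>p\<in>stochastic_ray A (next_binding \<tau>). gain p \<partial>Q)"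
    using multiplier_density by blast
  interpret investment_multiplier M F R \<delta> y \<theta>\<^sub>o \<theta> X l k
    by unfold_locales (use k in auto)
  have "optimal M F \<delta> R X \<theta> y \<nu>"
    unfolding optimal_def using nu_admissible optimality by blast
  moreover have "AE \<omega> in M. \<forall>t\<ge>0. \<nu> t \<omega> \<le> \<theta> t \<omega>"
    using nu_le_theta by (intro AE_I2) blast
  ultimately show ?thesis
    using multiplier_random_measure multiplier_finite multiplier_absolutely_continuous supergradient_le slackness
      multiplier_complementary
    by (intro conjI exI[of _ multiplier]) blast+
qed

end
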